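(* Let $\alpha\in[0,1]$ and $4\le n\le 10$. Let $k=\lceil n/2\rceil$ and let $s_{2i-1}=s_{2i}=\frac{2i-1}{2k}$ for $i\in\{1,\dots,k\}$. Let $\mathsf{s}_{\mathrm{pair}}=(s_1,\dots,s_n)$ if $n=2k$ is even, and $\mathsf{s}_{\mathrm{pair}}=(s_1,\dots,s_{k-1},s_k,s_{k+2},\dots,s_{n+1})$ (i.e. the entry $s_{k+1}$ of $(s_1,\dots,s_{2k})$ is omitted) if $n=2k-1$ is odd. Then in the game with $n$ facilities and parameter $\alpha$, the locations $\mathsf{s}_{\mathrm{pair}}$ (together with the induced client equilibria) yield a $\rho_n$-SPE, where $$\rho_4=\frac{4+\alpha-\alpha^2}{4},$$ $$\rho_5=\frac{(4+\alpha)(\alpha(\alpha(3+\alpha)-3)-4)}{(2+\alpha)(\alpha(5\alpha-2)-8)},$$ $$\rho_6=\frac{\alpha(4-\alpha(\alpha-7))-16}{2(\alpha(4+\alpha)-8)},$$ $$\rho_7=\frac{(64-64\alpha+7\alpha^3)(16+\alpha(2+\alpha)(\alpha(\alpha-3)-2))}{2(32+\alpha(\alpha(\alpha-10)-16))(16+\alpha(\alpha-16+\alpha^2))},$$ $$\rho_8=\frac{64-\alpha(48+\alpha(24+(\alpha-17)\alpha))}{4(16+\alpha(\alpha-16+\alpha^2))},$$ $$\rho_9=\frac{(32+(\alpha-4)\alpha(2+\alpha)(1+2\alpha))(\alpha(4+3\alpha)-16)}{(\alpha-2)(4+\alpha)(64+\alpha(\alpha(\alpha-24)-32))},$$ $$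\rho_{10}=\frac{\alpha(320-\alpha(\alpha(120+(\alpha-31)\alpha)-16))-256}{2(\alpha(\alpha-4)(\alpha(4+3\alpha)-48)-128)}.$$
   Context: The game with parameters $n\ge 1$ and $\alpha\in[0,1]$: there are $n$ facility players $\{1,\dots,n\}$, each choosing a location $s_i\in[0,1]$; a facility location vector is $\mathsf{s}=(s_1,\dots,s_n)\in[0,1]^n$, and $(\mathsf{s}_{-i},s_i')$ is $\mathsf{s}$ with $s_i$ replaced by $s_i'$. The clients are the points $z\in[0,1]$. A client mapping is a function $\mathsf{f}:[0,1]^n\times[0,1]\to\{1,\dots,n\}$; client $z$ uses facility $\mathsf{f}(\mathsf{s},z)$. Only measurable mappings are considered: for every $\mathsf{s}$ and $i$, the set $\{z:\mathsf{f}(\mathsf{s},z)=i\}$ is a finite union of disjoint intervals; its total length is the load $\ell_i(\mathsf{s},\mathsf{f})$. The cost of client $z$ is $C_z(\mathsf{s},\mathsf{f})=(1-\alpha)|s_{\mathsf{f}(\mathsf{s},z)}-z|+\alpha\,\ell_{\mathsf{f}(\mathsf{s},z)}(\mathsf{s},\mathsf{f})$. The utility of facility $i$ is $u_i(\mathsf{s},\mathsf{f})=\ell_i(\mathsf{s},\mathsf{f})$. $\mathsf{f}(\mathsf{t},\cdot)$ is a client equilibrium if for all $z\in[0,1]$ and all $j$, $(1-\alpha)|t_{\mathsf{f}(\mathsf{t},z)}-z|+\alpha\ell_{\mathsf{f}(\mathsf{t},z)}(\mathsf{t},\mathsf{f})\le(1-\alpha)|t_j-z|+\alpha\ell_j(\mathsf{t},\mathsf{f})$.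 A pair $(\mathsf{s},\mathsf{f})$ is a $\rho$-SPE if (1) for all $i$ and all $s_i'\in[0,1]$, $\rho\cdot u_i(\mathsf{s},\mathsf{f})\ge u_i((\mathsf{s}_{-i},s_i'),\mathsf{f})$; and (2) $\mathsf{f}(\mathsf{t},\cdot)$ is a client equilibrium for every $\mathsf{t}\in[0,1]^n$. Induced client equilibrium: after renaming facilities so that $s_1\le\dots\le s_n$, a client equilibrium is proper if $[0,1]$ is partitioned (up to endpoints) into consecutive intervals $[\beta_{i-1},\beta_i]$, $\beta_0=0$, $\beta_n=1$, with facility $i$ serving $[\beta_{i-1},\beta_i]$. It is assumed that for every location vector the clients are in the unique proper client equilibrium (for $\alpha>0$ all client equilibria for a given location vector induce the same loads). For $\alpha=0$, where clients are indifferent between co-located facilities, co-located facilities share equally the interval of clients nearest to their common location. *)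

theory Defs
  imports "HOL-Analysis.Analysis" "HOL-Library.Disjoint_Sets" "HOL-Combinatorics.Permutations"
begin

text \<open>
  Two-stage facility location game on the unit interval. Players are numbered \<open>1, \<dots>, n\<close>.
  A location vector is an extensional function, so that a client mapping depends on the entries
  \<open>1, \<dots>, n\<close> only, and \<open>s(i := x)\<close> is the vector \<open>s\<close> with its \<open>i\<close>-th entry replaced by \<open>x\<close>.
\<close>

definition locations :: "nat \<Rightarrow> (nat \<Rightarrow> real) set" where
  "locations n = {1..n} \<rightarrow>\<^sub>E {0..1}"

type_synonym mapping = "(nat \<Rightarrow> real) \<Rightarrow> real \<Rightarrow> nat"

definition clients_of :: "(nat \<Rightarrow> real) \<Rightarrow> mapping \<Rightarrow> nat \<Rightarrow> real set" where
  "clients_of s f i = {z \<in> {0..1}. f s z = i}"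

definition finite_interval_union :: "real set \<Rightarrow> bool" where
  "finite_interval_union A \<longleftrightarrow>
     (\<exists>I. finite I \<and> disjoint I \<and> (\<forall>J\<in>I. is_interval J) \<and> A = \<Union>I)"

definition client_mapping :: "nat \<Rightarrow> mapping \<Rightarrow> bool" where
  "client_mapping n f \<longleftrightarrow>
     (\<forall>s\<in>locations n. (\<forall>z\<in>{0..1}. f s z \<in> {1..n}) \<and>
        (\<forall>i\<in>{1..n}. finite_interval_union (clients_of s f i)))"

definition load :: "(nat \<Rightarrow> real) \<Rightarrow> mapping \<Rightarrow> nat \<Rightarrow> real" where
  "load s f i = measure lborel (clients_of s f i)"

definition facility_cost ::
    "real \<Rightarrow> (nat \<Rightarrow> real) \<Rightarrow> mapping \<Rightarrow> real \<Rightarrow> nat \<Rightarrow> real" where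
  "facility_cost \<alpha> s f z j = (1 - \<alpha>) * \<bar>s j - z\<bar> + \<alpha> * load s f j"

definition client_cost :: "real \<Rightarrow> (nat \<Rightarrow> real) \<Rightarrow> mapping \<Rightarrow> real \<Rightarrow> real" where
  "client_cost \<alpha> s f z = facility_cost \<alpha> s f z (f s z)"

text \<open>The clients are a continuum, so a client switching to \<open>j\<close> does not change the load of \<open>j\<close>.\<close>

definition client_equilibrium ::
    "nat \<Rightarrow> real \<Rightarrow> (nat \<Rightarrow> real) \<Rightarrow> mapping \<Rightarrow> bool" where
  "client_equilibrium n \<alpha> s f \<longleftrightarrow>
     (\<forall>z\<in>{0..1}. \<forall>j\<in>{1..n}. client_cost \<alpha> s f z \<le> facility_cost \<alpha> s f z j)"

definition utility :: "(nat \<Rightarrow> real) \<Rightarrow> mapping \<Rightarrow> nat \<Rightarrow> real" where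
  "utility s f i = load s f i"

definition approx_SPE ::
    "nat \<Rightarrow> real \<Rightarrow> real \<Rightarrow> (nat \<Rightarrow> real) \<Rightarrow> mapping \<Rightarrow> bool" where
  "approx_SPE n \<alpha> \<rho> s f \<longleftrightarrow>
     s \<in> locations n \<and> client_mapping n f \<and>
     (\<forall>i\<in>{1..n}. \<forall>x\<in>{0..1}. \<rho> * utility s f i \<ge> utility (s(i := x)) f i) \<and>
     (\<forall>t\<in>locations n. client_equilibrium n \<alpha> t f)"

text \<open>
  The permutation \<open>p\<close> renames the facilities so that the locations \<open>s (p 1) \<le> \<dots> \<le> s (p n)\<close>
  are sorted. The clients at the interval boundaries \<open>\<beta> i\<close> are left unconstrained.
\<close>

definition proper :: "nat \<Rightarrow> (nat \<Rightarrow> real) \<Rightarrow> mapping \<Rightarrow> bool" where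
  "proper n s f \<longleftrightarrow>
     (\<exists>p \<beta>. p permutes {1..n} \<and> mono_on {1..n} (s \<circ> p) \<and>
        mono_on {0..n} \<beta> \<and> \<beta> 0 = (0::real) \<and> \<beta> n = 1 \<and>
        (\<forall>i\<in>{1..n}. \<forall>z\<in>{\<beta> (i - 1)<..<\<beta> i}. f s z = p i))"

definition nearest_clients :: "nat \<Rightarrow> (nat \<Rightarrow> real) \<Rightarrow> nat \<Rightarrow> real set" where
  "nearest_clients n s i = {z \<in> {0..1}. \<forall>j\<in>{1..n}. \<bar>s i - z\<bar> \<le> \<bar>s j - z\<bar>}"

definition equal_sharing :: "nat \<Rightarrow> (nat \<Rightarrow> real) \<Rightarrow> mapping \<Rightarrow> bool" where
  "equal_sharing n s f \<longleftrightarrow>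
     (\<forall>i\<in>{1..n}. load s f i =
        measure lborel (nearest_clients n s i) / real (card {j \<in> {1..n}. s j = s i}))"

text \<open>
  The clients always play the proper client equilibrium. It is unique up to the order of co-located
  facilities and the choices of the boundary clients, except for \<open>\<alpha> = 0\<close>, where the equal sharing
  rule selects it; hence this determines all loads.
\<close>

definition induced_equilibria :: "nat \<Rightarrow> real \<Rightarrow> mapping \<Rightarrow> bool" where
  "induced_equilibria n \<alpha> f \<longleftrightarrow> client_mapping n f \<and>
     (\<forall>t\<in>locations n. client_equilibrium n \<alpha> t f \<and> proper n t f \<and>
        (\<alpha> = 0 \<longrightarrow> equal_sharing n t f))"

definition half_ceiling :: "nat \<Rightarrow> nat" where
  "half_ceiling n = nat \<lceil>real n / 2\<rceil>"

definition paired :: "nat \<Rightarrow> nat \<Rightarrow> real" where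
  "paired k j = (2 * real ((j + 1) div 2) - 1) / (2 * real k)"

lemma paired_odd_even:
  assumes "i \<ge> 1"
  shows "paired k (2 * i - 1) = (2 * real i - 1) / (2 * real k)"
    and "paired k (2 * i) = (2 * real i - 1) / (2 * real k)"
  using assms by (simp_all add: paired_def)

definition s_pair :: "nat \<Rightarrow> nat \<Rightarrow> real" where
  "s_pair n = (let k = half_ceiling n in
     (\<lambda>j\<in>{1..n}. if even n \<or> j \<le> k then paired k j else paired k (j + 1)))"

text \<open>Only the values at \<open>n = 4, \<dots>, 10\<close> are meaningful.\<close>

definition rho :: "nat \<Rightarrow> real \<Rightarrow> real" where
  "rho n \<alpha> =
    (if n = 4 then (4 + \<alpha> - \<alpha>^2) / 4
     else if n = 5 then
       ((4 + \<alpha>) * (\<alpha> * (\<alpha> * (3 + \<alpha>) - 3) - 4)) / ((2 + \<alpha>) * (\<alpha> * (5 * \<alpha> - 2) - 8))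
     else if n = 6 then
       (\<alpha> * (4 - \<alpha> * (\<alpha> - 7)) - 16) / (2 * (\<alpha> * (4 + \<alpha>) - 8))
     else if n = 7 then
       ((64 - 64 * \<alpha> + 7 * \<alpha>^3) * (16 + \<alpha> * (2 + \<alpha>) * (\<alpha> * (\<alpha> - 3) - 2))) /
       (2 * (32 + \<alpha> * (\<alpha> * (\<alpha> - 10) - 16)) * (16 + \<alpha> * (\<alpha> - 16 + \<alpha>^2)))
     else if n = 8 then
       (64 - \<alpha> * (48 + \<alpha> * (24 + (\<alpha> - 17) * \<alpha>))) / (4 * (16 + \<alpha> * (\<alpha> - 16 + \<alpha>^2)))
     else if n = 9 then
       ((32 + (\<alpha> - 4) * \<alpha> * (2 + \<alpha>) * (1 + 2 * \<alpha>)) * (\<alpha> * (4 + 3 * \<alpha>) - 16)) /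
       ((\<alpha> - 2) * (4 + \<alpha>) * (64 + \<alpha> * (\<alpha> * (\<alpha> - 24) - 32)))
     else if n = 10 then
       (\<alpha> * (320 - \<alpha> * (\<alpha> * (120 + (\<alpha> - 31) * \<alpha>) - 16)) - 256) /
       (2 * (\<alpha> * (\<alpha> - 4) * (\<alpha> * (4 + 3 * \<alpha>) - 48) - 128))
     else 0)"

end

theory Submission
  imports Defs
begin

text \<open>
  Scale the locations so that group \<open>j\<close> of co-located facilities stands at \<open>2 * j + 1\<close>. An equilibrium is
  given by its boundaries: adjacent facilities cost the same at their common boundary, and co-located
  facilities have equal loads (for \<open>\<alpha> = 0\<close> because of equal sharing). Such boundaries exist by a shooting
  argument in the first load.

  Let a facility deviate to \<open>x\<close>, serve \<open>[z, z + L]\<close>, and cut the line at this facility. On each side the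
  others form a stack between it and an end of the line. By induction along the stack, the load next to
  the deviator is at most an affine function \<open>c + p * r\<close> of the excess \<open>r\<close> of the width of the stack, where
  \<open>c\<close> and \<open>p\<close> are rational functions of \<open>\<alpha>\<close>. Adding suitable multiples of the two balance conditions at
  \<open>z\<close> and \<open>z + L\<close> eliminates \<open>x\<close> because of \<open>\<bar>x - z\<bar> + \<bar>x - (z + L)\<bar> \<ge> L\<close>, and bounds \<open>L\<close> by a rational
  function of \<open>\<alpha>\<close>. If a boundary lies beyond the next facility, the balance condition there is clamped and
  a different combination is used. Comparing the bounds with \<open>\<rho>\<^sub>n\<close> times the load without deviation leaves
  finitely many polynomial inequalities on \<open>[0, 1]\<close>, all of which are certified by nonnegative
  coefficients in the Bernstein basis.
\<close>

section \<open>Polynomials with integer coefficients\<close>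

text \<open>The equilibrium loads are piecewise rational in the location \<open>x\<close> of the
  deviator, and the pieces change whenever a boundary crosses a facility, so solving for them would
  multiply cases. One-sided affine estimates avoid this. In the balance between a group and the
  stack behind it, the absolute value belonging to the group can be replaced by its argument, since
  this errs upwards. The one belonging to the stack errs the wrong way once the boundary has passed
  the first group of the stack. There the estimate is flattened: the excess becomes
  \<open>max r (- \<tau>)\<close>, which is harmless as long as the load is at most \<open>1\<close>
  at the flattening point. Where this check fails at excess \<open>- 1\<close>, a second candidate
  is carried along, so a stack has a list of bounds of which at least one holds.

  At \<alpha> = 0 the cost equations say nothing about loads. The estimates are therefore kept free
  of division, as integer polynomials with cleared denominators, and equal loads of co-located
  facilities are made part of the notion of balance.\<close>

fun peval :: "int list \<Rightarrow> real \<Rightarrow> real" where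
  "peval [] x = 0"
| "peval (a # p) x = of_int a + x * peval p x"

fun padd :: "int list \<Rightarrow> int list \<Rightarrow> int list" where
  "padd [] q = q"
| "padd (a # p) [] = a # p"
| "padd (a # p) (b # q) = (a + b) # padd p q"

definition pscale :: "int \<Rightarrow> int list \<Rightarrow> int list" where
  "pscale c p = map (\<lambda>a. c * a) p"

fun pmul :: "int list \<Rightarrow> int list \<Rightarrow> int list" where
  "pmul [] q = []"
| "pmul (a # p) q = padd (pscale a q) (0 # pmul p q)"

definition psub :: "int list \<Rightarrow> int list \<Rightarrow> int list" where
  "psub p q = padd p (pscale (- 1) q)"

lemma peval_padd [simp]: "peval (padd p q) x = peval p x + peval q x"
  by (induction p q rule: padd.induct) (auto simp: algebra_simps)

lemma peval_pscale [simp]: "peval (pscale c p) x = of_int c * peval p x"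
  by (induction p) (auto simp: pscale_def algebra_simps)

lemma peval_pmul [simp]: "peval (pmul p q) x = peval p x * peval q x"
  by (induction p) (auto simp: algebra_simps)

lemma peval_psub [simp]: "peval (psub p q) x = peval p x - peval q x"
  by (simp add: psub_def)

lemma peval_replicate_zero [simp]: "peval (replicate k 0 @ p) x = x ^ k * peval p x"
  by (induction k) auto

text \<open>Each step multiplies the form by \<open>x + y\<close> and adds the new coefficient times
  a power of \<open>x\<close>, so the result is the sum of all
  \<open>a_i * x ^ i * (x + y) ^ (d - i)\<close>. Its coefficients are the Bernstein coefficients
  times binomials, hence integers with the same signs.\<close>

definition bernstein :: "int list \<Rightarrow> int list" where
  "bernstein p = foldl (\<lambda>g c. padd (c # g) g) [] p"

text \<open>The homogeneous form \<open>\<Sum>i. g ! i * x ^ (d - i) * y ^ i\<close> of degree \<open>d = length g - 1\<close>.\<close>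

fun hom_eval :: "int list \<Rightarrow> real \<Rightarrow> real \<Rightarrow> real" where
  "hom_eval [] x y = 0"
| "hom_eval (a # g) x y = of_int a * x ^ length g + y * hom_eval g x y"

lemma hom_eval_nonneg:
  assumes "list_all (\<lambda>b. 0 \<le> b) g" "0 \<le> x" "0 \<le> y"
  shows "0 \<le> hom_eval g x y"
  using assms by (induction g) auto

lemma length_padd_Cons: "length (padd (c # g) g) = Suc (length g)"
proof -
  have "length (padd p q) = max (length p) (length q)" for p q
    by (induction p q rule: padd.induct) auto
  then show ?thesis by simp
qed

lemma hom_eval_padd_Cons:
  assumes "x + y = 1"
  shows "hom_eval (padd (c # g) g) x y = of_int c * x ^ length g + hom_eval g x y"
proof (induction g arbitrary: c)
  case (Cons a g)
  have "y * (of_int a * x ^ length g) + x * (of_int a * x ^ length g) = of_int a * x ^ length g"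
    using assms by (metis add.commute distrib_right mult_1)
  then show ?case
    using Cons[of a] by (simp add: length_padd_Cons algebra_simps)
qed simp

lemma hom_eval_bernstein:
  assumes "x + y = 1"
  shows "hom_eval (bernstein p) x y = peval p x"
proof -
  have "hom_eval (foldl (\<lambda>g c. padd (c # g) g) g p) x y =
      hom_eval g x y + x ^ length g * peval p x" for g
    by (induction p arbitrary: g)
       (auto simp: hom_eval_padd_Cons[OF assms] length_padd_Cons algebra_simps)
  then show ?thesis by (simp add: bernstein_def)
qed

definition nonneg_test :: "int list \<Rightarrow> bool" where
  "nonneg_test p \<longleftrightarrow> list_all (\<lambda>b. 0 \<le> b) (bernstein p)"

lemma nonneg_test:
  assumes "nonneg_test p" "0 \<le> x" "x \<le> 1"
  shows "0 \<le> peval p x"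
  using hom_eval_nonneg[of "bernstein p" x "1 - x"] hom_eval_bernstein[of x "1 - x" p] assms
  by (simp add: nonneg_test_def)

text \<open>Here \<open>l\<close> is the load in a group of \<open>M\<close> facilities in front of
  a stack with first load \<open>l'\<close>; \<open>r\<close> and \<delta> are the excess widths
  with and without the group. If the boundary is not beyond the first location of the stack
  (\<delta> \<ge> - 1), the balance is at most linear in \<delta>, and inserting \<delta> and
  collecting \<open>l\<close> gives the claim. Otherwise \<open>C - B \<le> A\<close> yields
  \<open>l \<le> l' \<le> 1\<close>. The floor \<open>- (2 * h + 1 - M)\<close> is the
  \<open>r\<close> for which \<delta> = - 1 and \<open>l = 1\<close>.\<close>

lemma step_near:
  fixes \<alpha> A B C M h r \<delta> l l' :: real
  assumes \<alpha>: "0 \<le> \<alpha>" "\<alpha> \<le> 1" and pos: "0 < A" "0 < B" and M: "0 \<le> M" and h: "1 \<le> h" and \<tau>: "1 \<le> \<tau>"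
    and inner: "A * l' \<le> C + B * max \<delta> (- \<tau>)" and \<delta>: "\<delta> = r + 2 * h - M * l"
    and bal: "\<alpha> * (l - l') = (1 - \<alpha>) * (\<bar>1 + \<delta>\<bar> - \<bar>2 * h - 1 - \<delta>\<bar>)"
    and near: "C - B \<le> A" and Q: "Q = \<alpha> * B + 2 * (1 - \<alpha>) * A"
  shows "(\<alpha> * A + M * Q) * l \<le>
    \<alpha> * C + 2 * h * Q - 2 * (h - 1) * (1 - \<alpha>) * A + Q * max r (- (2 * h + 1 - M))"
proof (cases "\<delta> \<ge> - 1")
  case True
  have Q0: "0 \<le> Q" using \<alpha> pos Q by simp
  have "\<alpha> * (l - l') \<le> (1 - \<alpha>) * (2 * \<delta> - 2 * (h - 1))"
    unfolding bal using True \<alpha> by (intro mult_left_mono) auto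
  then have "A * (\<alpha> * (l - l')) \<le> A * ((1 - \<alpha>) * (2 * \<delta> - 2 * (h - 1)))"
    using pos by (intro mult_left_mono) auto
  moreover have "\<alpha> * (A * l') \<le> \<alpha> * (C + B * \<delta>)"
    using inner True \<tau> \<alpha> by (intro mult_left_mono) auto
  ultimately have "\<alpha> * A * l \<le> \<alpha> * C + Q * \<delta> - 2 * (h - 1) * (1 - \<alpha>) * A"
    unfolding Q by (simp add: algebra_simps)
  moreover have "Q * r \<le> Q * max r (- (2 * h + 1 - M))"
    using Q0 by (intro mult_left_mono) auto
  ultimately show ?thesis unfolding \<delta> by (simp add: algebra_simps)
next
  case False
  have Q0: "0 \<le> Q" using \<alpha> pos Q by simp
  have eq: "\<alpha> * (l - l') = (1 - \<alpha>) * (- 2 * h)"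
    unfolding bal using False h by auto
  \<comment> \<open>At \<alpha> = 0 the balance would read \<open>0 = - 2 * h\<close>.\<close>
  have "\<alpha> \<noteq> 0" using eq h by auto
  then have "0 < \<alpha>" using \<alpha> by simp
  have "l \<le> l'"
  proof -
    have "(1 - \<alpha>) * (- 2 * h) \<le> 0" using \<alpha> h by (simp add: mult_nonneg_nonpos)
    then have "\<alpha> * (l - l') \<le> 0" using eq by simp
    then show ?thesis using \<open>0 < \<alpha>\<close> by (simp add: mult_le_0_iff)
  qed
  have "B * max \<delta> (- \<tau>) \<le> B * (- 1)"
    using False \<tau> pos by (intro mult_left_mono) auto
  then have in1: "A * l' \<le> C - B" using inner by simp
  then have "A * l' \<le> A * 1" using near by simp
  then have "l' \<le> 1" using pos by (simp only: mult_le_cancel_left_pos)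
  then have MQ: "M * Q * l \<le> M * Q * 1"
    using \<open>l \<le> l'\<close> M Q0 by (intro mult_left_mono) auto
  have "\<alpha> * (A * l') \<le> \<alpha> * (C - B)" using in1 \<alpha> by (intro mult_left_mono)
  moreover have "A * (\<alpha> * (l - l')) = A * ((1 - \<alpha>) * (- 2 * h))" using eq by simp
  ultimately have 1: "\<alpha> * A * l \<le> \<alpha> * C - Q - 2 * (h - 1) * (1 - \<alpha>) * A"
    unfolding Q by (simp add: algebra_simps)
  have "Q * (- (2 * h + 1 - M)) \<le> Q * max r (- (2 * h + 1 - M))"
    using Q0 by (intro mult_left_mono) auto
  then show ?thesis using 1 MQ by (simp add: algebra_simps)
qed

text \<open>Under the weaker condition \<open>C - \<tau> * B \<le> A\<close> the load is known to be
  at most \<open>1\<close> only from \<delta> = - \<tau> downwards. Once the boundary has passed the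
  first location of the stack, the balance is used merely to get \<open>l \<le> l'\<close>, and the
  inner bound is applied to \<open>l\<close> itself; this is the second alternative. The floor moves
  to the \<open>r\<close> for which \<delta> = - \<tau> and \<open>l = 1\<close>.\<close>

lemma step_far:
  fixes \<alpha> A B C M h r \<delta> l l' :: real
  assumes \<alpha>: "0 \<le> \<alpha>" "\<alpha> \<le> 1" and pos: "0 < A" "0 < B" and M: "0 \<le> M" and h: "1 \<le> h" and \<tau>: "1 \<le> \<tau>"
    and inner: "A * l' \<le> C + B * max \<delta> (- \<tau>)" and \<delta>: "\<delta> = r + 2 * h - M * l"
    and bal: "\<alpha> * (l - l') = (1 - \<alpha>) * (\<bar>1 + \<delta>\<bar> - \<bar>2 * h - 1 - \<delta>\<bar>)"
    and far: "C - \<tau> * B \<le> A" and Q: "Q = \<alpha> * B + 2 * (1 - \<alpha>) * A"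
  shows "(\<alpha> * A + M * Q) * l \<le>
      \<alpha> * C + 2 * h * Q - 2 * (h - 1) * (1 - \<alpha>) * A + Q * max r (- (2 * h + \<tau> - M)) \<or>
    (A + M * B) * l \<le> C + 2 * h * B + B * max r (- (2 * h + \<tau> - M))"
proof (cases "\<delta> \<ge> - 1")
  case True
  have Q0: "0 \<le> Q" using \<alpha> pos Q by simp
  have "\<alpha> * (l - l') \<le> (1 - \<alpha>) * (2 * \<delta> - 2 * (h - 1))"
    unfolding bal using True \<alpha> by (intro mult_left_mono) auto
  then have "A * (\<alpha> * (l - l')) \<le> A * ((1 - \<alpha>) * (2 * \<delta> - 2 * (h - 1)))"
    using pos by (intro mult_left_mono) auto
  moreover have "\<alpha> * (A * l') \<le> \<alpha> * (C + B * \<delta>)"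
    using inner True \<tau> \<alpha> by (intro mult_left_mono) auto
  ultimately have "\<alpha> * A * l \<le> \<alpha> * C + Q * \<delta> - 2 * (h - 1) * (1 - \<alpha>) * A"
    unfolding Q by (simp add: algebra_simps)
  moreover have "Q * r \<le> Q * max r (- (2 * h + \<tau> - M))"
    using Q0 by (intro mult_left_mono) auto
  ultimately show ?thesis unfolding \<delta> by (simp add: algebra_simps)
next
  case False
  have eq: "\<alpha> * (l - l') = (1 - \<alpha>) * (- 2 * h)"
    unfolding bal using False h by auto
  have "\<alpha> \<noteq> 0" using eq h by auto
  then have "0 < \<alpha>" using \<alpha> by simp
  have "l \<le> l'"
  proof -
    have "(1 - \<alpha>) * (- 2 * h) \<le> 0" using \<alpha> h by (simp add: mult_nonneg_nonpos)
    then have "\<alpha> * (l - l') \<le> 0" using eq by simp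
    then show ?thesis using \<open>0 < \<alpha>\<close> by (simp add: mult_le_0_iff)
  qed
  then have "A * l \<le> A * l'" using pos by (intro mult_left_mono) auto
  then have out: "A * l \<le> C + B * max \<delta> (- \<tau>)" using inner by simp
  show ?thesis
  proof (cases "\<delta> \<ge> - \<tau>")
    case True
    have "B * r \<le> B * max r (- (2 * h + \<tau> - M))" using pos by (intro mult_left_mono) auto
    then show ?thesis using out True unfolding \<delta> by (simp add: algebra_simps)
  next
    case False
    then have out': "A * l \<le> C - \<tau> * B" using out by (simp add: algebra_simps)
    then have "A * l \<le> A * 1" using far by simp
    then have "l \<le> 1" using pos by (simp only: mult_le_cancel_left_pos)
    then have "M * B * l \<le> M * B * 1" using M pos by (intro mult_left_mono) auto
    moreover have "B * (- (2 * h + \<tau> - M)) \<le> B * max r (- (2 * h + \<tau> - M))"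
      using pos by (intro mult_left_mono) auto
    ultimately show ?thesis using out' by (simp add: algebra_simps)
  qed
qed

text \<open>Weighting the two estimates by \<open>S'\<close> and \<open>S\<close> gives
  \<open>r\<close> and \<open>r'\<close> the same coefficient, so that only their known sum remains.
  The distances \<theta> and \<theta>' then carry the weights \<open>S' * A\<close> and
  \<open>S * A'\<close>, and the smaller weight times \<open>L\<close> bounds their total from
  below. Which weight is smaller depends on \<alpha>, hence the choice between two values.\<close>

lemma gap_linear:
  fixes \<alpha> h A B C A' B' C' L r r' \<theta> \<theta>' :: real
  assumes \<alpha>: "0 \<le> \<alpha>" "\<alpha> \<le> 1" and pos: "0 < A" "0 < B" "0 < A'" "0 < B'"
    and S: "S = \<alpha> * B + (1 - \<alpha>) * A" and S': "S' = \<alpha> * B' + (1 - \<alpha>) * A'"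
    and left: "A * (\<alpha> * L + (1 - \<alpha>) * \<theta>) \<le> K + S * r"
    and right: "A' * (\<alpha> * L + (1 - \<alpha>) * \<theta>') \<le> K' + S' * r'"
    and sum: "r + r' = 2 * h - 2 - L" and \<theta>: "0 \<le> \<theta>" "0 \<le> \<theta>'" "L \<le> \<theta> + \<theta>'"
  defines "U \<equiv> \<lambda>\<mu>. S * S' + \<alpha> * (S * A' + S' * A) + (1 - \<alpha>) * \<mu>"
  shows "\<exists>\<mu>\<in>{S * A', S' * A}. 0 < U \<mu> \<and> L * U \<mu> \<le> S' * K + S * K' + (2 * h - 2) * (S * S')"
proof -
  have S0: "0 < S" "0 < S'"
    unfolding S S' using \<alpha> pos by (cases "\<alpha> = 0"; simp add: add_pos_nonneg)+
  define \<mu> where "\<mu> = min (S * A') (S' * A)"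
  have \<mu>0: "0 < \<mu>" using S0 pos by (simp add: \<mu>_def)
  have "S' * (A * (\<alpha> * L + (1 - \<alpha>) * \<theta>)) \<le> S' * (K + S * r)"
    using left S0 by (intro mult_left_mono) auto
  moreover have "S * (A' * (\<alpha> * L + (1 - \<alpha>) * \<theta>')) \<le> S * (K' + S' * r')"
    using right S0 by (intro mult_left_mono) auto
  ultimately have "S' * (A * (\<alpha> * L + (1 - \<alpha>) * \<theta>)) + S * (A' * (\<alpha> * L + (1 - \<alpha>) * \<theta>')) \<le>
      S' * K + S * K' + S * S' * (r + r')"
    by (simp add: algebra_simps)
  then have 1: "L * (S * S' + \<alpha> * (S * A' + S' * A)) + (1 - \<alpha>) * (S' * A * \<theta> + S * A' * \<theta>') \<le>
      S' * K + S * K' + (2 * h - 2) * (S * S')"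
    unfolding sum by (simp add: algebra_simps)
  have "\<mu> * L \<le> \<mu> * (\<theta> + \<theta>')" using \<theta> \<mu>0 by (intro mult_left_mono) auto
  also have "\<dots> = \<mu> * \<theta> + \<mu> * \<theta>'" by (simp add: algebra_simps)
  also have "\<dots> \<le> S' * A * \<theta> + S * A' * \<theta>'"
    using \<theta> by (intro add_mono mult_right_mono) (auto simp: \<mu>_def)
  finally have "(1 - \<alpha>) * (\<mu> * L) \<le> (1 - \<alpha>) * (S' * A * \<theta> + S * A' * \<theta>')"
    using \<alpha> by (intro mult_left_mono) auto
  then have "L * U \<mu> \<le> S' * K + S * K' + (2 * h - 2) * (S * S')"
    using 1 by (simp add: U_def algebra_simps)
  moreover have "0 < U \<mu>"
    unfolding U_def using S0 pos \<mu>0 \<alpha> by (intro add_pos_nonneg mult_nonneg_nonneg add_nonneg_nonneg) auto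
  moreover have "\<mu> \<in> {S * A', S' * A}" by (auto simp: \<mu>_def min_def)
  ultimately show ?thesis by blast
qed

text \<open>The left boundary lies beyond the left neighbour, so the left estimate bounds
  \<open>L\<close> plus a multiple of \<zeta>. Of the distance \<theta>' to the right boundary only
  the fraction \<open>t\<close> is used; it adds to the coefficient of \<open>r'\<close> and turns
  \<open>S'\<close> into \<open>Q\<close>. The weights \<open>Q\<close> and \<open>B\<close> then
  eliminate \<open>r\<close> and \<open>r'\<close>, and \<open>QA\<close> says that what remains of
  \<zeta> has the sign that allows it to be dropped.\<close>

lemma gap_clamped:
  fixes \<alpha> h A B C A' B' L r r' \<theta>' \<zeta> t :: real
  assumes \<alpha>: "0 \<le> \<alpha>" "\<alpha> \<le> 1" and pos: "0 < A" "0 < B" "0 < A'" "0 < B'"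
    and S': "S' = \<alpha> * B' + (1 - \<alpha>) * A'"
    and left: "A * (L + (1 - \<alpha>) * \<zeta>) \<le> C + B * r" and \<zeta>: "0 \<le> \<zeta>"
    and right: "A' * (\<alpha> * L + (1 - \<alpha>) * \<theta>') \<le> K' + S' * r'"
    and sum: "r + r' = 2 * h - 2 - L" and \<theta>': "t * (2 * h - 1 - r' - \<alpha> * \<zeta>) \<le> \<theta>'"
    and t: "0 \<le> t" and Q: "Q = S' + t * (1 - \<alpha>) * A'" and QA: "t * \<alpha> * B * A' \<le> Q * A"
  shows "0 < Q * A + \<alpha> * B * A' + B * Q"
    and "L * (Q * A + \<alpha> * B * A' + B * Q) \<le>
      Q * C + B * (K' - (2 * h - 1) * (t * (1 - \<alpha>) * A')) + (2 * h - 2) * (B * Q)"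
proof -
  have "0 < S'"
    unfolding S' using \<alpha> pos by (cases "\<alpha> = 0"; simp add: add_pos_nonneg)+
  then have Q0: "0 < Q" unfolding Q using \<alpha> pos t by (simp add: add_pos_nonneg)
  then show "0 < Q * A + \<alpha> * B * A' + B * Q" using pos \<alpha> by (simp add: add_pos_nonneg)
  have "Q * (A * (L + (1 - \<alpha>) * \<zeta>)) \<le> Q * (C + B * r)"
    using left Q0 by (intro mult_left_mono) auto
  moreover have "B * (A' * (\<alpha> * L + (1 - \<alpha>) * \<theta>')) \<le> B * (K' + S' * r')"
    using right pos by (intro mult_left_mono) auto
  moreover have "B * A' * (1 - \<alpha>) * (t * (2 * h - 1 - r' - \<alpha> * \<zeta>)) \<le> B * A' * (1 - \<alpha>) * \<theta>'"
    using \<theta>' \<alpha> pos by (intro mult_left_mono) auto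
  moreover have "(1 - \<alpha>) * \<zeta> * (t * \<alpha> * B * A') \<le> (1 - \<alpha>) * \<zeta> * (Q * A)"
    using QA \<alpha> \<zeta> by (intro mult_left_mono) auto
  moreover have "r = 2 * h - 2 - L - r'" using sum by simp
  ultimately show "L * (Q * A + \<alpha> * B * A' + B * Q) \<le>
      Q * C + B * (K' - (2 * h - 1) * (t * (1 - \<alpha>) * A')) + (2 * h - 2) * (B * Q)"
    unfolding Q by (simp add: algebra_simps)
qed

lemma mult_bound_cancel:
  fixes L U V N D :: real
  assumes "0 < U" "L * U \<le> V" "D * V \<le> N * U" "0 \<le> D"
  shows "D * L \<le> N"
proof -
  have "U * (D * L) = D * (L * U)" by (simp add: ac_simps)
  also have "\<dots> \<le> D * V" using assms by (intro mult_left_mono) auto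
  also have "\<dots> \<le> N * U" by fact
  also have "\<dots> = U * N" by (simp add: ac_simps)
  finally have "U * (D * L) \<le> U * N" .
  then show ?thesis using assms(1) by (simp only: mult_le_cancel_left_pos)
qed

section \<open>Chains of facilities\<close>

text \<open>The second clause speaks of adjacent facilities only; sortedness spreads it over a whole
  group of co-located ones.\<close>

definition balanced :: "real \<Rightarrow> real \<Rightarrow> real \<times> real \<Rightarrow> real \<times> real \<Rightarrow> bool" where
  "balanced \<alpha> z c c' \<longleftrightarrow>
     \<alpha> * snd c + (1 - \<alpha>) * \<bar>fst c - z\<bar> = \<alpha> * snd c' + (1 - \<alpha>) * \<bar>fst c' - z\<bar> \<and>
     (fst c = fst c' \<longrightarrow> snd c = snd c')"

text \<open>The facilities from left to right as pairs of location and load; the first one serves from \<open>v\<close> on.\<close>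

fun chain :: "real \<Rightarrow> real \<Rightarrow> (real \<times> real) list \<Rightarrow> bool" where
  "chain \<alpha> v [] = True"
| "chain \<alpha> v [c] = True"
| "chain \<alpha> v (c # c' # cs) = (balanced \<alpha> (v + snd c) c c' \<and> chain \<alpha> (v + snd c) (c' # cs))"

abbreviation total :: "(real \<times> real) list \<Rightarrow> real" where
  "total cs \<equiv> sum_list (map snd cs)"

lemma chain_append:
  "chain \<alpha> v (xs @ ys) \<longleftrightarrow> chain \<alpha> v xs \<and> chain \<alpha> (v + total xs) ys \<and>
     (xs \<noteq> [] \<longrightarrow> ys \<noteq> [] \<longrightarrow> balanced \<alpha> (v + total xs) (last xs) (hd ys))"
proof (induction \<alpha> v xs rule: chain.induct)
  case (2 \<alpha> v c)
  then show ?case by (cases ys) auto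
qed (auto simp: add.assoc)

lemma chain_Cons:
  "chain \<alpha> v (c # cs) \<longleftrightarrow> chain \<alpha> (v + snd c) cs \<and> (cs \<noteq> [] \<longrightarrow> balanced \<alpha> (v + snd c) c (hd cs))"
  using chain_append[of \<alpha> v "[c]" cs] by simp

definition mirror :: "real \<Rightarrow> (real \<times> real) list \<Rightarrow> (real \<times> real) list" where
  "mirror W cs = rev (map (\<lambda>(t, l). (W - t, l)) cs)"

lemma balanced_mirror:
  assumes "balanced \<alpha> z c c'"
  shows "balanced \<alpha> (W - z) (W - fst c', snd c') (W - fst c, snd c)"
proof -
  have "\<bar>W - fst c - (W - z)\<bar> = \<bar>fst c - z\<bar>" "\<bar>W - fst c' - (W - z)\<bar> = \<bar>fst c' - z\<bar>" by simp_all
  then show ?thesis using assms by (auto simp: balanced_def)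
qed

lemma total_mirror [simp]: "total (mirror W cs) = total cs"
  by (induction cs) (auto simp: mirror_def)

text \<open>Reflection turns a stack on the left of the deviator into one on the right, so stacks
  are estimated in one direction only. The mirrored chain starts at the image of the right end
  \<open>v + total cs\<close>.\<close>

lemma chain_mirror:
  "chain \<alpha> v cs \<Longrightarrow> chain \<alpha> (W - v - total cs) (mirror W cs)"
proof (induction cs arbitrary: v)
  case (Cons c cs)
  have eq: "mirror W (c # cs) = mirror W cs @ [(W - fst c, snd c)]"
    by (cases c) (simp add: mirror_def)
  have pos: "W - v - total (c # cs) + total (mirror W cs) = W - (v + snd c)"
    by simp
  have IH: "chain \<alpha> (W - v - total (c # cs)) (mirror W cs)"
  proof -
    have "chain \<alpha> (W - (v + snd c) - total cs) (mirror W cs)"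
      using Cons by (simp only: chain_Cons)
    moreover have "W - (v + snd c) - total cs = W - v - total (c # cs)" by simp
    ultimately show ?thesis by (simp only:)
  qed
  have bal: "balanced \<alpha> (W - (v + snd c)) (last (mirror W cs)) (W - fst c, snd c)"
    if ne: "mirror W cs \<noteq> []"
  proof -
    have "cs \<noteq> []" using ne by (auto simp: mirror_def)
    then have b: "balanced \<alpha> (v + snd c) c (hd cs)" using Cons.prems by (simp add: chain_Cons)
    have "last (mirror W cs) = (W - fst (hd cs), snd (hd cs))"
      using \<open>cs \<noteq> []\<close> by (cases cs) (auto simp: mirror_def case_prod_unfold)
    then show ?thesis using balanced_mirror[OF b, of W] by simp
  qed
  show ?case unfolding eq chain_append pos using IH bal by simp
qed (simp add: mirror_def)

lemma map_fst_mirror: "map fst (mirror W cs) = rev (map (\<lambda>t. W - t) (map fst cs))"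
  by (induction cs) (auto simp: mirror_def)

text \<open>The balance is homogeneous of degree one in locations and loads, so the unit interval
  can be stretched until the groups stand at odd integers.\<close>

lemma chain_scale:
  assumes "chain \<alpha> v cs" "0 < K"
  shows "chain \<alpha> (K * v) (map (\<lambda>(t, l). (K * t, K * l)) cs)"
  using assms(1)
proof (induction cs arbitrary: v)
  case (Cons c cs)
  have sc: "balanced \<alpha> (K * z) (K * t, K * l) (K * t', K * l')" if "balanced \<alpha> z (t, l) (t', l')"
    for z t l t' l'
  proof -
    have "\<bar>K * t - K * z\<bar> = K * \<bar>t - z\<bar>" "\<bar>K * t' - K * z\<bar> = K * \<bar>t' - z\<bar>"
      using assms(2) by (simp_all add: abs_mult flip: right_diff_distrib)
    moreover have "K * (\<alpha> * l + (1 - \<alpha>) * \<bar>t - z\<bar>) = K * (\<alpha> * l' + (1 - \<alpha>) * \<bar>t' - z\<bar>)"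
      using that by (simp add: balanced_def)
    ultimately show ?thesis using that assms(2) by (auto simp: balanced_def algebra_simps)
  qed
  obtain t l where c: "c = (t, l)" by (cases c)
  show ?case
  proof (cases cs)
    case (Cons d ds)
    obtain t' l' where d: "d = (t', l')" by (cases d)
    show ?thesis using Cons.IH[of "v + l"] Cons.prems sc[of "v + l" t l t' l'] c d Cons
      by (simp add: distrib_left)
  qed (simp add: c)
qed simp

text \<open>Co-located facilities are contiguous in a sorted chain, so the equality of adjacent
  loads propagates. This makes it irrelevant which of several facilities at one location a load is
  read off from.\<close>

lemma chain_colocated:
  assumes "chain \<alpha> v cs" "sorted (map fst cs)" "c \<in> set cs" "c' \<in> set cs" "fst c = fst c'"
  shows "snd c = snd c'"
proof -
  have *: "snd c' = snd d" if "chain \<alpha> v (d # cs)" "sorted (map fst (d # cs))" "c' \<in> set cs" "fst d = fst c'"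
    for v d c' cs
    using that
  proof (induction cs arbitrary: v d)
    case (Cons e cs)
    have "fst d = fst e" using Cons.prems by auto
    then have "snd d = snd e" using Cons.prems by (auto simp: balanced_def)
    show ?case
    proof (cases "c' = e")
      case False
      then have "snd c' = snd e"
        using Cons.IH[of "v + snd d" e] Cons.prems \<open>fst d = fst e\<close> by simp
      then show ?thesis using \<open>snd d = snd e\<close> by simp
    qed (use \<open>snd d = snd e\<close> in simp)
  qed simp
  show ?thesis using assms
  proof (induction cs arbitrary: v)
    case (Cons d cs)
    note head = *[OF Cons.prems(1,2)]
    consider "c = d" "c' = d" | "c = d" "c' \<in> set cs" | "c \<in> set cs" "c' = d"
      | "c \<in> set cs" "c' \<in> set cs"
      using Cons.prems(3,4) by auto
    then show ?case
    proof cases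
      case 2
      then show ?thesis using head[of c'] Cons.prems(5) by simp
    next
      case 3
      then show ?thesis using head[of c] Cons.prems(5) by simp
    next
      case 4
      have "chain \<alpha> (v + snd d) cs" using Cons.prems(1) by (simp only: chain_Cons)
      moreover have "sorted (map fst cs)" using Cons.prems(2) by simp
      ultimately show ?thesis using Cons.IH 4 Cons.prems(5) by blast
    qed simp
  qed simp
qed

lemma chain_replicate:
  assumes "chain \<alpha> v cs" "map fst cs = replicate M a" "M > 0"
  shows "cs = replicate M (a, snd (hd cs))"
  using assms
proof (induction M arbitrary: v cs)
  case (Suc M)
  then obtain c cs' where cs: "cs = c # cs'" "fst c = a" "map fst cs' = replicate M a" by auto
  show ?case
  proof (cases "M = 0")
    case False
    then have "cs' = replicate M (a, snd (hd cs'))"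
      using Suc.IH[of "v + snd c" cs'] Suc.prems cs False by (simp add: chain_Cons)
    moreover have "snd (hd cs') = snd c"
    proof -
      have ne: "cs' \<noteq> []" using cs False by auto
      then have "fst (hd cs') = hd (map fst cs')" by (simp add: hd_map)
      also have "\<dots> = a" using cs(3) False by (cases M) auto
      finally have "fst (hd cs') = a" .
      then show ?thesis using Suc.prems(1) cs(1,2) ne by (simp add: chain_Cons balanced_def)
    qed
    ultimately show ?thesis using cs by (cases c) simp
  qed (use cs in \<open>cases c; auto\<close>)
qed simp

text \<open>Groups of co-located facilities with the given multiplicities, of which \<open>0\<close> stands for a hole.\<close>

fun spots :: "real \<Rightarrow> nat list \<Rightarrow> real list" where
  "spots a [] = []"
| "spots a (M # ms) = replicate M a @ spots (a + 2) ms"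

lemma spots_append: "spots a (ms @ ns) = spots a ms @ spots (a + 2 * real (length ms)) ns"
  by (induction ms arbitrary: a) (auto simp: algebra_simps)

lemma rev_spots:
  "rev (map (\<lambda>t. W - t) (spots a ms)) = spots (W - a - 2 * (real (length ms) - 1)) (rev ms)"
proof (induction ms arbitrary: a)
  case (Cons M ms)
  then show ?case by (simp add: spots_append algebra_simps)
qed simp

lemma set_spots:
  assumes "x \<in> set (spots a ms)"
  shows "a \<le> x" "x \<le> a + 2 * (real (length ms) - 1)"
proof -
  have "a \<le> x \<and> x \<le> a + 2 * (real (length ms) - 1)"
    using assms
  proof (induction ms arbitrary: a)
    case (Cons M ms)
    have "x = a \<or> x \<in> set (spots (a + 2) ms)" using Cons.prems by auto
    then show ?case
    proof
      assume "x \<in> set (spots (a + 2) ms)"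
      from Cons.IH[OF this] show ?thesis by simp
    qed simp
  qed simp
  then show "a \<le> x" "x \<le> a + 2 * (real (length ms) - 1)" by auto
qed

lemma sorted_spots: "sorted (spots a ms)"
proof (induction ms arbitrary: a)
  case (Cons M ms)
  have "sorted (replicate M a)" by (simp add: sorted_replicate)
  then show ?case using Cons set_spots(1)[of _ "a + 2" ms]
    by (fastforce simp: sorted_append)
qed simp

section \<open>Bounds for stacks of facilities\<close>

type_synonym bound = "int list \<times> int list \<times> int list \<times> int"

text \<open>
  The bound \<open>(A, B, C, \<tau>)\<close> stands for the estimate \<open>l \<le> c + p * max r (- \<tau>)\<close> with
  \<open>c = C / A\<close> and \<open>p = B / A\<close> as rational functions of \<open>\<alpha>\<close>.
\<close>

definition dominates :: "real \<Rightarrow> bound \<Rightarrow> real \<Rightarrow> real \<Rightarrow> bool" where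
  "dominates \<alpha> b r l = (case b of (A, B, C, \<tau>) \<Rightarrow>
     peval A \<alpha> * l \<le> peval C \<alpha> + peval B \<alpha> * max r (- of_int \<tau>))"

definition bound_pos :: "real \<Rightarrow> bound \<Rightarrow> bool" where
  "bound_pos \<alpha> b = (case b of (A, B, C, \<tau>) \<Rightarrow> 0 < peval A \<alpha> \<and> 0 < peval B \<alpha> \<and> 1 \<le> \<tau>)"

definition pbeta :: "int list" where
  "pbeta = [1, - 1]"

lemma peval_pbeta [simp]: "peval pbeta \<alpha> = 1 - \<alpha>"
  by (simp add: pbeta_def)

text \<open>The value of the bound at excess \<open>- 1\<close>, where the boundary stands exactly
  on the first group of the stack, is compared with \<open>N / D\<close>. With
  \<open>[1] [1]\<close> this is the condition of \<open>step_near\<close>.\<close>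

definition near_test :: "int list \<Rightarrow> int list \<Rightarrow> bound \<Rightarrow> bool" where
  "near_test N D b = (case b of (A, B, C, \<tau>) \<Rightarrow>
     nonneg_test (psub (pmul N A) (pmul D (psub C B))))"

definition far_test :: "int list \<Rightarrow> int list \<Rightarrow> bound \<Rightarrow> bool" where
  "far_test N D b = (case b of (A, B, C, \<tau>) \<Rightarrow>
     nonneg_test (psub (pmul N A) (pmul D (psub C (pscale \<tau> B)))))"

definition slope_num :: "int list \<Rightarrow> int list \<Rightarrow> int list" where
  "slope_num A B = padd (0 # B) (pscale 2 (pmul pbeta A))"

lemma peval_slope_num [simp]: "peval (slope_num A B) \<alpha> = \<alpha> * peval B \<alpha> + 2 * (1 - \<alpha>) * peval A \<alpha>"
  by (simp add: slope_num_def)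

text \<open>
  A group of \<open>M\<close> facilities is added at distance \<open>2 * h\<close> in front of a stack bounded by \<open>b\<close>. The
  balance at their boundary is linear unless the boundary lies beyond the inner group; in that case
  \<open>step_clamped\<close> only uses that the load does not decrease towards the end of the line.
\<close>

definition step_balanced :: "int \<Rightarrow> int \<Rightarrow> int \<Rightarrow> bound \<Rightarrow> bound" where
  "step_balanced \<sigma> h M b = (case b of (A, B, C, \<tau>) \<Rightarrow>
     let Q = slope_num A B in
       (padd (0 # A) (pscale M Q), Q,
        psub (padd (0 # C) (pscale (2 * h) Q)) (pscale (2 * (h - 1)) (pmul pbeta A)), 2 * h + \<sigma> - M))"

definition step_clamped :: "int \<Rightarrow> int \<Rightarrow> bound \<Rightarrow> bound" where
  "step_clamped h M b = (case b of (A, B, C, \<tau>) \<Rightarrow>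
     (padd A (pscale M B), B, padd C (pscale (2 * h) B), 2 * h + \<tau> - M))"

definition extend :: "int \<Rightarrow> int \<Rightarrow> bound \<Rightarrow> bound list" where
  "extend h M b = (if near_test [1] [1] b then [step_balanced 1 h M b]
     else [step_balanced (snd (snd (snd b))) h M b, step_clamped h M b])"

text \<open>For a single group the width is the equation \<open>M * l = 2 + r\<close>; its floor
  \<open>3 - M\<close> continues the pattern \<open>2 * h + 1 - M\<close> and is at least
  \<open>1\<close> for \<open>M \<le> 2\<close>. A hole merges two gaps into one of width
  \<open>4\<close>, hence the argument \<open>2\<close> of \<open>extend\<close>.\<close>

fun bounds :: "nat list \<Rightarrow> bound list" where
  "bounds [] = []"
| "bounds [M] = [([int M], [1], [2], 3 - int M)]"
| "bounds (M # M' # ms) =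
     (if M' = 0 then concat (map (extend 2 (int M)) (bounds ms))
      else concat (map (extend 1 (int M)) (bounds (M' # ms))))"

text \<open>Gathers for all levels of the recursion of \<open>bounds\<close> what a further step
  requires: group sizes \<open>1\<close> or \<open>2\<close>, and one of the two tests for every
  inner bound. Two holes in a row are rejected.\<close>

fun valid :: "nat list \<Rightarrow> bool" where
  "valid [] = False"
| "valid [M] = (M = 1 \<or> M = 2)"
| "valid (M # M' # ms) = ((M = 1 \<or> M = 2) \<and>
     (if M' = 0 then valid ms \<and> list_all (\<lambda>b. near_test [1] [1] b \<or> far_test [1] [1] b) (bounds ms)
      else valid (M' # ms) \<and>
        list_all (\<lambda>b. near_test [1] [1] b \<or> far_test [1] [1] b) (bounds (M' # ms))))"

lemma valid_hd: "valid ms \<Longrightarrow> ms \<noteq> [] \<and> hd ms > 0"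
  by (cases ms rule: valid.cases) auto

context
  fixes \<alpha> :: real
  assumes \<alpha>: "0 \<le> \<alpha>" "\<alpha> \<le> 1"
begin

lemma slope_pos:
  assumes "0 < A" "0 < B"
  shows "0 < \<alpha> * B + 2 * (1 - \<alpha>) * A"
  using \<alpha> assms by (cases "\<alpha> = 0") (auto intro!: add_pos_nonneg)

lemma near_test:
  assumes "near_test N D (A, B, C, \<tau>)"
  shows "peval D \<alpha> * (peval C \<alpha> - peval B \<alpha>) \<le> peval N \<alpha> * peval A \<alpha>"
  using nonneg_test[of _ \<alpha>] \<alpha> assms by (fastforce simp: near_test_def)

lemma far_test:
  assumes "far_test N D (A, B, C, \<tau>)"
  shows "peval D \<alpha> * (peval C \<alpha> - of_int \<tau> * peval B \<alpha>) \<le> peval N \<alpha> * peval A \<alpha>"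
  using nonneg_test[of _ \<alpha>] \<alpha> assms by (fastforce simp: far_test_def)

text \<open>\<open>M \<le> 2\<close> keeps the new \<tau> at least \<open>1\<close>, so that the
  clamp is inactive as long as the next boundary has not passed the stack's first group.\<close>

lemma extend_pos:
  assumes "bound_pos \<alpha> b" "b' \<in> set (extend h M b)" "1 \<le> M" "M \<le> 2" "1 \<le> h"
  shows "bound_pos \<alpha> b'"
proof -
  obtain A B C \<tau> where b: "b = (A, B, C, \<tau>)" by (metis prod_cases4)
  have pos: "0 < peval A \<alpha>" "0 < peval B \<alpha>" "1 \<le> \<tau>" using assms(1) by (auto simp: b bound_pos_def)
  have Q: "0 < \<alpha> * peval B \<alpha> + 2 * (1 - \<alpha>) * peval A \<alpha>" using pos by (intro slope_pos)
  have "0 < \<alpha> * peval A \<alpha> + of_int M * (\<alpha> * peval B \<alpha> + 2 * (1 - \<alpha>) * peval A \<alpha>)"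
  proof (rule add_nonneg_pos)
    show "0 \<le> \<alpha> * peval A \<alpha>" using \<alpha> pos by simp
    show "0 < of_int M * (\<alpha> * peval B \<alpha> + 2 * (1 - \<alpha>) * peval A \<alpha>)"
      using assms(3) by (intro mult_pos_pos Q) simp
  qed
  moreover have "0 < peval A \<alpha> + of_int M * peval B \<alpha>"
    using pos assms(3) by (intro add_pos_nonneg mult_nonneg_nonneg) auto
  ultimately show ?thesis
    using assms(2-) Q pos
    by (auto simp: b extend_def bound_pos_def step_balanced_def step_clamped_def Let_def split: if_splits)
qed

lemma extend_dominates:
  assumes dom: "dominates \<alpha> b \<delta> l'" and pos: "bound_pos \<alpha> b"
    and test: "near_test [1] [1] b \<or> far_test [1] [1] b"
    and M: "1 \<le> M" and h: "1 \<le> h"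
    and \<delta>: "\<delta> = r + 2 * of_int h - of_int M * l"
    and bal: "\<alpha> * (l - l') = (1 - \<alpha>) * (\<bar>1 + \<delta>\<bar> - \<bar>2 * of_int h - 1 - \<delta>\<bar>)"
  shows "\<exists>b'\<in>set (extend h M b). dominates \<alpha> b' r l"
proof -
  obtain A B C \<tau> where b: "b = (A, B, C, \<tau>)" by (metis prod_cases4)
  have p: "0 < peval A \<alpha>" "0 < peval B \<alpha>" "1 \<le> (of_int \<tau> :: real)"
    using pos by (auto simp: b bound_pos_def)
  have inner: "peval A \<alpha> * l' \<le> peval C \<alpha> + peval B \<alpha> * max \<delta> (- of_int \<tau>)"
    using dom by (simp add: b dominates_def)
  have hM: "1 \<le> (of_int h :: real)" "0 \<le> (of_int M :: real)" using M h by auto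
  show ?thesis
  proof (cases "near_test [1] [1] b")
    case True
    have "peval C \<alpha> - peval B \<alpha> \<le> peval A \<alpha>" using near_test True by (fastforce simp: b)
    from step_near[OF \<alpha> p(1,2) hM(2,1) p(3) inner \<delta> bal this refl] True show ?thesis
      by (simp add: b extend_def step_balanced_def Let_def dominates_def algebra_simps)
  next
    case False
    have "peval C \<alpha> - of_int \<tau> * peval B \<alpha> \<le> peval A \<alpha>"
      using far_test test False by (fastforce simp: b)
    from step_far[OF \<alpha> p(1,2) hM(2,1) p(3) inner \<delta> bal this refl] False show ?thesis
      by (simp add: b extend_def step_balanced_def step_clamped_def Let_def dominates_def algebra_simps)
  qed
qed

lemma bounds_pos: "valid ms \<Longrightarrow> b \<in> set (bounds ms) \<Longrightarrow> bound_pos \<alpha> b"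
proof (induction ms arbitrary: b rule: bounds.induct)
  case (2 M)
  then show ?case by (auto simp: bound_pos_def)
next
  case (3 M M' ms)
  define h :: nat where "h = (if M' = 0 then 2 else 1)"
  define ns where "ns = (if M' = 0 then ms else M' # ms)"
  obtain b' where b': "b' \<in> set (bounds ns)" "b \<in> set (extend (int h) (int M) b')"
    using 3(4) by (auto simp: h_def ns_def split: if_splits)
  have "bound_pos \<alpha> b'"
    using 3(1)[of b'] 3(2)[of b'] 3(3) b'(1) by (auto simp: ns_def split: if_splits)
  then show ?case using extend_pos[OF _ b'(2)] 3(3) by (auto simp: h_def)
qed simp

text \<open>Every group or hole has a cell of width \<open>2\<close> centred at its location, so
  \<open>a - 1 - v\<close> is how much wider the stack is than its cells. The induction removes the
  first group. Which bound holds for the rest depends on the loads, so only some member of the list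
  is asserted.\<close>

lemma stack_bound:
  assumes "chain \<alpha> v cs" "map fst cs = spots a ms" "v + total cs = a - 1 + 2 * real (length ms)"
    and "valid ms"
  shows "\<exists>b\<in>set (bounds ms). dominates \<alpha> b (a - 1 - v) (snd (hd cs))"
  using assms
proof (induction ms arbitrary: v a cs rule: bounds.induct)
  case (2 M)
  then have M: "M > 0" by auto
  have "cs = replicate M (a, snd (hd cs))"
    using chain_replicate[OF 2(1)] 2(2) M by simp
  then have "total cs = M * snd (hd cs)"
    by (metis map_replicate snd_conv sum_list_replicate)
  then show ?case using 2 by (auto simp: dominates_def)
next
  case (3 M M' ms)
  have M: "M = 1 \<or> M = 2" using 3(6) by auto
  define h :: nat where "h = (if M' = 0 then 2 else 1)"
  define ns where "ns = (if M' = 0 then ms else M' # ms)"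
  have ns: "valid ns" "list_all (\<lambda>b. near_test [1] [1] b \<or> far_test [1] [1] b) (bounds ns)"
    using 3(6) by (auto simp: ns_def split: if_splits)
  have bnds: "bounds (M # M' # ms) = concat (map (extend (int h) (int M)) (bounds ns))"
    by (simp add: h_def ns_def)
  have IH: "\<exists>b\<in>set (bounds ns). dominates \<alpha> b (a - 1 - v) (snd (hd cs))"
    if "chain \<alpha> v cs" "map fst cs = spots a ns" "v + total cs = a - 1 + 2 * real (length ns)" for v a cs
    using 3(1)[of v cs a] 3(2)[of v cs a] that ns(1) by (auto simp: ns_def split: if_splits)
  have sp: "spots a (M # M' # ms) = replicate M a @ spots (a + 2 * h) ns"
    by (simp add: h_def ns_def algebra_simps)
  define xs where "xs = take M cs"
  define ys where "ys = drop M cs"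
  have cs: "cs = xs @ ys" by (simp add: xs_def ys_def)
  have fx: "map fst xs = replicate M a" and fy: "map fst ys = spots (a + 2 * h) ns"
    using 3(4) sp by (simp_all add: xs_def ys_def take_map[symmetric] drop_map[symmetric])
  have xs_ne: "xs \<noteq> []" using fx M by auto
  have "fst (hd ys) = a + 2 * h \<and> ys \<noteq> []"
  proof -
    have "spots (a + 2 * h) ns \<noteq> [] \<and> hd (spots (a + 2 * h) ns) = a + 2 * h"
      using valid_hd[OF ns(1)] by (cases ns) (auto simp: hd_append)
    then show ?thesis using fy by (metis hd_map list.map_disc_iff)
  qed
  then have hy: "fst (hd ys) = a + 2 * h" "ys \<noteq> []" by auto
  have ch: "chain \<alpha> v xs" "chain \<alpha> (v + total xs) ys" "balanced \<alpha> (v + total xs) (last xs) (hd ys)"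
    using 3(3) xs_ne hy(2) by (auto simp: cs chain_append)
  define l where "l = snd (hd cs)"
  have xs: "xs = replicate M (a, l)"
    using chain_replicate[OF ch(1) fx] M xs_ne by (auto simp: cs l_def)
  have tx: "total xs = M * l"
    using xs by (metis map_replicate snd_conv sum_list_replicate)
  have lx: "last xs = (a, l)" using xs M by auto
  have len: "real (length (M # M' # ms)) = real (length ns) + h" by (simp add: h_def ns_def)
  \<comment> \<open>Excess of the remaining stack: its first group stands at
    \<open>a + 2 * h\<close>, and it serves from \<open>v + M * l\<close> on.\<close>
  define \<delta> where "\<delta> = a + 2 * h - 1 - (v + M * l)"
  have "v + M * l + total ys = a + 2 * h - 1 + 2 * real (length ns)"
    using 3(5) tx len by (simp add: cs)
  then obtain b where b: "b \<in> set (bounds ns)" "dominates \<alpha> b \<delta> (snd (hd ys))"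
    using IH[of "v + M * l" ys "a + 2 * h"] ch(2) fy tx by (auto simp: \<delta>_def)
  have "\<alpha> * l + (1 - \<alpha>) * \<bar>a - (v + M * l)\<bar> =
      \<alpha> * snd (hd ys) + (1 - \<alpha>) * \<bar>a + 2 * h - (v + M * l)\<bar>"
    using ch(3) lx tx hy(1) by (simp add: balanced_def)
  moreover have "\<bar>a - (v + M * l)\<bar> = \<bar>2 * of_int (int h) - 1 - \<delta>\<bar>"
    "\<bar>a + 2 * h - (v + M * l)\<bar> = \<bar>1 + \<delta>\<bar>"
    by (auto simp: \<delta>_def)
  ultimately have bal: "\<alpha> * (l - snd (hd ys)) =
      (1 - \<alpha>) * (\<bar>1 + \<delta>\<bar> - \<bar>2 * of_int (int h) - 1 - \<delta>\<bar>)"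
    by (simp only: right_diff_distrib)
  have "\<exists>b'\<in>set (extend (int h) (int M) b). dominates \<alpha> b' (a - 1 - v) l"
  proof (rule extend_dominates[OF b(2) _ _ _ _ _ bal])
    show "bound_pos \<alpha> b" using bounds_pos ns(1) b(1) by blast
    show "near_test [1] [1] b \<or> far_test [1] [1] b" using ns(2) b(1) by (simp add: list_all_iff)
    show "1 \<le> int M" using M by auto
    show "1 \<le> int h" by (simp add: h_def)
    show "\<delta> = a - 1 - v + 2 * of_int (int h) - of_int (int M) * l" by (simp add: \<delta>_def)
  qed
  then show ?case unfolding bnds l_def using b(1) by auto
qed simp

end

section \<open>A facility in a gap\<close>

text \<open>
  A facility with load \<open>L\<close> at \<open>x\<close> in the gap \<open>[- h, h]\<close> borders at \<open>z\<close> on a facility with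
  load \<open>l\<close> at \<open>- h\<close>. The clause for \<open>z < - h\<close> also covers \<open>\<alpha> = 0\<close>, where it forces \<open>x = - h\<close>.
\<close>

definition side :: "real \<Rightarrow> real \<Rightarrow> real \<Rightarrow> real \<Rightarrow> real \<Rightarrow> real \<Rightarrow> bound \<Rightarrow> bool" where
  "side \<alpha> h x z L l b \<longleftrightarrow>
     \<alpha> * L + (1 - \<alpha>) * \<bar>x - z\<bar> \<le> \<alpha> * l + (1 - \<alpha>) * \<bar>- h - z\<bar> \<and>
     (z < - h \<longrightarrow> (\<exists>\<zeta>\<ge>0. x + h = \<alpha> * \<zeta> \<and> L + (1 - \<alpha>) * \<zeta> \<le> l)) \<and>
     dominates \<alpha> b (z + h - 1) l"

text \<open>The conclusion of \<open>gap_linear\<close> compared with \<open>N / D\<close>, for both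
  values of \<mu>. \<open>S\<close> and \<open>K\<close> come from \<open>side_linear\<close>, where
  the distance from the neighbour to the boundary is the excess plus \<open>1\<close>.\<close>

definition linear_test :: "int \<Rightarrow> int list \<Rightarrow> int list \<Rightarrow> bound \<Rightarrow> bound \<Rightarrow> bool" where
  "linear_test h N D b b' = (case b of (A, B, C, \<tau>) \<Rightarrow> case b' of (A', B', C', \<tau>') \<Rightarrow>
     let S = padd (0 # B) (pmul pbeta A);
         S' = padd (0 # B') (pmul pbeta A');
         K = padd (0 # C) (pmul pbeta A);
         K' = padd (0 # C') (pmul pbeta A');
         SS = pmul S S';
         base = psub (pmul N (padd SS (0 # padd (pmul S A') (pmul S' A))))
                     (pmul D (padd (padd (pmul S' K) (pmul S K')) (pscale (2 * h - 2) SS)))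
     in nonneg_test (padd base (pmul N (pmul pbeta (pmul S A')))) \<and>
        nonneg_test (padd base (pmul N (pmul pbeta (pmul S' A)))))"

text \<open>The multiplier \<open>1 - \<alpha>\<^sup>2\<close> is one that works uniformly for all the cases needed.\<close>

definition clamped_test :: "int \<Rightarrow> int list \<Rightarrow> int list \<Rightarrow> bound \<Rightarrow> bound \<Rightarrow> bool" where
  "clamped_test h N D b b' = (case b of (A, B, C, \<tau>) \<Rightarrow> case b' of (A', B', C', \<tau>') \<Rightarrow>
     let T = pmul [1, 0, - 1] (pmul pbeta A');
         Q = padd (padd (0 # B') (pmul pbeta A')) T;
         K' = padd (0 # C') (pmul pbeta A')
     in nonneg_test (psub (pmul Q A) (pmul (pmul [0, 1, 0, - 1] B) A')) \<and>
        nonneg_test (psub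
          (pmul N (padd (pmul Q A) (padd (0 # pmul B A') (pmul B Q))))
          (pmul D (padd (pmul Q C)
            (padd (pmul B (psub K' (pscale (2 * h - 1) T))) (pscale (2 * h - 2) (pmul B Q)))))) \<and>
        far_test N D b \<and> near_test N D b')"

text \<open>\<open>near_test\<close> alone settles a boundary beyond the neighbour; the finer
  \<open>clamped_test\<close> is required only where it fails. The latter includes
  \<open>near_test\<close> for the opposite bound, which covers the case of both boundaries beyond
  their neighbours.\<close>

definition gap_test :: "int \<Rightarrow> int list \<Rightarrow> int list \<Rightarrow> bound \<Rightarrow> bound \<Rightarrow> bool" where
  "gap_test h N D b b' \<longleftrightarrow> linear_test h N D b b' \<and>
     (near_test N D b \<or> clamped_test h N D b b') \<and> (near_test N D b' \<or> clamped_test h N D b' b)"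

context
  fixes \<alpha> :: real
  assumes \<alpha>: "0 \<le> \<alpha>" "\<alpha> \<le> 1"
begin

text \<open>A boundary beyond the neighbour makes the deviator's load at most that of the neighbour,
  which in turn is at most its bound at excess \<open>- 1\<close>.\<close>

lemma side_near:
  assumes "side \<alpha> h x z L l b" "z < - h" "bound_pos \<alpha> b" "near_test N D b" "0 \<le> peval D \<alpha>"
  shows "peval D \<alpha> * L \<le> peval N \<alpha>"
proof -
  obtain A B C \<tau> where b: "b = (A, B, C, \<tau>)" by (metis prod_cases4)
  have p: "0 < peval A \<alpha>" "0 < peval B \<alpha>" "1 \<le> (of_int \<tau> :: real)"
    using assms(3) by (auto simp: b bound_pos_def)
  obtain \<zeta> where \<zeta>: "0 \<le> \<zeta>" "L + (1 - \<alpha>) * \<zeta> \<le> l" using assms(1,2) by (auto simp: side_def)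
  have "0 \<le> (1 - \<alpha>) * \<zeta>" using \<alpha> \<zeta> by simp
  then have "L \<le> l" using \<zeta> by simp
  then have "peval A \<alpha> * L \<le> peval A \<alpha> * l" using p by (intro mult_left_mono) auto
  also have "\<dots> \<le> peval C \<alpha> + peval B \<alpha> * max (z + h - 1) (- of_int \<tau>)"
    using assms(1) by (simp add: side_def b dominates_def)
  also have "\<dots> \<le> peval C \<alpha> + peval B \<alpha> * (- 1)"
    using p assms(2) by (intro add_left_mono mult_left_mono) auto
  finally have "L * peval A \<alpha> \<le> peval C \<alpha> - peval B \<alpha>" by (simp add: mult.commute)
  moreover have "peval D \<alpha> * (peval C \<alpha> - peval B \<alpha>) \<le> peval N \<alpha> * peval A \<alpha>"
    using near_test[OF \<alpha>] assms(4) by (simp add: b)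
  ultimately show ?thesis using mult_bound_cancel[OF p(1)] assms(5) by blast
qed

lemma side_linear:
  assumes "side \<alpha> h x z L l (A, B, C, \<tau>)" "- h \<le> z" "bound_pos \<alpha> (A, B, C, \<tau>)"
  shows "peval A \<alpha> * (\<alpha> * L + (1 - \<alpha>) * \<bar>x - z\<bar>) \<le> (\<alpha> * peval C \<alpha> + (1 - \<alpha>) * peval A \<alpha>) +
    (\<alpha> * peval B \<alpha> + (1 - \<alpha>) * peval A \<alpha>) * (z + h - 1)"
proof -
  have p: "0 < peval A \<alpha>" "0 < peval B \<alpha>" "1 \<le> (of_int \<tau> :: real)"
    using assms(3) by (auto simp: bound_pos_def)
  have "peval A \<alpha> * l \<le> peval C \<alpha> + peval B \<alpha> * (z + h - 1)"
    using assms(1,2) p(3) by (simp add: side_def dominates_def)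
  then have "\<alpha> * (peval A \<alpha> * l) \<le> \<alpha> * (peval C \<alpha> + peval B \<alpha> * (z + h - 1))"
    using \<alpha> by (intro mult_left_mono)
  moreover have "\<alpha> * L + (1 - \<alpha>) * \<bar>x - z\<bar> \<le> \<alpha> * l + (1 - \<alpha>) * (z + h)"
  proof -
    have "\<bar>- h - z\<bar> = z + h" using assms(2) by simp
    then show ?thesis using assms(1) by (simp add: side_def)
  qed
  then have "peval A \<alpha> * (\<alpha> * L + (1 - \<alpha>) * \<bar>x - z\<bar>) \<le> peval A \<alpha> * (\<alpha> * l + (1 - \<alpha>) * (z + h))"
    using p by (intro mult_left_mono) auto
  ultimately show ?thesis by (simp add: algebra_simps)
qed

lemma side_clamped:
  assumes "side \<alpha> (of_int h) x z L l b" "side \<alpha> (of_int h) (- x) (- (z + L)) L l' b'"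
    and "z < - of_int h" "- of_int h \<le> - (z + L)"
    and "bound_pos \<alpha> b" "bound_pos \<alpha> b'" "clamped_test h N D b b'" "0 \<le> peval D \<alpha>"
  shows "peval D \<alpha> * L \<le> peval N \<alpha>"
proof -
  obtain A B C \<tau> where b: "b = (A, B, C, \<tau>)" by (metis prod_cases4)
  obtain A' B' C' \<tau>' where b': "b' = (A', B', C', \<tau>')" by (metis prod_cases4)
  have p: "0 < peval A \<alpha>" "0 < peval B \<alpha>" "0 < peval A' \<alpha>" "0 < peval B' \<alpha>"
    using assms(5,6) by (auto simp: b b' bound_pos_def)
  obtain \<zeta> where \<zeta>: "0 \<le> \<zeta>" "x + of_int h = \<alpha> * \<zeta>" "L + (1 - \<alpha>) * \<zeta> \<le> l"
    using assms(1,3) by (auto simp: side_def)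
  have dom: "peval A \<alpha> * l \<le> peval C \<alpha> + peval B \<alpha> * max (z + of_int h - 1) (- of_int \<tau>)"
    using assms(1) by (simp add: side_def b dominates_def)
  have Al: "peval A \<alpha> * (L + (1 - \<alpha>) * \<zeta>) \<le> peval A \<alpha> * l"
    using p \<zeta> by (intro mult_left_mono) auto
  show ?thesis
  proof (cases "z + of_int h - 1 \<ge> - of_int \<tau>")
    \<comment> \<open>Below the floor the bound is constant, and \<open>far_test\<close>
      suffices.\<close>
    case False
    have "0 \<le> (1 - \<alpha>) * \<zeta>" using \<alpha> \<zeta> by simp
    then have "peval A \<alpha> * L \<le> peval A \<alpha> * (L + (1 - \<alpha>) * \<zeta>)"
      using p by (intro mult_left_mono) auto
    then have "L * peval A \<alpha> \<le> peval C \<alpha> - of_int \<tau> * peval B \<alpha>"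
      using Al dom False by (simp add: algebra_simps)
    moreover have "peval D \<alpha> * (peval C \<alpha> - of_int \<tau> * peval B \<alpha>) \<le> peval N \<alpha> * peval A \<alpha>"
      using far_test[OF \<alpha>] assms(7) by (simp add: b b' clamped_test_def Let_def)
    ultimately show ?thesis using mult_bound_cancel[OF p(1)] assms(8) by blast
  next
    case True
    define t where "t = 1 - \<alpha>\<^sup>2"
    have t: "0 \<le> t" "t \<le> 1" using \<alpha> by (simp_all add: t_def power_le_one)
    define S' where "S' = \<alpha> * peval B' \<alpha> + (1 - \<alpha>) * peval A' \<alpha>"
    define K' where "K' = \<alpha> * peval C' \<alpha> + (1 - \<alpha>) * peval A' \<alpha>"
    define Q where "Q = S' + t * (1 - \<alpha>) * peval A' \<alpha>"
    have left: "peval A \<alpha> * (L + (1 - \<alpha>) * \<zeta>) \<le> peval C \<alpha> + peval B \<alpha> * (z + of_int h - 1)"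
      using Al dom True by simp
    have right: "peval A' \<alpha> * (\<alpha> * L + (1 - \<alpha>) * \<bar>- x - - (z + L)\<bar>) \<le>
        K' + S' * (- (z + L) + of_int h - 1)"
      using side_linear[OF assms(2)[unfolded b'] assms(4)] assms(6) by (simp add: b' S'_def K'_def)
    \<comment> \<open>\<open>z + L - x\<close> is the signed distance from the deviator to its right
      boundary; a fraction of it never exceeds the absolute value, whatever the sign.\<close>
    have "t * (z + L - x) \<le> \<bar>z + L - x\<bar>"
      using t by (smt (verit) mult_left_le_one_le mult_nonneg_nonpos)
    then have \<theta>: "t * (2 * of_int h - 1 - (- (z + L) + of_int h - 1) - \<alpha> * \<zeta>) \<le> \<bar>- x - - (z + L)\<bar>"
    proof -
      have "2 * of_int h - 1 - (- (z + L) + of_int h - 1) - \<alpha> * \<zeta> = z + L - x"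
        using \<zeta>(2) by linarith
      moreover have "- x - - (z + L) = z + L - x" by simp
      ultimately show ?thesis using \<open>t * (z + L - x) \<le> \<bar>z + L - x\<bar>\<close> by (simp only:)
    qed
    have QA: "t * \<alpha> * peval B \<alpha> * peval A' \<alpha> \<le> Q * peval A \<alpha>"
      and test: "peval D \<alpha> * (Q * peval C \<alpha> +
          peval B \<alpha> * (K' - (2 * of_int h - 1) * (t * (1 - \<alpha>) * peval A' \<alpha>)) +
          (2 * of_int h - 2) * (peval B \<alpha> * Q)) \<le>
        peval N \<alpha> * (Q * peval A \<alpha> + \<alpha> * peval B \<alpha> * peval A' \<alpha> + peval B \<alpha> * Q)"
      using assms(7) nonneg_test[OF _ \<alpha>]
      by (fastforce simp: b b' clamped_test_def Let_def Q_def S'_def K'_def t_def algebra_simps power2_eq_square)+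
    note clamp = gap_clamped[OF \<alpha> p S'_def left \<zeta>(1) right _ \<theta> t(1) Q_def QA]
    show ?thesis
      using mult_bound_cancel[OF clamp test assms(8)] by simp
  qed
qed

lemma gap_bound:
  assumes "side \<alpha> (of_int h) x z L l b" "side \<alpha> (of_int h) (- x) (- (z + L)) L l' b'"
    and "bound_pos \<alpha> b" "bound_pos \<alpha> b'" "gap_test h N D b b'" "0 \<le> peval D \<alpha>"
  shows "peval D \<alpha> * L \<le> peval N \<alpha>"
proof (cases "z < - of_int h")
  case True
  show ?thesis
  proof (cases "near_test N D b")
    case near: True
    show ?thesis by (rule side_near[OF assms(1) True assms(3) near assms(6)])
  next
    case False
    then have c: "clamped_test h N D b b'" using assms(5) by (simp add: gap_test_def)
    then have near: "near_test N D b'" by (auto simp: clamped_test_def Let_def split: prod.splits)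
    show ?thesis
    proof (cases "- (z + L) < - of_int h")
      case True
      show ?thesis by (rule side_near[OF assms(2) True assms(4) near assms(6)])
    next
      case False
      then show ?thesis using side_clamped[OF assms(1,2) True _ assms(3,4) c assms(6)] by simp
    qed
  qed
next
  case z: False
  show ?thesis
  proof (cases "- (z + L) < - of_int h")
    case True
    show ?thesis
    proof (cases "near_test N D b'")
      case near: True
      show ?thesis by (rule side_near[OF assms(2) True assms(4) near assms(6)])
    next
      case False
      then have c: "clamped_test h N D b' b" using assms(5) by (simp add: gap_test_def)
      have "- (- (z + L) + L) = z" by simp
      then show ?thesis
        using side_clamped[of h "- x" "- (z + L)" L l' b' l b N D] assms z True c by simp
    qed
  next
    case False
    obtain A B C \<tau> where b: "b = (A, B, C, \<tau>)" by (metis prod_cases4)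
    obtain A' B' C' \<tau>' where b': "b' = (A', B', C', \<tau>')" by (metis prod_cases4)
    have p: "0 < peval A \<alpha>" "0 < peval B \<alpha>" "0 < peval A' \<alpha>" "0 < peval B' \<alpha>"
      using assms(3,4) by (auto simp: b b' bound_pos_def)
    define S where "S = \<alpha> * peval B \<alpha> + (1 - \<alpha>) * peval A \<alpha>"
    define K where "K = \<alpha> * peval C \<alpha> + (1 - \<alpha>) * peval A \<alpha>"
    define S' where "S' = \<alpha> * peval B' \<alpha> + (1 - \<alpha>) * peval A' \<alpha>"
    define K' where "K' = \<alpha> * peval C' \<alpha> + (1 - \<alpha>) * peval A' \<alpha>"
    have left: "peval A \<alpha> * (\<alpha> * L + (1 - \<alpha>) * \<bar>x - z\<bar>) \<le> K + S * (z + of_int h - 1)"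
      using side_linear[OF assms(1)[unfolded b]] z assms(3) by (simp add: b S_def K_def)
    have right: "peval A' \<alpha> * (\<alpha> * L + (1 - \<alpha>) * \<bar>- x - - (z + L)\<bar>) \<le>
        K' + S' * (- (z + L) + of_int h - 1)"
      using side_linear[OF assms(2)[unfolded b']] False assms(4) by (simp add: b' S'_def K'_def)
    have "\<exists>\<mu>\<in>{S * peval A' \<alpha>, S' * peval A \<alpha>}.
        0 < S * S' + \<alpha> * (S * peval A' \<alpha> + S' * peval A \<alpha>) + (1 - \<alpha>) * \<mu> \<and>
        L * (S * S' + \<alpha> * (S * peval A' \<alpha> + S' * peval A \<alpha>) + (1 - \<alpha>) * \<mu>) \<le>
        S' * K + S * K' + (2 * of_int h - 2) * (S * S')"
      by (rule gap_linear[OF \<alpha> p S_def S'_def left right]) auto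
    then obtain \<mu> where \<mu>: "\<mu> \<in> {S * peval A' \<alpha>, S' * peval A \<alpha>}"
        "0 < S * S' + \<alpha> * (S * peval A' \<alpha> + S' * peval A \<alpha>) + (1 - \<alpha>) * \<mu>"
        "L * (S * S' + \<alpha> * (S * peval A' \<alpha> + S' * peval A \<alpha>) + (1 - \<alpha>) * \<mu>) \<le>
          S' * K + S * K' + (2 * of_int h - 2) * (S * S')"
      by blast
    have lt: "linear_test h N D b b'" using assms(5) by (simp add: gap_test_def)
    have "peval D \<alpha> * (S' * K + S * K' + (2 * of_int h - 2) * (S * S')) \<le>
        peval N \<alpha> * (S * S' + \<alpha> * (S * peval A' \<alpha> + S' * peval A \<alpha>) + (1 - \<alpha>) * \<mu>)"
    proof -
      define base where "base = peval N \<alpha> * (S * S' + \<alpha> * (S * peval A' \<alpha> + S' * peval A \<alpha>)) -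
        peval D \<alpha> * (S' * K + S * K' + (2 * of_int h - 2) * (S * S'))"
      have "0 \<le> base + peval N \<alpha> * ((1 - \<alpha>) * (S * peval A' \<alpha>))"
        "0 \<le> base + peval N \<alpha> * ((1 - \<alpha>) * (S' * peval A \<alpha>))"
        using lt[unfolded linear_test_def b b' Let_def, simplified]
          nonneg_test[OF _ \<alpha>]
        by (fastforce simp: base_def S_def S'_def K_def K'_def)+
      then show ?thesis using \<mu>(1) by (auto simp: base_def algebra_simps)
    qed
    from mult_bound_cancel[OF \<mu>(2,3) this assms(6)] show ?thesis .
  qed
qed

end

text \<open>Applied to the multiplicities \<open>m\<close> that remain after the deviator has left
  its group. The left stack is reversed because both stacks are read from the gap outwards. The
  comparison of \<open>D\<close> with \<open>N\<close> serves the two ends of the line, where a load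
  of at most \<open>1\<close> is accepted without a gap argument.\<close>

definition gaps_test :: "int list \<Rightarrow> int list \<Rightarrow> nat list \<Rightarrow> bool" where
  "gaps_test N D m \<longleftrightarrow> nonneg_test (psub N D) \<and> length m \<ge> 2 \<and> hd m > 0 \<and> last m > 0 \<and>
     list_all (\<lambda>i. 0 < m ! i \<or> 0 < m ! (i + 1)) [0..<length m - 1] \<and>
     list_all (\<lambda>i. 0 < m ! i \<longrightarrow>
       (let h = if m ! (i + 1) = 0 then 2 else 1;
            ls = rev (take (i + 1) m); rs = drop (i + h) m in
        valid ls \<and> valid rs \<and>
        list_all (\<lambda>b. list_all (gap_test (int h) N D b) (bounds rs)) (bounds ls)))
       [0..<length m - 1]"

lemma sorted_unique:
  assumes "sorted xs" "sorted ys" "mset xs = mset ys"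
  shows "xs = (ys :: real list)"
  using assms properties_for_sort by metis

context
  fixes \<alpha> :: real
  assumes \<alpha>: "0 \<le> \<alpha>" "\<alpha> \<le> 1"
begin

text \<open>Shifts a balanced pair to coordinates centred in the gap \<open>[a, a + 2 * h]\<close>.
  For a boundary left of \<open>a\<close> the witness is \<open>(x - a) / \<alpha>\<close>; at
  \<alpha> = 0 such a boundary forces \<open>x = a\<close>, and equal loads at one location allow
  \<zeta> = 0.\<close>

lemma side_balanced:
  assumes "balanced \<alpha> z (a, l) (x, L)" "a \<le> x" "dominates \<alpha> b (z - a - 1) l"
  shows "side \<alpha> h (x - a - h) (z - a - h) L l b"
proof -
  have eq: "\<alpha> * L + (1 - \<alpha>) * \<bar>x - z\<bar> = \<alpha> * l + (1 - \<alpha>) * \<bar>a - z\<bar>"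
    using assms(1) by (simp add: balanced_def)
  have "\<exists>\<zeta>\<ge>0. x - a = \<alpha> * \<zeta> \<and> L + (1 - \<alpha>) * \<zeta> \<le> l" if "z < a"
  proof -
    have "\<bar>x - z\<bar> = x - z" "\<bar>a - z\<bar> = a - z" using that assms(2) by auto
    then have *: "\<alpha> * L + (1 - \<alpha>) * (x - a) = \<alpha> * l" using eq by (simp add: algebra_simps)
    show ?thesis
    proof (cases "\<alpha> = 0")
      case True
      then have "x = a" using * by simp
      then show ?thesis using assms(1) by (intro exI[of _ 0]) (auto simp: balanced_def)
    next
      case False
      then have "\<alpha> * (L + (1 - \<alpha>) * ((x - a) / \<alpha>)) = \<alpha> * l" using * by (simp add: field_simps)
      then have "L + (1 - \<alpha>) * ((x - a) / \<alpha>) = l" using False by simp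
      then show ?thesis using False assms(2) \<alpha> by (intro exI[of _ "(x - a) / \<alpha>"]) auto
    qed
  qed
  moreover have "\<bar>- h - (z - a - h)\<bar> = \<bar>a - z\<bar>" by simp
  ultimately show ?thesis using eq assms(3) by (auto simp: side_def)
qed

lemma middle_bound:
  fixes h :: int
  assumes chain: "chain \<alpha> 0 cs" and fst: "map fst cs = spots 1 ms @ x # spots (a + 2 * of_int h) ns"
    and a: "a = 2 * real (length ms) - 1" and x: "a \<le> x" "x \<le> a + 2 * of_int h"
    and total: "total cs = a + 2 * of_int h - 1 + 2 * real (length ns)"
    and valid: "valid (rev ms)" "valid ns"
    and test: "\<And>b b'. b \<in> set (bounds (rev ms)) \<Longrightarrow> b' \<in> set (bounds ns) \<Longrightarrow> gap_test h N D b b'"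
    and D: "0 \<le> peval D \<alpha>"
  obtains L where "(x, L) \<in> set cs" "peval D \<alpha> * L \<le> peval N \<alpha>"
proof -
  obtain xs c ys where cs: "cs = xs @ c # ys" and fx: "map fst xs = spots 1 ms"
      and c: "fst c = x" and fy: "map fst ys = spots (a + 2 * of_int h) ns"
    using fst by (auto simp: map_eq_append_conv map_eq_Cons_conv)
  define L where "L = snd c"
  have c: "c = (x, L)" using c by (cases c) (simp add: L_def)
  have len: "ms \<noteq> []" "0 < last ms"
    using valid_hd[OF valid(1)] by (auto simp: hd_rev)
  have ne: "xs \<noteq> []" "fst (last xs) = a"
  proof -
    obtain ms' where ms: "ms = ms' @ [last ms]" using len(1) by (metis append_butlast_last_id)
    have "spots 1 ms = spots 1 ms' @ replicate (last ms) a"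
      using a by (subst ms, subst spots_append) (simp add: ms[symmetric], subst (2) ms, simp)
    then have "spots 1 ms \<noteq> [] \<and> last (spots 1 ms) = a" using len(2) by simp
    then show "xs \<noteq> []" "fst (last xs) = a" using fx by (metis list.map_disc_iff last_map)+
  qed
  have nys: "ys \<noteq> []" "fst (hd ys) = a + 2 * of_int h"
  proof -
    have "spots (a + 2 * of_int h) ns \<noteq> [] \<and> hd (spots (a + 2 * of_int h) ns) = a + 2 * of_int h"
      using valid_hd[OF valid(2)] by (cases ns) (auto simp: hd_append)
    then show "ys \<noteq> []" "fst (hd ys) = a + 2 * of_int h" using fy by (metis list.map_disc_iff hd_map)+
  qed
  define z where "z = total xs"
  have ch: "chain \<alpha> 0 xs" "balanced \<alpha> z (last xs) c" "balanced \<alpha> (z + L) c (hd ys)" "chain \<alpha> (z + L) ys"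
    using chain ne nys unfolding cs by (auto simp: chain_append chain_Cons z_def L_def)
  \<comment> \<open>The reflection \<open>t \<mapsto> a + 1 - t\<close> moves the group at
    \<open>a\<close>, the neighbour of the deviator, to \<open>1\<close> and thereby makes it the
    first of its stack.\<close>
  have "\<exists>b\<in>set (bounds (rev ms)). dominates \<alpha> b (1 - 1 - (a + 1 - z)) (snd (hd (mirror (a + 1) xs)))"
  proof (rule stack_bound[OF \<alpha>])
    show "chain \<alpha> (a + 1 - z) (mirror (a + 1) xs)" using chain_mirror[OF ch(1), of "a + 1"] by (simp add: z_def)
    show "map fst (mirror (a + 1) xs) = spots 1 (rev ms)"
      unfolding map_fst_mirror fx rev_spots using a by simp
    show "a + 1 - z + total (mirror (a + 1) xs) = 1 - 1 + 2 * real (length (rev ms))"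
      using a by (simp add: z_def)
  qed (rule valid)
  moreover have "snd (hd (mirror (a + 1) xs)) = snd (last xs)"
    using ne(1) by (simp add: mirror_def hd_rev last_map case_prod_unfold)
  ultimately obtain b where b: "b \<in> set (bounds (rev ms))" "dominates \<alpha> b (z - a - 1) (snd (last xs))"
    by (auto simp: algebra_simps)
  have "\<exists>b'\<in>set (bounds ns). dominates \<alpha> b' (a + 2 * of_int h - 1 - (z + L)) (snd (hd ys))"
    using total by (intro stack_bound[OF \<alpha> ch(4) fy _ valid(2)]) (simp add: cs z_def L_def)
  then obtain b' where b': "b' \<in> set (bounds ns)"
      "dominates \<alpha> b' (a + 2 * of_int h - 1 - (z + L)) (snd (hd ys))" by blast
  have s1: "side \<alpha> (of_int h) (x - a - of_int h) (z - a - of_int h) L (snd (last xs)) b"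
    using ch(2) ne(2) x b(2) by (intro side_balanced) (auto simp: c prod_eq_iff balanced_def)
  \<comment> \<open>Negation turns the right neighbour into a left one at
    \<open>- (a + 2 * h)\<close>.\<close>
  have "balanced \<alpha> (0 - (z + L)) (0 - (a + 2 * of_int h), snd (hd ys)) (0 - x, L)"
    using balanced_mirror[OF ch(3), of 0] nys(2) by (simp add: c)
  then have "side \<alpha> (of_int h) (0 - x - (0 - (a + 2 * of_int h)) - of_int h)
      (0 - (z + L) - (0 - (a + 2 * of_int h)) - of_int h) L (snd (hd ys)) b'"
    using x b'(2) by (intro side_balanced) (auto simp: algebra_simps)
  then have s2: "side \<alpha> (of_int h) (- (x - a - of_int h)) (- (z - a - of_int h + L)) L (snd (hd ys)) b'"
    by (simp add: algebra_simps)
  have "peval D \<alpha> * L \<le> peval N \<alpha>"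
    using gap_bound[OF \<alpha> s1 s2 bounds_pos[OF \<alpha> valid(1) b(1)] bounds_pos[OF \<alpha> valid(2) b'(1)]
        test[OF b(1) b'(1)] D] .
  moreover have "(x, L) \<in> set cs" by (simp add: cs c)
  ultimately show ?thesis using that by blast
qed

text \<open>
  A facility to the left of the first pair is treated as if it were co-located with it and stood on its
  right: its load is at most that of the pair as soon as it exceeds \<open>1\<close>.
\<close>

lemma end_sides:
  fixes h :: int
  assumes chain: "chain \<alpha> 0 cs" and fst: "map fst cs = x # replicate M 1 @ spots (1 + 2 * of_int h) ns"
    and x: "x \<le> 1" and h: "1 \<le> h" and M: "M = 1 \<or> M = 2"
    and total: "total cs = 2 * of_int h + 2 * real (length ns)" and valid: "valid ns"
  obtains L where "(x, L) \<in> set cs"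
    "L \<le> 1 \<or> (\<exists>y z l l'. \<exists>b\<in>set (bounds [M]). \<exists>b'\<in>set (bounds ns).
        side \<alpha> (of_int h) y z L l b \<and> side \<alpha> (of_int h) (- y) (- (z + L)) L l' b')"
proof -
  obtain c xs ys where cs: "cs = c # xs @ ys" and fx: "map fst xs = replicate M 1"
      and c: "fst c = x" and fy: "map fst ys = spots (1 + 2 * of_int h) ns"
    using fst by (auto simp: map_eq_append_conv map_eq_Cons_conv)
  define L where "L = snd c"
  have c: "c = (x, L)" using c by (cases c) (simp add: L_def)
  have nx: "xs \<noteq> []" using fx M by auto
  have nys: "ys \<noteq> []" "fst (hd ys) = 1 + 2 * of_int h"
  proof -
    have "spots (1 + 2 * of_int h) ns \<noteq> [] \<and> hd (spots (1 + 2 * of_int h) ns) = 1 + 2 * of_int h"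
      using valid_hd[OF valid] by (cases ns) (auto simp: hd_append)
    then show "ys \<noteq> []" "fst (hd ys) = 1 + 2 * of_int h" using fy by (metis list.map_disc_iff hd_map)+
  qed
  define l where "l = snd (hd xs)"
  define w where "w = L + M * l"
  have chx: "chain \<alpha> L xs"
    using chain nx unfolding cs by (simp add: chain_append chain_Cons c)
  have xs: "xs = replicate M (1, l)"
    unfolding l_def using chain_replicate[OF chx fx] M by auto
  have tx: "total xs = M * l" using xs by (metis map_replicate snd_conv sum_list_replicate)
  have ch: "balanced \<alpha> L (x, L) (1, l)" "balanced \<alpha> w (1, l) (hd ys)" "chain \<alpha> w ys"
    using chain nx nys tx xs M unfolding cs
    by (auto simp: chain_append chain_Cons c w_def)
  have mem: "(x, L) \<in> set cs" by (simp add: cs c)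
  show ?thesis
  proof (cases "L \<le> 1")
    case True
    then show ?thesis using that mem by blast
  next
    case False
    define l' where "l' = snd (hd ys)"
    \<comment> \<open>The boundary \<open>L\<close> is to the right of both locations, so the
      distances to it differ by \<open>1 - x \<ge> 0\<close>.\<close>
    have Ll: "L \<le> l"
    proof -
      have "\<bar>x - L\<bar> = L - x" "\<bar>1 - L\<bar> = L - 1" using False x by auto
      then have *: "\<alpha> * (l - L) = (1 - \<alpha>) * (1 - x)"
        using ch(1) by (simp add: balanced_def algebra_simps)
      show ?thesis
      proof (cases "\<alpha> = 0")
        case True
        then show ?thesis using * ch(1) by (simp add: balanced_def)
      next
        case False
        have "0 \<le> \<alpha> * (l - L)" using * \<alpha> x by simp
        then show ?thesis using False \<alpha> by (simp add: zero_le_mult_iff)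
      qed
    qed
    have bal: "\<alpha> * l + (1 - \<alpha>) * \<bar>1 - w\<bar> = \<alpha> * l' + (1 - \<alpha>) * \<bar>1 + 2 * of_int h - w\<bar>"
      using ch(2) nys(2) by (simp add: balanced_def l'_def)
    have "\<exists>b'\<in>set (bounds ns). dominates \<alpha> b' (1 + 2 * of_int h - 1 - w) l'"
      unfolding l'_def using total tx
      by (intro stack_bound[OF \<alpha> ch(3) fy _ valid]) (simp add: cs w_def c)
    then obtain b' where b': "b' \<in> set (bounds ns)" "dominates \<alpha> b' (2 * of_int h - w) l'" by auto
    define b :: bound where "b = ([int M], [1], [2], 3 - int M)"
    have b: "b \<in> set (bounds [M])" by (simp add: b_def)
    \<comment> \<open>The order is exchanged: the group is taken to serve \<open>[0, M * l]\<close>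
      and the facility the remainder up to \<open>w\<close>, so that the boundary \<open>w\<close>
      towards the next group is unchanged. Coordinates are centred at \<open>1 + h\<close>.\<close>
    have s1: "side \<alpha> (of_int h) (- of_int h) (M * l - 1 - of_int h) L l b"
    proof -
      have "\<alpha> * L \<le> \<alpha> * l" using Ll \<alpha> by (intro mult_left_mono)
      moreover have "dominates \<alpha> b (M * l - 2) l" by (simp add: dominates_def b_def)
      ultimately show ?thesis using Ll by (auto simp: side_def intro: exI[of _ 0])
    qed
    have s2: "side \<alpha> (of_int h) (- (- of_int h)) (- (M * l - 1 - of_int h + L)) L l' b'"
    proof -
      have eq: "- (M * l - 1 - of_int h + L) = 1 + of_int h - w" by (simp add: w_def)
      have "\<bar>of_int h - (1 + of_int h - w)\<bar> = \<bar>1 - w\<bar>"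
        "\<bar>- of_int h - (1 + of_int h - w)\<bar> = \<bar>1 + 2 * of_int h - w\<bar>" by auto
      moreover have "\<alpha> * L \<le> \<alpha> * l" using Ll \<alpha> by (intro mult_left_mono)
      \<comment> \<open>Seen from the right the facility stands \<open>2 * h\<close> away from its
        neighbour, which makes \<zeta> equal to \<open>2 * h / \<alpha>\<close>.\<close>
      moreover have "\<exists>\<zeta>\<ge>0. of_int h + of_int h = \<alpha> * \<zeta> \<and> L + (1 - \<alpha>) * \<zeta> \<le> l'"
        if "1 + of_int h - w < - of_int h"
      proof -
        have "\<bar>1 - w\<bar> = w - 1" "\<bar>1 + 2 * of_int h - w\<bar> = w - 1 - 2 * of_int h" using that h by auto
        then have *: "\<alpha> * l + (1 - \<alpha>) * (2 * of_int h) = \<alpha> * l'"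
          using bal by (simp add: algebra_simps)
        have "\<alpha> \<noteq> 0" using * h by auto
        then have "\<alpha> * (l + (1 - \<alpha>) * (2 * of_int h / \<alpha>)) = \<alpha> * l'" using * by (simp add: field_simps)
        then have "l + (1 - \<alpha>) * (2 * of_int h / \<alpha>) = l'" using \<open>\<alpha> \<noteq> 0\<close> by simp
        then show ?thesis using \<open>\<alpha> \<noteq> 0\<close> Ll \<alpha> h by (intro exI[of _ "2 * of_int h / \<alpha>"]) auto
      qed
      ultimately show ?thesis using bal b'(2) unfolding eq side_def by auto
    qed
    show ?thesis using that[OF mem] s1 s2 b b' by blast
  qed
qed

end

section \<open>Locating the gap that contains a deviation\<close>

lemma gaps_testD:
  assumes "gaps_test N D m" "i < length m - 1" "0 < m ! i" "h = (if m ! (i + 1) = 0 then 2 else 1)"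
  shows "valid (rev (take (i + 1) m))" "valid (drop (i + h) m)"
    "b \<in> set (bounds (rev (take (i + 1) m))) \<Longrightarrow> b' \<in> set (bounds (drop (i + h) m)) \<Longrightarrow>
      gap_test (int h) N D b b'"
proof -
  have "i \<in> set [0..<length m - 1]" using assms(2) by simp
  then have "valid (rev (take (i + 1) m)) \<and> valid (drop (i + h) m) \<and>
      list_all (\<lambda>b. list_all (gap_test (int h) N D b) (bounds (drop (i + h) m)))
        (bounds (rev (take (i + 1) m)))"
    using assms(1,3) unfolding gaps_test_def assms(4) Let_def list_all_iff by blast
  then show "valid (rev (take (i + 1) m))" "valid (drop (i + h) m)"
    "b \<in> set (bounds (rev (take (i + 1) m))) \<Longrightarrow> b' \<in> set (bounds (drop (i + h) m)) \<Longrightarrow>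
      gap_test (int h) N D b b'"
    by (auto simp: list_all_iff)
qed

lemma gaps_test_adj:
  assumes "gaps_test N D m" "i < length m - 1"
  shows "0 < m ! i \<or> 0 < m ! (i + 1)"
  using assms by (simp add: gaps_test_def list_all_iff)

lemma gaps_test_gap:
  assumes test: "gaps_test N D m" and x: "1 \<le> x" "x \<le> 2 * real (length m) - 1"
  obtains i h :: nat where "i + h < length m" "1 \<le> h" "h = 2 \<Longrightarrow> m ! (i + 1) = 0" "h \<le> 2"
    "2 * real i + 1 \<le> x" "x \<le> 2 * real (i + h) + 1"
    "valid (rev (take (i + 1) m))" "valid (drop (i + h) m)"
    "\<And>b b'. b \<in> set (bounds (rev (take (i + 1) m))) \<Longrightarrow> b' \<in> set (bounds (drop (i + h) m)) \<Longrightarrow>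
      gap_test (int h) N D b b'"
proof -
  note result = that
  define k where "k = length m"
  have k: "2 \<le> k" using test by (simp add: gaps_test_def k_def)
  note adj = gaps_test_adj[OF test, folded k_def]
  have use: thesis if i: "i < k - 1" "0 < m ! i" "2 * real i + 1 \<le> x"
    and up: "x \<le> 2 * real (i + (if m ! (i + 1) = 0 then 2 else 1)) + 1" for i
  proof -
    define h :: nat where "h = (if m ! (i + 1) = 0 then 2 else 1)"
    note t = gaps_testD[OF test i(1)[unfolded k_def] i(2) h_def]
    have "drop (i + h) m \<noteq> []" using valid_hd[OF t(2)] by simp
    then have "i + h < length m" by (simp only: drop_eq_Nil not_le)
    moreover have "1 \<le> h" "h \<le> 2" "h = 2 \<Longrightarrow> m ! (i + 1) = 0"
      by (auto simp: h_def split: if_splits)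
    moreover have "x \<le> 2 * real (i + h) + 1" using up by (simp only: h_def)
    ultimately show thesis using result[of i h] t i(3) by blast
  qed
  obtain q :: nat where q: "real q \<le> (x - 1) / 2" "(x - 1) / 2 < real q + 1"
  proof -
    define y where "y = (x - 1) / 2"
    have "0 \<le> y" using x(1) by (simp add: y_def)
    then have "real (nat \<lfloor>y\<rfloor>) = of_int \<lfloor>y\<rfloor>" by simp
    then show thesis
      using that[of "nat \<lfloor>y\<rfloor>"] of_int_floor_le[of y] floor_correct[of y] by (simp add: y_def)
  qed
  \<comment> \<open>The cap assigns the location of the last group, \<open>2 * k - 1\<close>, to the
    last gap instead of going past it.\<close>
  define j where "j = min q (k - 2)"
  have j: "j < k - 1" using k by (auto simp: j_def)
  have j1: "2 * real j + 1 \<le> x"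
  proof -
    have "real j \<le> real q" by (simp add: j_def)
    then show ?thesis using q(1) by simp
  qed
  have j2: "x \<le> 2 * real (j + 1) + 1"
  proof (cases "q \<le> k - 2")
    case True
    then show ?thesis using q(2) by (simp add: j_def)
  next
    case False
    then have "real (j + 1) = real k - 1" using k by (simp add: j_def min_def of_nat_diff)
    then show ?thesis using x(2) by (simp add: k_def)
  qed
  show thesis
  proof (cases "0 < m ! j")
    case True
    moreover have "x \<le> 2 * real (j + (if m ! (j + 1) = 0 then 2 else 1)) + 1" using j2 by simp
    ultimately show thesis using use[of j] j j1 by blast
  next
    \<comment> \<open>Here \<open>x\<close> is in the right half of a double gap, which starts one
      position earlier.\<close>
    case False
    have "hd m = m ! 0" using k by (intro hd_conv_nth) (auto simp: k_def)
    moreover have "0 < hd m" using test by (simp add: gaps_test_def)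
    ultimately have "j \<noteq> 0" using False by (cases j) auto
    then obtain i where ji: "j = i + 1" by (metis Suc_eq_plus1 not0_implies_Suc)
    have "0 < m ! i" using adj[of i] j False by (simp add: ji)
    moreover have "i < k - 1" "2 * real i + 1 \<le> x" using j j1 by (simp_all add: ji)
    moreover have "x \<le> 2 * real (i + (if m ! (i + 1) = 0 then 2 else 1)) + 1"
      using j2 False by (simp add: ji)
    ultimately show thesis using use[of i] by blast
  qed
qed

lemma gaps_test_first:
  assumes "gaps_test N D m"
  shows "\<exists>h ns. m = hd m # replicate (h - 1) 0 @ ns \<and> 1 \<le> h \<and> valid [hd m] \<and> valid ns \<and>
    (\<forall>b\<in>set (bounds [hd m]). \<forall>b'\<in>set (bounds ns). gap_test (int h) N D b b')"
proof -
  obtain p q us where m: "m = p # q # us"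
    using assms by (cases m; cases "tl m") (auto simp: gaps_test_def)
  define h :: nat where "h = (if m ! (0 + 1) = 0 then 2 else 1)"
  have "0 < length m - 1" "0 < m ! 0" using assms by (auto simp: m gaps_test_def)
  note t = gaps_testD[OF assms this h_def]
  have tk: "rev (take (0 + 1) m) = [hd m]" by (simp add: m)
  have "m = hd m # replicate (h - 1) 0 @ drop (0 + h) m" by (simp add: m h_def)
  moreover have "1 \<le> h" by (simp add: h_def)
  ultimately show ?thesis using t[unfolded tk] by blast
qed

lemma gaps_test_last:
  assumes "gaps_test N D m"
  shows "\<exists>h ns. rev m = last m # replicate (h - 1) 0 @ ns \<and> 1 \<le> h \<and> valid [last m] \<and> valid ns \<and>
    (\<forall>b\<in>set (bounds [last m]). \<forall>b'\<in>set (bounds ns). gap_test (int h) N D b' b)"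
proof -
  have len: "2 \<le> length m" using assms by (simp add: gaps_test_def)
  obtain ws q where ws: "m = ws @ [q]" using len by (cases m rule: rev_cases) auto
  then obtain us p where "ws = us @ [p]" using len by (cases ws rule: rev_cases) auto
  then have m: "m = us @ [p, q]" using ws by simp
  show ?thesis
  proof (cases "p = 0")
    case False
    have i: "length us < length m - 1" "0 < m ! length us"
        "1 = (if m ! (length us + 1) = 0 then 2 else (1 :: nat))"
      using assms False by (auto simp: m gaps_test_def nth_append)
    have eq: "rev (take (length us + 1) m) = p # rev us" "drop (length us + 1) m = [last m]"
      by (simp_all add: m)
    have "rev m = last m # replicate (1 - 1) 0 @ p # rev us" by (simp add: m)
    note d = gaps_testD[OF assms i, unfolded eq]
    show ?thesis
    proof (rule exI[of _ 1], rule exI[of _ "p # rev us"], intro conjI ballI)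
      show "rev m = last m # replicate (1 - 1) 0 @ p # rev us" by fact
      show "gap_test (int 1) N D b' b" if "b \<in> set (bounds [last m])" "b' \<in> set (bounds (p # rev us))" for b b'
        using d(3)[OF that(2,1)] .
    qed (use d in simp_all)
  next
    case True
    have "us \<noteq> []"
    proof
      assume "us = []"
      then show False using assms True by (simp add: m gaps_test_def)
    qed
    then obtain vs r where us: "us = vs @ [r]" by (cases us rule: rev_cases) auto
    have m': "m = vs @ [r, 0, q]" using m True us by simp
    have mem: "length vs \<in> set [0..<length m - 1]" by (simp add: m')
    have "0 < m ! length vs \<or> 0 < m ! (length vs + 1)"
      using gaps_test_adj[OF assms] mem by simp
    moreover have "m ! length vs = r" "m ! (length vs + 1) = 0"
      by (simp_all add: m' nth_append)
    ultimately have i: "length vs < length m - 1" "0 < m ! length vs"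
        "2 = (if m ! (length vs + 1) = 0 then 2 else (1 :: nat))"
      using mem by simp_all
    have eq: "rev (take (length vs + 1) m) = r # rev vs" "drop (length vs + 2) m = [last m]"
      by (simp_all add: m')
    have "rev m = last m # replicate (2 - 1) 0 @ r # rev vs" by (simp add: m')
    note d = gaps_testD[OF assms i, unfolded eq]
    show ?thesis
    proof (rule exI[of _ 2], rule exI[of _ "r # rev vs"], intro conjI ballI)
      show "rev m = last m # replicate (2 - 1) 0 @ r # rev vs" by fact
      show "gap_test (int 2) N D b' b" if "b \<in> set (bounds [last m])" "b' \<in> set (bounds (r # rev vs))" for b b'
        using d(3)[OF that(2,1)] .
    qed (use d in simp_all)
  qed
qed

context
  fixes \<alpha> :: real
  assumes \<alpha>: "0 \<le> \<alpha>" "\<alpha> \<le> 1"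
begin

text \<open>The right end of the line is reached by reflection, so the certificate may be available
  for \<open>m\<close> or for \<open>rev m\<close>. In the second case the gap test has its two
  bounds exchanged, which is absorbed by exchanging the two sides in
  \<open>gap_bound\<close>.\<close>

lemma end_bound:
  assumes chain: "chain \<alpha> 0 cs" and fst: "map fst cs = x # spots 1 m" and x: "x \<le> 1"
    and total: "total cs = 2 * real (length m)"
    and test: "gaps_test N D m \<or> gaps_test N D (rev m)" and D: "0 \<le> peval D \<alpha>"
  obtains L where "(x, L) \<in> set cs" "peval D \<alpha> * L \<le> peval N \<alpha>"
proof -
  have len: "length m \<ge> 2" and DN: "peval D \<alpha> \<le> peval N \<alpha>"
    using test nonneg_test[OF _ \<alpha>, of "psub N D"] by (auto simp: gaps_test_def)
  have "\<exists>h ns. m = hd m # replicate (h - 1) 0 @ ns \<and> 1 \<le> h \<and> valid [hd m] \<and> valid ns \<and>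
      (\<forall>b\<in>set (bounds [hd m]). \<forall>b'\<in>set (bounds ns). gap_test (int h) N D b b' \<or> gap_test (int h) N D b' b)"
    using test
  proof
    assume "gaps_test N D m"
    then show ?thesis using gaps_test_first by blast
  next
    assume t: "gaps_test N D (rev m)"
    have "last (rev m) = hd m" using len by (cases m) auto
    then show ?thesis using gaps_test_last[OF t] unfolding rev_rev_ident by simp blast
  qed
  then obtain h ns where m: "m = hd m # replicate (h - 1) 0 @ ns" and h: "1 \<le> h"
    and v: "valid [hd m]" "valid ns"
    and gt: "\<And>b b'. b \<in> set (bounds [hd m]) \<Longrightarrow> b' \<in> set (bounds ns) \<Longrightarrow>
        gap_test (int h) N D b b' \<or> gap_test (int h) N D b' b"
    by blast
  have holes: "spots a (replicate j 0 @ ns) = spots (a + 2 * real j) ns" for a j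
    by (induction j arbitrary: a) (auto simp: algebra_simps)
  have "spots 1 m = replicate (hd m) 1 @ spots (1 + 2 * of_int (int h)) ns"
    using h by (subst m) (simp add: holes of_nat_diff)
  moreover have "total cs = 2 * of_int (int h) + 2 * real (length ns)"
    using h unfolding total by (subst m) (simp add: of_nat_diff)
  ultimately obtain L where L: "(x, L) \<in> set cs"
    "L \<le> 1 \<or> (\<exists>y z l l'. \<exists>b\<in>set (bounds [hd m]). \<exists>b'\<in>set (bounds ns).
        side \<alpha> (of_int (int h)) y z L l b \<and> side \<alpha> (of_int (int h)) (- y) (- (z + L)) L l' b')"
    using end_sides[OF \<alpha> chain, of x "hd m" "int h" ns] fst x h v by auto
  from L(2) have "peval D \<alpha> * L \<le> peval N \<alpha>"
  proof
    assume "L \<le> 1"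
    then have "peval D \<alpha> * L \<le> peval D \<alpha> * 1" using D by (intro mult_left_mono)
    then show ?thesis using DN by simp
  next
    assume "\<exists>y z l l'. \<exists>b\<in>set (bounds [hd m]). \<exists>b'\<in>set (bounds ns).
        side \<alpha> (of_int (int h)) y z L l b \<and> side \<alpha> (of_int (int h)) (- y) (- (z + L)) L l' b'"
    then obtain y z l l' b b' where b: "b \<in> set (bounds [hd m])" "b' \<in> set (bounds ns)"
      and s: "side \<alpha> (of_int (int h)) y z L l b" "side \<alpha> (of_int (int h)) (- y) (- (z + L)) L l' b'"
      by blast
    have p: "bound_pos \<alpha> b" "bound_pos \<alpha> b'" using bounds_pos[OF \<alpha>] v b by blast+
    from gt[OF b] show ?thesis
    proof
      assume "gap_test (int h) N D b b'"
      then show ?thesis by (rule gap_bound[OF \<alpha> s p _ D])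
    next
      assume g: "gap_test (int h) N D b' b"
      have s': "side \<alpha> (of_int (int h)) (- (- y)) (- (- (z + L) + L)) L l b" using s(1) by simp
      show ?thesis by (rule gap_bound[OF \<alpha> s(2) s' p(2,1) g D])
    qed
  qed
  then show ?thesis using that L(1) by blast
qed

lemma deviation_bound:
  assumes chain: "chain \<alpha> 0 cs" and sorted: "sorted (map fst cs)"
    and mset: "mset (map fst cs) = add_mset x (mset (spots 1 m))"
    and total: "total cs = 2 * real (length m)"
    and test: "gaps_test N D m" and D: "0 \<le> peval D \<alpha>" and c: "c \<in> set cs" "fst c = x"
  shows "peval D \<alpha> * snd c \<le> peval N \<alpha>"
proof -
  define k where "k = length m"
  have "\<exists>L. (x, L) \<in> set cs \<and> peval D \<alpha> * L \<le> peval N \<alpha>"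
  proof -
    consider "x < 1" | "2 * real k - 1 < x" | "1 \<le> x" "x \<le> 2 * real k - 1" by linarith
    then show ?thesis
    proof cases
      case 1
      have "x \<le> y" if "y \<in> set (spots 1 m)" for y using 1 set_spots(1)[OF that] by simp
      then have "sorted (x # spots 1 m)" by (simp add: sorted_spots)
      then have fc: "map fst cs = x # spots 1 m" using sorted mset by (intro sorted_unique) auto
      have "x \<le> 1" using 1 by simp
      from end_bound[OF chain fc this total disjI1[OF test] D] show ?thesis by blast
    next
      case 2
      define W where "W = 2 * real k"
      have W: "W - 0 - total cs = 0" using total by (simp add: W_def k_def)
      have ch: "chain \<alpha> 0 (mirror W cs)" using chain_mirror[OF chain, of W] unfolding W .
      have "y \<le> x" if "y \<in> set (spots 1 m)" for y using 2 set_spots(2)[OF that] by (simp add: k_def)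
      then have "sorted (spots 1 m @ [x])" by (simp add: sorted_append sorted_spots)
      then have fc: "map fst cs = spots 1 m @ [x]" using sorted mset by (intro sorted_unique) auto
      have fm: "map fst (mirror W cs) = (W - x) # spots 1 (rev m)"
        unfolding map_fst_mirror fc using rev_spots[of W 1 m] by (simp add: W_def k_def)
      have "total (mirror W cs) = 2 * real (length (rev m))" using total by simp
      moreover have "W - x \<le> 1" using 2 by (simp add: W_def)
      moreover have "gaps_test N D (rev (rev m))" using test by simp
      ultimately obtain L where L: "(W - x, L) \<in> set (mirror W cs)" "peval D \<alpha> * L \<le> peval N \<alpha>"
        using end_bound[OF ch fm _ _ disjI2 D] by blast
      then have "(x, L) \<in> set cs" by (auto simp: mirror_def)
      then show ?thesis using L(2) by blast
    next
      case 3
      obtain i h where i: "i + h < length m" "1 \<le> h" "h = 2 \<Longrightarrow> m ! (i + 1) = 0" "h \<le> 2"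
        "2 * real i + 1 \<le> x" "x \<le> 2 * real (i + h) + 1"
        "valid (rev (take (i + 1) m))" "valid (drop (i + h) m)"
        "\<And>b b'. b \<in> set (bounds (rev (take (i + 1) m))) \<Longrightarrow> b' \<in> set (bounds (drop (i + h) m)) \<Longrightarrow>
          gap_test (int h) N D b b'"
        using gaps_test_gap[OF test, of x] 3 unfolding k_def by blast
      define a where "a = 2 * real i + 1"
      have "spots (a + 2) (drop (i + 1) m) = spots (a + 2 * real h) (drop (i + h) m)"
      proof (cases "h = 2")
        case True
        then have "drop (i + 1) m = 0 # drop (i + h) m"
          using i(1,3) Cons_nth_drop_Suc[of "i + 1" m] by auto
        moreover have "a + 2 + 2 = a + 2 * real h" using True by simp
        ultimately show ?thesis by (simp only: spots.simps replicate_0 append_Nil)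
      next
        case False
        then have "h = 1" using i by auto
        then show ?thesis by simp
      qed
      moreover have "spots 1 m = spots 1 (take (i + 1) m) @ spots (a + 2) (drop (i + 1) m)"
        using spots_append[of 1 "take (i + 1) m" "drop (i + 1) m"] i(1) by (simp add: a_def algebra_simps)
      ultimately have sp: "spots 1 m = spots 1 (take (i + 1) m) @ spots (a + 2 * of_int (int h)) (drop (i + h) m)"
        by simp
      have len: "real (length (take (i + 1) m)) = real i + 1" using i(1,2) by simp
      have "sorted (spots 1 (take (i + 1) m) @ x # spots (a + 2 * of_int (int h)) (drop (i + h) m))"
      proof -
        have "y \<le> x" if "y \<in> set (spots 1 (take (i + 1) m))" for y
          using set_spots(2)[OF that] i(5) len by simp
        moreover have "x \<le> y" if "y \<in> set (spots (a + 2 * of_int (int h)) (drop (i + h) m))" for y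
          using set_spots(1)[OF that] i(6) by (simp add: a_def)
        ultimately show ?thesis by (fastforce simp: sorted_append sorted_spots)
      qed
      then have fc: "map fst cs = spots 1 (take (i + 1) m) @ x # spots (a + 2 * of_int (int h)) (drop (i + h) m)"
        using sorted mset sp by (intro sorted_unique) auto
      have "a = 2 * real (length (take (i + 1) m)) - 1" using len by (simp add: a_def)
      moreover have "total cs = a + 2 * of_int (int h) - 1 + 2 * real (length (drop (i + h) m))"
        using total i(1) by (simp add: a_def of_nat_diff)
      moreover have "a \<le> x" "x \<le> a + 2 * of_int (int h)" using i(5,6) by (simp_all add: a_def)
      ultimately show ?thesis
        using middle_bound[OF \<alpha> chain fc _ _ _ _ i(7,8,9) D] by blast
    qed
  qed
  then obtain L where L: "(x, L) \<in> set cs" "peval D \<alpha> * L \<le> peval N \<alpha>" by blast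
  \<comment> \<open>The facility found at \<open>x\<close> need not be the entry \<open>c\<close>,
    but it has the same load.\<close>
  then show ?thesis using chain_colocated[OF chain sorted c(1) L(1)] c(2) by simp
qed

end

section \<open>Loads without deviation\<close>

text \<open>
  The stack of \<open>m + 1\<close> pairs: numerators of the constant term and of the slope in its bound.
\<close>

fun pair_stack :: "nat \<Rightarrow> int list \<times> int list" where
  "pair_stack 0 = ([2], [1])"
| "pair_stack (Suc m) = (let (A, B) = pair_stack m; Q = slope_num A B in
     (padd (0 # A) (pscale 2 Q), Q))"

definition pair_A :: "nat \<Rightarrow> int list" where
  "pair_A m = fst (pair_stack m)"

definition pair_B :: "nat \<Rightarrow> int list" where
  "pair_B m = snd (pair_stack m)"

definition pair_Q :: "nat \<Rightarrow> int list" where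
  "pair_Q m = slope_num (pair_A m) (pair_B m)"

lemma pair_A_0: "peval (pair_A 0) \<alpha> = 2" and pair_B_0: "peval (pair_B 0) \<alpha> = 1"
  by (simp_all add: pair_A_def pair_B_def)

lemma pair_A_Suc: "peval (pair_A (Suc m)) \<alpha> = \<alpha> * peval (pair_A m) \<alpha> + 2 * peval (pair_B (Suc m)) \<alpha>"
  and pair_B_Suc: "peval (pair_B (Suc m)) \<alpha> = \<alpha> * peval (pair_B m) \<alpha> + 2 * (1 - \<alpha>) * peval (pair_A m) \<alpha>"
  and pair_Q: "peval (pair_Q m) \<alpha> = peval (pair_B (Suc m)) \<alpha>"
  by (simp_all add: pair_A_def pair_B_def pair_Q_def case_prod_unfold Let_def)

text \<open>
  The loads for \<open>a + 1\<close> pairs, a single facility and \<open>b + 1\<close> pairs, where \<open>i\<close> counts these groups from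
  \<open>0\<close>. For \<open>a = b\<close> the common factor \<open>pair_Q a\<close> is cancelled.
\<close>

definition load_den :: "nat \<Rightarrow> nat \<Rightarrow> int list" where
  "load_den a b = (if a = b then padd (pair_Q a) (pscale 2 (0 # pair_A a))
     else padd (pmul (pair_Q a) (pair_Q b))
       (0 # padd (pmul (pair_Q a) (pair_A b)) (pmul (pair_Q b) (pair_A a))))"

definition load_num :: "nat \<Rightarrow> nat \<Rightarrow> nat \<Rightarrow> int list" where
  "load_num a b i = padd (load_den a b)
     (if i \<le> a then replicate (a + 1 - i) 0 @ pmul (pair_B i) (if a = b then [1] else pair_Q b)
      else if i = a + 1 then pmul (pair_Q a) (if a = b then [1] else pair_Q b)
      else replicate (i - (a + 1)) 0 @ pmul (pair_B (a + b + 2 - i)) (if a = b then [1] else pair_Q a))"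

text \<open>Without deviation the load of group \<open>i\<close> is \<open>num i / d\<close>; the claimed ratio is \<open>N / D\<close>.\<close>

definition ratio_test :: "int list \<Rightarrow> int list \<Rightarrow> int list \<Rightarrow> nat list \<Rightarrow> nat \<Rightarrow> (nat \<Rightarrow> int list) \<Rightarrow> bool" where
  "ratio_test N D d m k num \<longleftrightarrow>
     list_all (\<lambda>i. gaps_test (pmul N (num i)) (pmul D d) (m[i := m ! i - 1])) [0..<k]"

context
  fixes \<alpha> :: real
  assumes \<alpha>: "0 \<le> \<alpha>" "\<alpha> \<le> 1"
begin

lemma pair_pos: "0 < peval (pair_A m) \<alpha>" "0 < peval (pair_B m) \<alpha>"
proof (induction m)
  case (Suc m)
  have B: "0 < peval (pair_B (Suc m)) \<alpha>"
    unfolding pair_B_Suc using slope_pos[OF \<alpha>] Suc by blast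
  then show "0 < peval (pair_B (Suc m)) \<alpha>" "0 < peval (pair_A (Suc m)) \<alpha>"
    unfolding pair_A_Suc[of m] using \<alpha> Suc by (auto intro!: add_nonneg_pos)
qed (simp_all add: pair_A_0 pair_B_0)

lemma pair_stack_split:
  assumes chain: "chain \<alpha> v cs" and fst: "map fst cs = spots a (replicate (Suc (Suc m)) 2)"
  obtains l l' ys where "cs = (a, l) # (a, l) # ys" "map fst ys = spots (a + 2) (replicate (Suc m) 2)"
    "chain \<alpha> (v + 2 * l) ys" "l' = snd (hd ys)"
    "\<alpha> * l + (1 - \<alpha>) * \<bar>a - (v + 2 * l)\<bar> = \<alpha> * l' + (1 - \<alpha>) * \<bar>a + 2 - (v + 2 * l)\<bar>"
proof -
  obtain c c' d ys where cs: "cs = c # c' # d # ys" and f: "fst c = a" "fst c' = a" "fst d = a + 2"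
      "map fst (d # ys) = spots (a + 2) (replicate (Suc m) 2)"
    using fst by (auto simp: numeral_2_eq_2 Cons_eq_map_conv map_eq_Cons_conv)
  define l where "l = snd c"
  have "snd c' = l" using chain f by (auto simp: cs balanced_def l_def)
  then have c: "c = (a, l)" "c' = (a, l)" using f by (auto simp: l_def prod_eq_iff)
  have "chain \<alpha> (v + 2 * l) (d # ys)" "balanced \<alpha> (v + 2 * l) (a, l) d"
    using chain by (auto simp: cs c algebra_simps)
  then show ?thesis using that[of l "d # ys" "snd d"] f by (simp add: cs c balanced_def)
qed

text \<open>For pairs the constant term of the bound is \<open>1\<close>, so balance and width are
  preserved when every load \<open>l\<close> becomes \<open>2 - l\<close> and the excess changes its
  sign. The lower estimate is \<open>step_near\<close> for these reflected quantities.\<close>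

lemma pair_stack_bounds:
  assumes "chain \<alpha> v cs" "map fst cs = spots a (replicate (Suc m) 2)"
    and "v + total cs = a - 1 + 2 * real (Suc m)"
  shows "peval (pair_A m) \<alpha> * snd (hd cs) \<le> peval (pair_A m) \<alpha> + peval (pair_B m) \<alpha> * max (a - 1 - v) (- 1)"
    and "peval (pair_A m) \<alpha> + peval (pair_B m) \<alpha> * min (a - 1 - v) 1 \<le> peval (pair_A m) \<alpha> * snd (hd cs)"
proof -
  have "peval (pair_A m) \<alpha> * snd (hd cs) \<le> peval (pair_A m) \<alpha> + peval (pair_B m) \<alpha> * max (a - 1 - v) (- 1) \<and>
    peval (pair_A m) \<alpha> + peval (pair_B m) \<alpha> * min (a - 1 - v) 1 \<le> peval (pair_A m) \<alpha> * snd (hd cs)"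
    using assms
  proof (induction m arbitrary: v a cs)
    case 0
    then obtain c c' where cs: "cs = [c, c']" "fst c = a" "fst c' = a"
      by (auto simp: numeral_2_eq_2 map_eq_Cons_conv)
    then have "snd c = snd c'" using 0(1) by (simp add: balanced_def)
    then have "2 * snd c = 2 + (a - 1 - v)" using 0(3) cs by simp
    then show ?case using cs by (auto simp: pair_A_0 pair_B_0)
  next
    case (Suc m)
    obtain l l' ys where cs: "cs = (a, l) # (a, l) # ys" "map fst ys = spots (a + 2) (replicate (Suc m) 2)"
      "chain \<alpha> (v + 2 * l) ys" "l' = snd (hd ys)"
      "\<alpha> * l + (1 - \<alpha>) * \<bar>a - (v + 2 * l)\<bar> = \<alpha> * l' + (1 - \<alpha>) * \<bar>a + 2 - (v + 2 * l)\<bar>"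
      using pair_stack_split[OF Suc.prems(1,2)] by blast
    define r where "r = a - 1 - v"
    define \<delta> where "\<delta> = r + 2 * 1 - 2 * l"
    have IH: "peval (pair_A m) \<alpha> * l' \<le> peval (pair_A m) \<alpha> + peval (pair_B m) \<alpha> * max \<delta> (- 1)"
      "peval (pair_A m) \<alpha> + peval (pair_B m) \<alpha> * min \<delta> 1 \<le> peval (pair_A m) \<alpha> * l'"
      using Suc.IH[OF cs(3,2)] Suc.prems(3) unfolding cs(4)[symmetric]
      by (simp_all add: cs(1) \<delta>_def r_def algebra_simps)
    have abs: "\<bar>a - (v + 2 * l)\<bar> = \<bar>2 * 1 - 1 - \<delta>\<bar>" "\<bar>a + 2 - (v + 2 * l)\<bar> = \<bar>1 + \<delta>\<bar>"
      by (auto simp: \<delta>_def r_def)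
    have bal: "\<alpha> * (l - l') = (1 - \<alpha>) * (\<bar>1 + \<delta>\<bar> - \<bar>2 * 1 - 1 - \<delta>\<bar>)"
      using cs(5) unfolding abs by (simp only: right_diff_distrib)
    have up: "peval (pair_A (Suc m)) \<alpha> * l \<le> \<alpha> * peval (pair_A m) \<alpha> + 2 * 1 * peval (pair_B (Suc m)) \<alpha> -
        2 * (1 - 1) * (1 - \<alpha>) * peval (pair_A m) \<alpha> + peval (pair_B (Suc m)) \<alpha> * max r (- (2 * 1 + 1 - 2))"
      unfolding pair_A_Suc
      by (rule step_near[OF \<alpha> pair_pos _ _ _ IH(1) \<delta>_def bal _ pair_B_Suc]) (use pair_pos in \<open>auto intro: less_imp_le\<close>)
    have flip: "peval (pair_A m) \<alpha> * (2 - l') \<le> peval (pair_A m) \<alpha> + peval (pair_B m) \<alpha> * max (- \<delta>) (- 1)"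
    proof -
      have "max (- \<delta>) (- 1) = - min \<delta> 1" by (auto simp: max_def min_def)
      then show ?thesis using IH(2) by (simp add: algebra_simps)
    qed
    have bal': "\<alpha> * ((2 - l) - (2 - l')) = (1 - \<alpha>) * (\<bar>1 + - \<delta>\<bar> - \<bar>2 * 1 - 1 - - \<delta>\<bar>)"
    proof -
      have "\<alpha> * ((2 - l) - (2 - l')) = - (\<alpha> * (l - l'))" by (simp add: algebra_simps)
      also have "\<dots> = (1 - \<alpha>) * (\<bar>2 * 1 - 1 - \<delta>\<bar> - \<bar>1 + \<delta>\<bar>)" unfolding bal by (simp add: algebra_simps)
      finally show ?thesis by simp
    qed
    have \<delta>': "- \<delta> = - r + 2 * 1 - 2 * (2 - l)" by (simp add: \<delta>_def)
    have down: "peval (pair_A (Suc m)) \<alpha> * (2 - l) \<le>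
        \<alpha> * peval (pair_A m) \<alpha> + 2 * 1 * peval (pair_B (Suc m)) \<alpha> -
        2 * (1 - 1) * (1 - \<alpha>) * peval (pair_A m) \<alpha> + peval (pair_B (Suc m)) \<alpha> * max (- r) (- (2 * 1 + 1 - 2))"
      unfolding pair_A_Suc
      by (rule step_near[OF \<alpha> pair_pos _ _ _ flip \<delta>' bal' _ pair_B_Suc]) (use pair_pos in \<open>auto intro: less_imp_le\<close>)
    have m: "max (- r) (- (2 * 1 + 1 - 2)) = - min r 1" by (auto simp: max_def min_def)
    have eq: "peval (pair_A (Suc m)) \<alpha> = \<alpha> * peval (pair_A m) \<alpha> + 2 * peval (pair_B (Suc m)) \<alpha>"
      by (rule pair_A_Suc)
    have "peval (pair_A (Suc m)) \<alpha> * l \<le> peval (pair_A (Suc m)) \<alpha> + peval (pair_B (Suc m)) \<alpha> * max r (- 1)"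
      using up eq by simp
    moreover have "peval (pair_A (Suc m)) \<alpha> + peval (pair_B (Suc m)) \<alpha> * min r 1 \<le> peval (pair_A (Suc m)) \<alpha> * l"
      using down unfolding m by (simp add: eq algebra_simps)
    ultimately show ?case by (simp add: cs(1) r_def)
  qed
  then show "peval (pair_A m) \<alpha> * snd (hd cs) \<le> peval (pair_A m) \<alpha> + peval (pair_B m) \<alpha> * max (a - 1 - v) (- 1)"
    "peval (pair_A m) \<alpha> + peval (pair_B m) \<alpha> * min (a - 1 - v) 1 \<le> peval (pair_A m) \<alpha> * snd (hd cs)"
    by auto
qed

text \<open>For an excess between \<open>0\<close> and \<open>1\<close> no clamp is active and the
  two estimates coincide. The excess behind the first pair is
  \<open>\<alpha> * pair_A m / pair_A (Suc m)\<close> times the old one and stays in that range, so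
  the factors telescope along the stack.\<close>

lemma pair_stack_load:
  assumes "chain \<alpha> v cs" "map fst cs = spots a (replicate (Suc m) 2)"
    and "v + total cs = a - 1 + 2 * real (Suc m)" and "0 \<le> a - 1 - v" "a - 1 - v \<le> 1"
    and "c \<in> set cs" "fst c = a + 2 * real j" "j \<le> m"
  shows "peval (pair_A m) \<alpha> * (snd c - 1) = \<alpha> ^ j * peval (pair_B (m - j)) \<alpha> * (a - 1 - v)"
  using assms
proof (induction m arbitrary: v a cs j)
  case 0
  then obtain d d' where cs: "cs = [d, d']" "fst d = a" "fst d' = a"
    by (auto simp: numeral_2_eq_2 map_eq_Cons_conv)
  then have "snd d = snd d'" using 0(1) by (simp add: balanced_def)
  then have "2 * snd d = 2 + (a - 1 - v)" using 0(3) cs by simp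
  then show ?case using 0 cs \<open>snd d = snd d'\<close> by (auto simp: pair_A_0 pair_B_0)
next
  case (Suc m)
  obtain l l' ys where cs: "cs = (a, l) # (a, l) # ys" "map fst ys = spots (a + 2) (replicate (Suc m) 2)"
    "chain \<alpha> (v + 2 * l) ys"
    using pair_stack_split[OF Suc.prems(1,2)] by blast
  define r where "r = a - 1 - v"
  have r: "0 \<le> r" "r \<le> 1" using Suc.prems by (auto simp: r_def)
  have l: "peval (pair_A (Suc m)) \<alpha> * (l - 1) = peval (pair_B (Suc m)) \<alpha> * r"
  proof -
    have "max (a - 1 - v) (- 1) = r" "min (a - 1 - v) 1 = r" using r by (auto simp: r_def)
    then show ?thesis using pair_stack_bounds[OF Suc.prems(1-3)] by (simp add: cs(1) algebra_simps)
  qed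
  show ?case
  proof (cases j)
    case 0
    have "c \<notin> set ys"
    proof
      assume "c \<in> set ys"
      then have "fst c \<in> set (spots (a + 2) (replicate (Suc m) 2))" unfolding cs(2)[symmetric] by simp
      from set_spots(1)[OF this] show False using Suc.prems(7) 0 by simp
    qed
    then have "c = (a, l)" using Suc.prems(6) by (auto simp: cs(1))
    then show ?thesis using l 0 by (simp add: r_def)
  next
    case (Suc i)
    have c: "c \<in> set ys" using Suc.prems(6,7) Suc by (auto simp: cs(1))
    define \<delta> where "\<delta> = a + 2 - 1 - (v + 2 * l)"
    have \<delta>: "\<delta> = r - 2 * (l - 1)" by (simp add: \<delta>_def r_def)
    have A\<delta>: "peval (pair_A (Suc m)) \<alpha> * \<delta> = \<alpha> * peval (pair_A m) \<alpha> * r"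
    proof -
      have "peval (pair_A (Suc m)) \<alpha> * \<delta> =
          peval (pair_A (Suc m)) \<alpha> * r - 2 * (peval (pair_A (Suc m)) \<alpha> * (l - 1))"
        unfolding \<delta> by (simp add: algebra_simps)
      also have "\<dots> = \<alpha> * peval (pair_A m) \<alpha> * r"
        unfolding l by (simp add: pair_A_Suc algebra_simps)
      finally show ?thesis .
    qed
    have "0 \<le> peval (pair_A (Suc m)) \<alpha> * \<delta>" unfolding A\<delta> using \<alpha> r pair_pos[of m] by simp
    then have \<delta>0: "0 \<le> \<delta>" using pair_pos(1)[of "Suc m"] by (simp add: zero_le_mult_iff)
    have "0 \<le> peval (pair_A (Suc m)) \<alpha> * (l - 1)" unfolding l using r pair_pos[of "Suc m"] by simp
    then have "0 \<le> l - 1" using pair_pos(1)[of "Suc m"] by (simp add: zero_le_mult_iff)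
    then have \<delta>1: "\<delta> \<le> 1" using r by (simp add: \<delta>)
    have "peval (pair_A m) \<alpha> * (snd c - 1) = \<alpha> ^ i * peval (pair_B (m - i)) \<alpha> * \<delta>"
      unfolding \<delta>_def
      using Suc.IH[OF cs(3,2) _ _ _ c] Suc.prems(3,7,8) \<delta>0 \<delta>1 Suc by (simp add: cs(1) \<delta>_def)
    then have "peval (pair_A m) \<alpha> * (peval (pair_A (Suc m)) \<alpha> * (snd c - 1)) =
        \<alpha> ^ i * peval (pair_B (m - i)) \<alpha> * (peval (pair_A (Suc m)) \<alpha> * \<delta>)"
      by (simp add: ac_simps)
    also have "\<dots> = peval (pair_A m) \<alpha> * (\<alpha> ^ j * peval (pair_B (Suc m - j)) \<alpha> * r)"
      unfolding A\<delta> by (simp add: Suc ac_simps)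
    finally show ?thesis using pair_pos(1)[of m] by (simp add: r_def)
  qed
qed

text \<open>\<open>X\<close> is the load of a single facility between two stacks. The point is that
  no clamp is active: \<open>r > 1\<close> would force \<open>X > 1\<close> and hence
  \<open>r' > 0\<close>, contradicting \<open>r + r' = 2 - X\<close>, and \<open>r < - 1\<close>
  would force \<open>X < 1\<close> and hence \<open>r' > 1\<close>. What remains is a linear system
  in \<open>r\<close>, \<open>r'\<close> and \<open>X\<close> with determinant
  \<open>E\<close>.\<close>

lemma centre_balance:
  fixes A B A' B' X r r' l l' :: real
  assumes pos: "0 < A" "0 < B" "0 < A'" "0 < B'"
    and up: "A * l \<le> A + B * max r (- 1)" "A' * l' \<le> A' + B' * max r' (- 1)"
    and low: "A + B * min r 1 \<le> A * l" "A' + B' * min r' 1 \<le> A' * l'"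
    and bal: "\<alpha> * (X - l) = (1 - \<alpha>) * (\<bar>1 + r\<bar> - \<bar>1 - r\<bar>)"
      "\<alpha> * (X - l') = (1 - \<alpha>) * (\<bar>1 + r'\<bar> - \<bar>1 - r'\<bar>)"
    and sum: "r + r' = 2 - X"
  defines "Q \<equiv> \<alpha> * B + 2 * (1 - \<alpha>) * A" and "Q' \<equiv> \<alpha> * B' + 2 * (1 - \<alpha>) * A'"
  defines "E \<equiv> Q * Q' + \<alpha> * (Q * A' + Q' * A)"
  shows "0 < E" "E * r = \<alpha> * Q' * A" "E * r' = \<alpha> * Q * A'" "E * X = E + Q * Q'"
    "0 \<le> r" "r \<le> 1" "0 \<le> r'" "r' \<le> 1"
proof -
  have upper: "\<alpha> * A * (X - 1) \<le> (\<alpha> * B + 2 * (1 - \<alpha>) * A) * max r (- 1)"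
    if "0 < A" "A * l \<le> A + B * max r (- 1)" "\<alpha> * (X - l) = (1 - \<alpha>) * (\<bar>1 + r\<bar> - \<bar>1 - r\<bar>)" for A B l r
  proof -
    have "\<alpha> * (X - l) \<le> (1 - \<alpha>) * (2 * max r (- 1))"
      unfolding that(3) using \<alpha> by (intro mult_left_mono) auto
    then have "A * (\<alpha> * (X - l)) \<le> A * ((1 - \<alpha>) * (2 * max r (- 1)))"
      using that by (intro mult_left_mono) auto
    moreover have "\<alpha> * (A * l) \<le> \<alpha> * (A + B * max r (- 1))" using that \<alpha> by (intro mult_left_mono)
    ultimately show ?thesis by (simp add: algebra_simps)
  qed
  have lower: "(\<alpha> * B + 2 * (1 - \<alpha>) * A) * min r 1 \<le> \<alpha> * A * (X - 1)"
    if "0 < A" "A + B * min r 1 \<le> A * l" "\<alpha> * (X - l) = (1 - \<alpha>) * (\<bar>1 + r\<bar> - \<bar>1 - r\<bar>)" for A B l r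
  proof -
    have "(1 - \<alpha>) * (2 * min r 1) \<le> \<alpha> * (X - l)"
      unfolding that(3) using \<alpha> by (intro mult_left_mono) auto
    then have "A * ((1 - \<alpha>) * (2 * min r 1)) \<le> A * (\<alpha> * (X - l))"
      using that by (intro mult_left_mono) auto
    moreover have "\<alpha> * (A + B * min r 1) \<le> \<alpha> * (A * l)" using that \<alpha> by (intro mult_left_mono)
    ultimately show ?thesis by (simp add: algebra_simps)
  qed
  note U = upper[OF pos(1) up(1) bal(1), folded Q_def] upper[OF pos(3) up(2) bal(2), folded Q'_def]
  note V = lower[OF pos(1) low(1) bal(1), folded Q_def] lower[OF pos(3) low(2) bal(2), folded Q'_def]
  have Q0: "0 < Q" "0 < Q'" using slope_pos[OF \<alpha>] pos by (simp_all add: Q_def Q'_def)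
  have le1: "r \<le> 1"
    if "q * min r 1 \<le> \<alpha> * A * (X - 1)" "\<alpha> * A' * (X - 1) \<le> q' * max r' (- 1)"
      "0 < q" "0 < q'" "0 < A" "0 < A'" "r + r' = 2 - X" for q q' A A' r r'
  proof (rule ccontr)
    assume "\<not> r \<le> 1"
    then have "0 < \<alpha> * A * (X - 1)" using that(1,3) by (simp add: min_def)
    moreover have "\<alpha> * A * (X - 1) \<le> 0" if "X \<le> 1"
      using that \<alpha> \<open>0 < A\<close> by (intro mult_nonneg_nonpos) auto
    ultimately have "0 < X - 1" "\<alpha> \<noteq> 0" by fastforce+
    then have "0 < \<alpha>" using \<alpha> by simp
    then have "0 < \<alpha> * A' * (X - 1)" using that(6) \<open>0 < X - 1\<close> by simp
    moreover have "q' * max r' (- 1) < 0"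
      using \<open>\<not> r \<le> 1\<close> \<open>0 < X - 1\<close> that(4,7) by (intro mult_pos_neg) auto
    ultimately show False using that(2) by simp
  qed
  show r1: "r \<le> 1" using le1[OF V(1) U(2) Q0 pos(1,3) sum] .
  show r1': "r' \<le> 1" using le1[OF V(2) U(1) Q0(2,1) pos(3,1)] sum by simp
  have ge: "- 1 \<le> r"
    if "\<alpha> * A * (X - 1) \<le> q * max r (- 1)" "r' \<le> 1" "0 < q" "0 < A" "r + r' = 2 - X" for q A r r'
  proof (rule ccontr)
    assume r: "\<not> - 1 \<le> r"
    then have "\<alpha> * A * (X - 1) < 0" using that(1,3) by (simp add: max_def)
    moreover have "0 \<le> \<alpha> * A * (X - 1)" if "1 \<le> X" using that \<alpha> \<open>0 < A\<close> by simp
    ultimately have "X < 1" by fastforce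
    then show False using r that(2,5) by simp
  qed
  have eq: "Q * r = \<alpha> * A * (X - 1)" "Q' * r' = \<alpha> * A' * (X - 1)"
  proof -
    have "- 1 \<le> r" using ge[OF U(1) r1' Q0(1) pos(1) sum] .
    then have "max r (- 1) = r" "min r 1 = r" using r1 by auto
    then show "Q * r = \<alpha> * A * (X - 1)" using U(1) V(1) by simp
    have "- 1 \<le> r'" using ge[OF U(2) r1 Q0(2) pos(3)] sum by simp
    then have "max r' (- 1) = r'" "min r' 1 = r'" using r1' by auto
    then show "Q' * r' = \<alpha> * A' * (X - 1)" using U(2) V(2) by simp
  qed
  have "E * r = Q' * (Q * r) + \<alpha> * A' * (Q * r) + \<alpha> * Q' * A * r"
    unfolding E_def by (simp add: algebra_simps)
  also have "\<dots> = \<alpha> * A * (Q' * ((X - 1) + r) + \<alpha> * A' * (X - 1))"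
    unfolding eq(1) by (simp add: algebra_simps)
  also have "\<dots> = \<alpha> * A * (Q' * ((X - 1) + r + r'))"
    unfolding eq(2)[symmetric] by (simp add: algebra_simps)
  also have "(X - 1) + r + r' = 1" using sum by simp
  finally show Er: "E * r = \<alpha> * Q' * A" by (simp add: ac_simps)
  have "E * r' = Q * (Q' * r') + \<alpha> * A * (Q' * r') + \<alpha> * Q * A' * r'"
    unfolding E_def by (simp add: algebra_simps)
  also have "\<dots> = \<alpha> * A' * (Q * ((X - 1) + r') + \<alpha> * A * (X - 1))"
    unfolding eq(2) by (simp add: algebra_simps)
  also have "\<dots> = \<alpha> * A' * (Q * ((X - 1) + r + r'))"
    unfolding eq(1)[symmetric] by (simp add: algebra_simps)
  also have "(X - 1) + r + r' = 1" using sum by simp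
  finally show Er': "E * r' = \<alpha> * Q * A'" by (simp add: ac_simps)
  have X: "X = 2 - r - r'" using sum by simp
  have "E * X = 2 * E - E * r - E * r'" unfolding X by (simp add: algebra_simps)
  then show "E * X = E + Q * Q'" unfolding Er Er' by (simp add: E_def algebra_simps)
  show E0: "0 < E" unfolding E_def using Q0 pos \<alpha> by (intro add_pos_nonneg mult_nonneg_nonneg add_nonneg_nonneg) auto
  have "0 \<le> E * r" "0 \<le> E * r'" unfolding Er Er' using Q0 pos \<alpha> by auto
  then show "0 \<le> r" "0 \<le> r'" using E0 by (simp_all add: zero_le_mult_iff)
qed

end

section \<open>Loads of the even and the odd paired configuration\<close>

context
  fixes \<alpha> :: real
  assumes \<alpha>: "0 \<le> \<alpha>" "\<alpha> \<le> 1"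
begin

text \<open>The pairs exactly fill their cells, so the excess of the whole stack is
  \<open>0\<close>.\<close>

lemma even_load:
  assumes "chain \<alpha> 0 cs" "map fst cs = spots 1 (replicate (Suc m) 2)" "total cs = 2 * real (Suc m)"
    and "c \<in> set cs" "fst c = 2 * real i + 1" "i \<le> m"
  shows "snd c = 1"
proof -
  have "peval (pair_A m) \<alpha> * (snd c - 1) = \<alpha> ^ i * peval (pair_B (m - i)) \<alpha> * (1 - 1 - 0)"
    by (rule pair_stack_load[OF \<alpha> assms(1,2)]) (use assms in auto)
  then show ?thesis using pair_pos(1)[OF \<alpha>, of m] by simp
qed

text \<open>The single facility at \<open>t\<close> separates two stacks of pairs:
  \<open>centre_balance\<close> determines their excesses, and \<open>pair_stack_load\<close>
  distributes these over the groups. Reflecting the left stack by \<open>t - 1\<close> gives its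
  group \<open>i\<close> the number \<open>a - i\<close>, counted from the centre.\<close>

lemma odd_load:
  fixes a b :: nat
  defines "t \<equiv> 2 * real (Suc a) + 1"
  assumes chain: "chain \<alpha> 0 cs" and sorted: "sorted (map fst cs)"
    and fst: "map fst cs = spots 1 (replicate (Suc a) 2) @ t # spots (t + 2) (replicate (Suc b) 2)"
    and total: "total cs = 2 * real (a + b + 3)"
    and c: "c \<in> set cs" "fst c = 2 * real i + 1" and i: "i < a + b + 3"
  shows "0 < peval (load_den a b) \<alpha>" "peval (load_den a b) \<alpha> * snd c = peval (load_num a b i) \<alpha>"
proof -
  define S where "S = spots 1 (replicate (Suc a) 2)"
  define xs where "xs = take (length S) cs"
  define zs where "zs = drop (length S) cs"
  have "map fst xs = S" and fz: "map fst zs = t # spots (t + 2) (replicate (Suc b) 2)"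
    unfolding xs_def zs_def take_map[symmetric] drop_map[symmetric] fst S_def[symmetric]
    by (rule append_eq_conv_conj[THEN iffD1, THEN conjunct1, OF refl, symmetric]
      append_eq_conv_conj[THEN iffD1, THEN conjunct2, OF refl, symmetric])+
  then have fx: "map fst xs = spots 1 (replicate (Suc a) 2)" by (simp only: S_def)
  obtain d ys where zs: "zs = d # ys" using fz by (cases zs) simp_all
  have d: "fst d = t" and fy: "map fst ys = spots (t + 2) (replicate (Suc b) 2)"
    using fz unfolding zs by simp_all
  have cs: "cs = xs @ d # ys" unfolding zs[symmetric] xs_def zs_def by simp
  define X where "X = snd d"
  define z where "z = total xs"
  define ms where "ms = mirror (t - 1) xs"
  have ms: "map fst ms = spots 1 (replicate (Suc a) 2)"
    unfolding ms_def map_fst_mirror fx rev_spots rev_replicate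
    by (rule arg_cong2[of _ _ _ _ spots]) (simp_all add: t_def)
  have hd_spots: "hd (spots s (replicate (Suc m) 2)) = s" "spots s (replicate (Suc m) 2) \<noteq> []" for s m
    by (simp_all add: numeral_2_eq_2)
  have ne: "xs \<noteq> []" "ys \<noteq> []" "ms \<noteq> []"
    using fx fy ms hd_spots(2) by (metis list.map_disc_iff)+
  have lx: "fst (last xs) = t - 2"
  proof -
    have "fst (hd ms) = 1" using ms ne(3) hd_spots(1) by (metis hd_map)
    moreover have "hd ms = (t - 1 - fst (last xs), snd (last xs))"
      using ne by (simp add: ms_def mirror_def hd_rev last_map case_prod_unfold)
    ultimately show ?thesis by simp
  qed
  have hy: "fst (hd ys) = t + 2" using fy ne(2) hd_spots(1) by (metis hd_map)
  have ch: "chain \<alpha> 0 xs" "balanced \<alpha> z (last xs) d" "balanced \<alpha> (z + X) d (hd ys)" "chain \<alpha> (z + X) ys"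
    using chain ne unfolding cs by (auto simp: chain_append chain_Cons z_def X_def)
  have chm: "chain \<alpha> (t - 1 - z) ms" using chain_mirror[OF ch(1), of "t - 1"] by (simp add: ms_def z_def)
  define r where "r = 1 - 1 - (t - 1 - z)"
  define r' where "r' = t + 2 - 1 - (z + X)"
  have tm: "t - 1 - z + total ms = 1 - 1 + 2 * real (Suc a)" by (simp add: ms_def z_def t_def)
  have ty: "z + X + total ys = t + 2 - 1 + 2 * real (Suc b)"
    using total by (simp add: cs z_def X_def t_def)
  have hm: "snd (hd ms) = snd (last xs)"
    using ne by (simp add: ms_def mirror_def hd_rev last_map case_prod_unfold)
  note B1 = pair_stack_bounds[OF \<alpha> chm ms tm, folded r_def, unfolded hm]
  note B2 = pair_stack_bounds[OF \<alpha> ch(4) fy ty, folded r'_def]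
  have bal1: "\<alpha> * (X - snd (last xs)) = (1 - \<alpha>) * (\<bar>1 + r\<bar> - \<bar>1 - r\<bar>)"
  proof -
    have "\<bar>t - 2 - z\<bar> = \<bar>1 + r\<bar>" "\<bar>t - z\<bar> = \<bar>1 - r\<bar>" by (auto simp: r_def)
    then show ?thesis using ch(2) lx d by (simp add: balanced_def X_def right_diff_distrib)
  qed
  have bal2: "\<alpha> * (X - snd (hd ys)) = (1 - \<alpha>) * (\<bar>1 + r'\<bar> - \<bar>1 - r'\<bar>)"
  proof -
    have "\<bar>t + 2 - (z + X)\<bar> = \<bar>1 + r'\<bar>" "\<bar>t - (z + X)\<bar> = \<bar>1 - r'\<bar>" by (auto simp: r'_def)
    then show ?thesis using ch(3) hy d by (simp add: balanced_def X_def right_diff_distrib)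
  qed
  have sum: "r + r' = 2 - X" by (simp add: r_def r'_def)
  define A where "A = peval (pair_A a) \<alpha>"
  define A' where "A' = peval (pair_A b) \<alpha>"
  define Q where "Q = peval (pair_Q a) \<alpha>"
  define Q' where "Q' = peval (pair_Q b) \<alpha>"
  define E where "E = Q * Q' + \<alpha> * (Q * A' + Q' * A)"
  have Q: "Q = \<alpha> * peval (pair_B a) \<alpha> + 2 * (1 - \<alpha>) * peval (pair_A a) \<alpha>"
    "Q' = \<alpha> * peval (pair_B b) \<alpha> + 2 * (1 - \<alpha>) * peval (pair_A b) \<alpha>"
    by (simp_all add: Q_def Q'_def pair_Q pair_B_Suc)
  note p = pair_pos[OF \<alpha>]
  note cb = centre_balance[OF \<alpha> p p B1(1) B2(1) B1(2) B2(2) bal1 bal2 sum,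
      folded Q, folded A_def A'_def, folded E_def]
  have pos: "0 < A" "0 < A'" "0 < Q" "0 < Q'"
    using p by (simp_all add: A_def A'_def Q_def Q'_def pair_Q)
  have EX: "E * (X - 1) = Q * Q'" using cb(4) by (simp add: algebra_simps)
  have left: "E * (snd c - 1) = \<alpha> ^ (a + 1 - i) * peval (pair_B i) \<alpha> * Q'" if "i \<le> a"
  proof -
    have "c \<in> set xs"
    proof -
      have "fst c < t" using that c(2) by (simp add: t_def)
      then have "c \<noteq> d" "c \<notin> set ys"
      proof -
        show "c \<noteq> d" using \<open>fst c < t\<close> d by auto
        show "c \<notin> set ys"
        proof
          assume "c \<in> set ys"
          then have "fst c \<in> set (spots (t + 2) (replicate (Suc b) 2))" unfolding fy[symmetric] by simp
          from set_spots(1)[OF this] show False using \<open>fst c < t\<close> by simp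
        qed
      qed
      then show ?thesis using c(1) by (auto simp: cs)
    qed
    then have "(t - 1 - fst c, snd c) \<in> set ms" by (force simp: ms_def mirror_def)
    moreover have "t - 1 - fst c = 1 + 2 * real (a - i)" using c(2) that by (simp add: t_def of_nat_diff)
    ultimately have "(1 + 2 * real (a - i), snd c) \<in> set ms" by (simp only:)
    from pair_stack_load[OF \<alpha> chm ms tm _ _ this, of "a - i"] cb(5,6)
    have "A * (snd c - 1) = \<alpha> ^ (a - i) * peval (pair_B (a - (a - i))) \<alpha> * r"
      by (simp add: r_def A_def)
    then have "A * (E * (snd c - 1)) = \<alpha> ^ (a - i) * peval (pair_B i) \<alpha> * (E * r)"
      using that by (simp add: ac_simps)
    also have "\<dots> = A * (\<alpha> ^ (a + 1 - i) * peval (pair_B i) \<alpha> * Q')"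
      unfolding cb(2) using that by (simp add: Suc_diff_le ac_simps)
    finally show ?thesis using pos by simp
  qed
  have right: "E * (snd c - 1) = \<alpha> ^ (i - (a + 1)) * peval (pair_B (a + b + 2 - i)) \<alpha> * Q" if "a + 1 < i"
  proof -
    have "c \<in> set ys"
    proof -
      have "t < fst c" using that c(2) by (simp add: t_def)
      moreover have "c \<notin> set xs"
      proof
        assume "c \<in> set xs"
        then have "fst c \<in> set (spots 1 (replicate (Suc a) 2))" unfolding fx[symmetric] by simp
        from set_spots(2)[OF this] show False using \<open>t < fst c\<close> by (simp add: t_def)
      qed
      ultimately show ?thesis using c(1) d by (auto simp: cs)
    qed
    moreover have "fst c = t + 2 + 2 * real (i - (a + 2))" using c(2) that by (simp add: t_def of_nat_diff)
    moreover have "i - (a + 2) \<le> b" using i by simp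
    ultimately have "A' * (snd c - 1) = \<alpha> ^ (i - (a + 2)) * peval (pair_B (b - (i - (a + 2)))) \<alpha> * r'"
      using pair_stack_load[OF \<alpha> ch(4) fy ty, of c "i - (a + 2)"] cb(7,8)
      by (simp add: r'_def A'_def)
    then have "A' * (E * (snd c - 1)) = \<alpha> ^ (i - (a + 2)) * peval (pair_B (a + b + 2 - i)) \<alpha> * (E * r')"
      using that i by (simp add: ac_simps)
    also have "\<dots> = A' * (\<alpha> ^ Suc (i - (a + 2)) * peval (pair_B (a + b + 2 - i)) \<alpha> * Q)"
      unfolding cb(3) by (simp add: ac_simps)
    also have "Suc (i - (a + 2)) = i - (a + 1)" using that by simp
    finally show ?thesis using pos by simp
  qed
  have mid: "E * (snd c - 1) = Q * Q'" if "i = a + 1"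
  proof -
    have "d \<in> set cs" "fst c = fst d" using that c d by (auto simp: cs t_def)
    then have "snd c = X" using chain_colocated[OF chain sorted c(1)] by (simp add: X_def)
    then show ?thesis using EX by simp
  qed
  show "0 < peval (load_den a b) \<alpha>"
  proof (cases "a = b")
    case False
    then show ?thesis using cb(1) by (simp add: load_den_def E_def Q_def Q'_def A_def A'_def)
  next
    case True
    have "0 < Q + 2 * (\<alpha> * A)" using pos \<alpha> by (intro add_pos_nonneg) auto
    then show ?thesis using True by (simp add: load_den_def Q_def A_def)
  qed
  show "peval (load_den a b) \<alpha> * snd c = peval (load_num a b i) \<alpha>"
  proof (cases "a = b")
    case False
    have den: "peval (load_den a b) \<alpha> = E"
      using False by (simp add: load_den_def E_def Q_def Q'_def A_def A'_def)
    have num: "peval (load_num a b i) \<alpha> = E + (if i \<le> a then \<alpha> ^ (a + 1 - i) * peval (pair_B i) \<alpha> * Q'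
        else if i = a + 1 then Q * Q' else \<alpha> ^ (i - (a + 1)) * peval (pair_B (a + b + 2 - i)) \<alpha> * Q)"
      using False by (simp add: load_num_def den Q_def Q'_def)
    have "E * snd c = E + E * (snd c - 1)" by (simp add: algebra_simps)
    then show ?thesis unfolding den num using left mid right by auto
  next
    case True
    define F where "F = Q + 2 * (\<alpha> * A)"
    have QA: "Q' = Q" "A' = A" using True by (simp_all add: Q_def Q'_def A_def A'_def)
    have E: "E = Q * F" by (simp add: E_def F_def QA algebra_simps)
    have den: "peval (load_den a b) \<alpha> = F"
      using True by (simp add: load_den_def F_def Q_def A_def)
    have num: "peval (load_num a b i) \<alpha> = F + (if i \<le> a then \<alpha> ^ (a + 1 - i) * peval (pair_B i) \<alpha>
        else if i = a + 1 then Q else \<alpha> ^ (i - (a + 1)) * peval (pair_B (a + b + 2 - i)) \<alpha>)"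
      using True den by (simp add: load_num_def Q_def)
    have "Q * (F * (snd c - 1)) = Q * (if i \<le> a then \<alpha> ^ (a + 1 - i) * peval (pair_B i) \<alpha>
        else if i = a + 1 then Q else \<alpha> ^ (i - (a + 1)) * peval (pair_B (a + b + 2 - i)) \<alpha>)"
      using left mid right unfolding E QA by (auto simp: ac_simps)
    then have "F * (snd c - 1) = (if i \<le> a then \<alpha> ^ (a + 1 - i) * peval (pair_B i) \<alpha>
        else if i = a + 1 then Q else \<alpha> ^ (i - (a + 1)) * peval (pair_B (a + b + 2 - i)) \<alpha>)"
      using pos by simp
    moreover have "F * snd c = F + F * (snd c - 1)" by (simp add: algebra_simps)
    ultimately show ?thesis unfolding den num by simp
  qed
qed

lemma ratio_bound:
  assumes test: "ratio_test N D d m k num" and i: "i < k"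
    and chain: "chain \<alpha> 0 cs" and sorted: "sorted (map fst cs)"
    and mset: "mset (map fst cs) = add_mset x (mset (spots 1 (m[i := m ! i - 1])))"
    and total: "total cs = 2 * real (length m)"
    and c: "c \<in> set cs" "fst c = x"
    and D: "0 < peval D \<alpha>" and d: "0 < peval d \<alpha>" and l: "peval d \<alpha> * l = peval (num i) \<alpha>"
  shows "snd c \<le> peval N \<alpha> / peval D \<alpha> * l"
proof -
  have "gaps_test (pmul N (num i)) (pmul D d) (m[i := m ! i - 1])"
    using test i by (simp add: ratio_test_def list_all_iff)
  from deviation_bound[OF \<alpha> chain sorted mset _ this _ c]
  have "peval D \<alpha> * peval d \<alpha> * snd c \<le> peval N \<alpha> * (peval d \<alpha> * l)"
    using total D d l by simp
  then have "peval d \<alpha> * (peval D \<alpha> * snd c) \<le> peval d \<alpha> * (peval N \<alpha> * l)"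
    by (simp add: ac_simps)
  then show ?thesis using D d by (simp add: field_simps)
qed

end

section \<open>Existence of client equilibria\<close>

text \<open>Facility \<open>i\<close> of the sorted location vector \<open>T\<close> serves the clients between \<open>\<beta> (i - 1)\<close> and \<open>\<beta> i\<close>.\<close>

definition boundaries :: "nat \<Rightarrow> real \<Rightarrow> (nat \<Rightarrow> real) \<Rightarrow> (nat \<Rightarrow> real) \<Rightarrow> bool" where
  "boundaries n \<alpha> T \<beta> \<longleftrightarrow> \<beta> 0 = 0 \<and> \<beta> n = 1 \<and> (\<forall>i<n. \<beta> i \<le> \<beta> (Suc i)) \<and>
     (\<forall>i<n - 1. balanced \<alpha> (\<beta> (Suc i)) (T (Suc i), \<beta> (Suc i) - \<beta> i)
       (T (Suc (Suc i)), \<beta> (Suc (Suc i)) - \<beta> (Suc i)))"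

text \<open>For \<alpha> > 0 the balance at a boundary can be solved for the next load, so a trial
  value \<open>y\<close> of the first load determines the rest continuously. The delicate point is
  that the loads found are nonnegative: a negative one leaves its right boundary to the left of its
  facility, then all later loads are negative too, and the last boundary would stay left of
  \<open>T n\<close> instead of being \<open>1\<close>.\<close>

lemma boundaries_exist_pos:
  assumes \<alpha>: "0 < \<alpha>" "\<alpha> \<le> 1" and n: "1 \<le> n"
    and mono: "\<And>i. 1 \<le> i \<Longrightarrow> i < n \<Longrightarrow> T i \<le> T (Suc i)"
    and range: "\<And>i. 1 \<le> i \<Longrightarrow> i \<le> n \<Longrightarrow> 0 \<le> T i \<and> T i \<le> 1"
  shows "\<exists>\<beta>. boundaries n \<alpha> T \<beta>"
proof -
  define \<gamma> where "\<gamma> = (1 - \<alpha>) / \<alpha>"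
  have \<gamma>: "0 \<le> \<gamma>" using \<alpha> by (simp add: \<gamma>_def)
  define F where "F = (\<lambda>i b. \<bar>T (Suc i) - b\<bar> - \<bar>T i - b\<bar>)"
  define st where "st = (\<lambda>y. rec_nat (0, y)
    (\<lambda>i (b, l). let l' = (if i = 0 then y else l - \<gamma> * F i b) in (b + l', l')))"
  define b where "b = (\<lambda>y i. fst (st y i))"
  define l where "l = (\<lambda>y i. snd (st y i))"
  have b0: "b y 0 = 0" and l1: "l y (Suc 0) = y" and bS: "b y (Suc i) = b y i + l y (Suc i)"
    and lS: "l y (Suc (Suc i)) = l y (Suc i) - \<gamma> * F (Suc i) (b y (Suc i))" for y i
    by (simp_all add: b_def l_def st_def case_prod_unfold Let_def)
  have cont: "continuous_on UNIV (\<lambda>y. b y i) \<and> continuous_on UNIV (\<lambda>y. l y (Suc i))" for i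
  proof (induction i)
    case 0
    show ?case by (simp add: b0 l1 continuous_on_id)
  next
    case (Suc i)
    have "continuous_on UNIV (\<lambda>y. b y (Suc i))" using Suc unfolding bS by (intro continuous_intros) auto
    moreover from this have "continuous_on UNIV (\<lambda>y. l y (Suc (Suc i)))"
      using Suc unfolding lS F_def by (intro continuous_intros) auto
    ultimately show ?case by blast
  qed
  have low: "b 0 (Suc i) \<le> 0 \<and> l 0 (Suc i) \<le> 0" if "i < n" for i
    using that
  proof (induction i)
    case 0
    show ?case by (simp add: b0 l1 bS)
  next
    case (Suc i)
    then have IH: "b 0 (Suc i) \<le> 0" "l 0 (Suc i) \<le> 0" by auto
    have "0 \<le> F (Suc i) (b 0 (Suc i))"
      using IH(1) mono[of "Suc i"] range[of "Suc i"] Suc.prems by (simp add: F_def)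
    then have "0 \<le> \<gamma> * F (Suc i) (b 0 (Suc i))" using \<gamma> by simp
    then have "l 0 (Suc (Suc i)) \<le> 0" using IH by (simp add: lS)
    then show ?case using IH by (simp add: bS[of 0 "Suc i"])
  qed
  \<comment> \<open>Distances differ by at most \<open>1\<close>, so a step lowers the load by at
    most \<gamma>; starting here, all loads stay at least \<open>1\<close>.\<close>
  define M where "M = 1 + \<gamma> * n"
  have high: "1 + \<gamma> * (real n - real i) \<le> l M (Suc i) \<and> real (Suc i) \<le> b M (Suc i)" if "i < n" for i
    using that
  proof (induction i)
    case 0
    show ?case using \<gamma> by (simp add: b0 l1 bS M_def)
  next
    case (Suc i)
    then have IH: "1 + \<gamma> * (real n - real i) \<le> l M (Suc i)" "real (Suc i) \<le> b M (Suc i)" by auto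
    have "F (Suc i) (b M (Suc i)) \<le> 1"
      using mono[of "Suc i"] range[of "Suc i"] range[of "Suc (Suc i)"] Suc.prems by (auto simp: F_def)
    then have "\<gamma> * F (Suc i) (b M (Suc i)) \<le> \<gamma> * 1" using \<gamma> by (intro mult_left_mono)
    then have l: "1 + \<gamma> * (real n - real (Suc i)) \<le> l M (Suc (Suc i))"
      using IH(1) unfolding lS by (simp add: algebra_simps)
    moreover have "0 \<le> \<gamma> * (real n - real (Suc i))" using Suc.prems \<gamma> by simp
    ultimately have "1 \<le> l M (Suc (Suc i))" by linarith
    then have "real (Suc (Suc i)) \<le> b M (Suc (Suc i))" using IH(2) bS[of M "Suc i"] by simp
    then show ?case using l by simp
  qed
  obtain k where k: "n = Suc k" using n by (cases n) auto
  have "\<exists>y\<ge>0. y \<le> M \<and> b y n = 1"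
  proof (rule IVT')
    show "b 0 n \<le> 1" using low[of k] by (simp add: k)
    show "1 \<le> b M n" using high[of k] by (simp add: k)
    show "0 \<le> M" using \<gamma> by (simp add: M_def)
    show "continuous_on {0..M} (\<lambda>y. b y n)" using cont continuous_on_subset by blast
  qed
  then obtain y where y: "0 \<le> y" "b y n = 1" by blast
  have drop: "l y (Suc j) < 0 \<and> b y (Suc j) < T (Suc j)"
    if "l y (Suc i) < 0 \<and> b y (Suc i) < T (Suc i)" "i \<le> j" "j < n" for i j
    using that(2,3)
  proof (induction j rule: dec_induct)
    case base
    show ?case using that(1) by simp
  next
    case (step j)
    then have IH: "l y (Suc j) < 0" "b y (Suc j) < T (Suc j)" by auto
    have m: "T (Suc j) \<le> T (Suc (Suc j))" using mono[of "Suc j"] step by simp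
    then have "0 \<le> F (Suc j) (b y (Suc j))" using IH(2) by (simp add: F_def)
    then have "0 \<le> \<gamma> * F (Suc j) (b y (Suc j))" using \<gamma> by simp
    then show ?case using IH m by (simp add: lS bS[of y "Suc j"])
  qed
  have alt: "0 \<le> l y (Suc i) \<or> (l y (Suc i) < 0 \<and> b y (Suc i) < T (Suc i))" if "i < n" for i
    using that
  proof (induction i)
    case 0
    show ?case using y by (simp add: l1)
  next
    case (Suc i)
    then consider "0 \<le> l y (Suc i)" | "l y (Suc i) < 0 \<and> b y (Suc i) < T (Suc i)" by fastforce
    then show ?case
    proof cases
      case 1
      \<comment> \<open>The load drops only where \<open>F > 0\<close>, which excludes a boundary at
        or beyond the next facility.\<close>
      have "b y (Suc i) < T (Suc (Suc i))" if neg: "l y (Suc (Suc i)) < 0"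
      proof (rule ccontr)
        assume "\<not> b y (Suc i) < T (Suc (Suc i))"
        moreover have "T (Suc i) \<le> T (Suc (Suc i))" using mono[of "Suc i"] Suc.prems by simp
        ultimately have "F (Suc i) (b y (Suc i)) \<le> 0" by (simp add: F_def)
        then have "\<gamma> * F (Suc i) (b y (Suc i)) \<le> 0" using \<gamma> by (simp add: mult_nonneg_nonpos)
        then show False using neg 1 by (simp add: lS)
      qed
      then show ?thesis using bS[of y "Suc i"] by fastforce
    next
      case 2
      then show ?thesis using drop[of i "Suc i"] Suc.prems by simp
    qed
  qed
  have pos: "0 \<le> l y (Suc i)" if "i < n" for i
  proof (rule ccontr)
    assume "\<not> 0 \<le> l y (Suc i)"
    then have "b y n < T n" using drop[of i k] alt[OF that] that by (simp add: k)
    then show False using y range[of n] n by simp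
  qed
  have "balanced \<alpha> (b y (Suc i)) (T (Suc i), l y (Suc i)) (T (Suc (Suc i)), l y (Suc (Suc i)))" for i
  proof -
    have "\<alpha> * l y (Suc (Suc i)) = \<alpha> * l y (Suc i) - (1 - \<alpha>) * F (Suc i) (b y (Suc i))"
      using \<alpha> by (simp add: lS \<gamma>_def field_simps)
    then show ?thesis by (simp add: balanced_def F_def lS right_diff_distrib)
  qed
  moreover have "b y (Suc i) - b y i = l y (Suc i)" for i by (simp add: bS)
  ultimately have "boundaries n \<alpha> T (b y)"
    using y(2) pos by (simp add: boundaries_def b0 bS)
  then show ?thesis by blast
qed

lemma convergent_subsequence:
  fixes g :: "nat \<Rightarrow> nat \<Rightarrow> real"
  assumes "\<And>m i. i < n \<Longrightarrow> g m i \<in> {0..1}"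
  shows "\<exists>r L. strict_mono r \<and> (\<forall>i<n. (\<lambda>m. g (r m) i) \<longlonglongrightarrow> L i)"
  using assms
proof (induction n)
  case 0
  show ?case by (intro exI[of _ id]) (simp add: strict_mono_def)
next
  case (Suc n)
  then obtain r L where r: "strict_mono r" "\<And>i. i < n \<Longrightarrow> (\<lambda>m. g (r m) i) \<longlonglongrightarrow> L i" by force
  have "\<forall>m. g (r m) n \<in> {0..1}" using Suc.prems by simp
  then obtain x s where s: "strict_mono s" "((\<lambda>m. g (r m) n) \<circ> s) \<longlonglongrightarrow> x"
    using compact_Icc[of "0 :: real" 1] unfolding compact_eq_seq_compact_metric seq_compact_def by metis
  have "(\<lambda>m. g ((r \<circ> s) m) i) \<longlonglongrightarrow> (L(n := x)) i" if "i < Suc n" for i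
    using that s LIMSEQ_subseq_LIMSEQ[OF r(2)[of i] s(1)] by (cases "i = n") (auto simp: o_def)
  moreover have "strict_mono (r \<circ> s)" using r s by (simp add: strict_mono_o)
  ultimately show ?case by blast
qed

text \<open>The case \<open>\<alpha> = 0\<close> is obtained as the limit \<open>\<alpha> \<rightarrow> 0\<close>, which preserves equal loads of co-located facilities.\<close>

lemma boundaries_exist:
  assumes \<alpha>: "0 \<le> \<alpha>" "\<alpha> \<le> 1" and n: "1 \<le> n"
    and mono: "\<And>i. 1 \<le> i \<Longrightarrow> i < n \<Longrightarrow> T i \<le> T (Suc i)"
    and range: "\<And>i. 1 \<le> i \<Longrightarrow> i \<le> n \<Longrightarrow> 0 \<le> T i \<and> T i \<le> 1"
  shows "\<exists>\<beta>. boundaries n \<alpha> T \<beta>"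
proof (cases "\<alpha> = 0")
  case False
  then show ?thesis using boundaries_exist_pos[of \<alpha> n T] assms by simp
next
  case True
  define a :: "nat \<Rightarrow> real" where "a = (\<lambda>m. 1 / real (Suc m))"
  have "\<exists>\<beta>. boundaries n (a m) T \<beta>" for m
    using boundaries_exist_pos[of "a m" n T] mono range n by (simp add: a_def)
  then obtain g where g: "\<And>m. boundaries n (a m) T (g m)" by metis
  have mono_g: "g m i \<le> g m j" if "i \<le> j" "j \<le> n" for m i j
    using that
  proof (induction j rule: dec_induct)
    case (step j)
    then have "g m j \<le> g m (Suc j)" using g[of m] by (simp add: boundaries_def)
    then show ?case using step by simp
  qed simp
  have "g m i \<in> {0..1}" if "i < Suc n" for m i
    using mono_g[of 0 i m] mono_g[of i n m] that g[of m] by (simp add: boundaries_def)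
  then obtain r L where r: "strict_mono r" "\<And>i. i < Suc n \<Longrightarrow> (\<lambda>m. g (r m) i) \<longlonglongrightarrow> L i"
    using convergent_subsequence[of "Suc n" g] by blast
  have a0: "(\<lambda>m. a (r m)) \<longlonglongrightarrow> 0"
    using LIMSEQ_subseq_LIMSEQ[OF LIMSEQ_Suc[OF lim_1_over_n] r(1)] by (simp add: a_def o_def)
  have "L 0 = 0" "L n = 1"
    using LIMSEQ_unique[OF r(2)[of 0], of 0] LIMSEQ_unique[OF r(2)[of n], of 1] g
    by (simp_all add: boundaries_def)
  moreover have "L i \<le> L (Suc i)" if "i < n" for i
    using LIMSEQ_le[OF r(2)[of i] r(2)[of "Suc i"]] that g by (auto simp: boundaries_def)
  moreover have "balanced 0 (L (Suc i)) (T (Suc i), L (Suc i) - L i)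
      (T (Suc (Suc i)), L (Suc (Suc i)) - L (Suc i))" if i: "i < n - 1" for i
  proof -
    have bal: "balanced (a (r m)) (g (r m) (Suc i)) (T (Suc i), g (r m) (Suc i) - g (r m) i)
      (T (Suc (Suc i)), g (r m) (Suc (Suc i)) - g (r m) (Suc i))" for m
      using g[of "r m"] i by (simp add: boundaries_def)
    have lim: "(\<lambda>m. g (r m) i) \<longlonglongrightarrow> L i" "(\<lambda>m. g (r m) (Suc i)) \<longlonglongrightarrow> L (Suc i)"
      "(\<lambda>m. g (r m) (Suc (Suc i))) \<longlonglongrightarrow> L (Suc (Suc i))"
      using i by (intro r; simp)+
    have "(\<lambda>m. a (r m) * (g (r m) (Suc i) - g (r m) i) + (1 - a (r m)) * \<bar>T (Suc i) - g (r m) (Suc i)\<bar>)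
        \<longlonglongrightarrow> 0 * (L (Suc i) - L i) + (1 - 0) * \<bar>T (Suc i) - L (Suc i)\<bar>"
      by (intro tendsto_intros lim a0)
    moreover have "(\<lambda>m. a (r m) * (g (r m) (Suc (Suc i)) - g (r m) (Suc i)) +
          (1 - a (r m)) * \<bar>T (Suc (Suc i)) - g (r m) (Suc i)\<bar>)
        \<longlonglongrightarrow> 0 * (L (Suc (Suc i)) - L (Suc i)) + (1 - 0) * \<bar>T (Suc (Suc i)) - L (Suc i)\<bar>"
      by (intro tendsto_intros lim a0)
    ultimately have eq: "0 * (L (Suc i) - L i) + (1 - 0) * \<bar>T (Suc i) - L (Suc i)\<bar> =
        0 * (L (Suc (Suc i)) - L (Suc i)) + (1 - 0) * \<bar>T (Suc (Suc i)) - L (Suc i)\<bar>"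
      using bal unfolding balanced_def by (auto intro: LIMSEQ_unique)
    have "L (Suc i) - L i = L (Suc (Suc i)) - L (Suc i)" if "T (Suc i) = T (Suc (Suc i))"
    proof -
      have e: "g (r m) (Suc i) - g (r m) i = g (r m) (Suc (Suc i)) - g (r m) (Suc i)" for m
        using bal[of m] that by (simp add: balanced_def)
      have "(\<lambda>m. g (r m) (Suc i) - g (r m) i) \<longlonglongrightarrow> L (Suc i) - L i"
        by (intro tendsto_intros lim)
      moreover have "(\<lambda>m. g (r m) (Suc i) - g (r m) i) \<longlonglongrightarrow> L (Suc (Suc i)) - L (Suc i)"
        unfolding e by (intro tendsto_intros lim)
      ultimately show ?thesis by (rule LIMSEQ_unique)
    qed
    then show ?thesis using eq by (simp add: balanced_def)
  qed
  ultimately show ?thesis unfolding True boundaries_def by blast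
qed

section \<open>Equilibria and their boundaries\<close>

lemma measure_between:
  fixes a b :: real
  assumes "{a<..<b} \<subseteq> S" "S \<subseteq> {a<..<b} \<union> N" "finite N" "a \<le> b"
  shows "S \<in> sets lborel" "measure lborel S = b - a"
proof -
  have "finite (S - {a<..<b})" using assms(2,3) by (elim finite_subset[rotated]) auto
  then have null: "S - {a<..<b} \<in> null_sets lborel" by (rule finite_imp_null_set_lborel)
  have S: "S = {a<..<b} \<union> (S - {a<..<b})" using assms(1) by auto
  have "{a<..<b} \<union> (S - {a<..<b}) \<in> sets lborel" using null by (intro sets.Un) auto
  then show "S \<in> sets lborel" by (simp only: S[symmetric])
  have "measure lborel ({a<..<b} \<union> (S - {a<..<b})) = measure lborel {a<..<b}"
    using null by (intro measure_Un_null_set) auto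
  then show "measure lborel S = b - a" using S assms(4) by simp
qed

lemma finite_interval_union_borel:
  assumes "finite_interval_union S"
  shows "S \<in> sets lborel"
proof -
  obtain I where I: "finite I" "\<forall>J\<in>I. is_interval J" "S = \<Union>I"
    using assms by (auto simp: finite_interval_union_def)
  have "J \<in> sets lborel" if "J \<in> I" for J
    using real_interval_borel_measurable[of J] I that by simp
  then show ?thesis using I by (auto intro: sets.finite_Union)
qed

lemma boundaries_mono:
  assumes "boundaries n \<alpha> T \<beta>" "i \<le> j" "j \<le> n"
  shows "\<beta> i \<le> \<beta> j"
  using assms(2,3)
proof (induction j rule: dec_induct)
  case (step j)
  then have "\<beta> j \<le> \<beta> (Suc j)" using assms(1) by (simp add: boundaries_def)
  then show ?case using step by simp
qed simp

text \<open>The cost difference between the neighbours \<open>Suc k\<close> and \<open>k\<close>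
  vanishes at \<beta> k for balanced loads and, relative to that client, is never smaller further
  left and never larger further right, because \<open>T k \<le> T (Suc k)\<close>. Moving from
  neighbour to neighbour then compares \<open>i\<close> with every \<open>j\<close>.\<close>

lemma boundaries_equilibrium:
  assumes b: "boundaries n \<alpha> T \<beta>" and \<alpha>: "\<alpha> \<le> 1"
    and mono: "\<And>i. 1 \<le> i \<Longrightarrow> i < n \<Longrightarrow> T i \<le> T (Suc i)"
    and i: "1 \<le> i" "i \<le> n" "\<beta> (i - 1) \<le> z" "z \<le> \<beta> i" and j: "1 \<le> j" "j \<le> n"
  defines "cost \<equiv> \<lambda>j. (1 - \<alpha>) * \<bar>T j - z\<bar> + \<alpha> * (\<beta> j - \<beta> (j - 1))"
  shows "cost i \<le> cost j"
proof -
  have diff: "cost (Suc k) - cost k = (1 - \<alpha>) *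
      ((\<bar>T (Suc k) - z\<bar> - \<bar>T k - z\<bar>) - (\<bar>T (Suc k) - \<beta> k\<bar> - \<bar>T k - \<beta> k\<bar>))"
    if k: "1 \<le> k" "k < n" for k
  proof -
    obtain m where m: "k = Suc m" using k by (cases k) auto
    have "balanced \<alpha> (\<beta> k) (T k, \<beta> k - \<beta> m) (T (Suc k), \<beta> (Suc k) - \<beta> k)"
      using b k by (auto simp: boundaries_def m)
    then show ?thesis by (simp add: balanced_def cost_def m algebra_simps)
  qed
  show ?thesis
  proof (cases "i \<le> j")
    case True
    then show ?thesis using j(2)
    proof (induction j rule: dec_induct)
      case (step k)
      have "z \<le> \<beta> k" using boundaries_mono[OF b step(1)] i step by simp
      then have "\<bar>T (Suc k) - \<beta> k\<bar> - \<bar>T k - \<beta> k\<bar> \<le> \<bar>T (Suc k) - z\<bar> - \<bar>T k - z\<bar>"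
        using mono[of k] i step by auto
      then have "0 \<le> cost (Suc k) - cost k" using diff[of k] i step \<alpha> by simp
      then show ?case using step by simp
    qed simp
  next
    case False
    then have "j \<le> i" by simp
    then show ?thesis using j(1)
    proof (induction j rule: inc_induct)
      case (step k)
      have "k \<le> i - 1" "i - 1 \<le> n" using i step by auto
      then have "\<beta> k \<le> z" using boundaries_mono[OF b, of k "i - 1"] i(3) by simp
      then have "\<bar>T (Suc k) - z\<bar> - \<bar>T k - z\<bar> \<le> \<bar>T (Suc k) - \<beta> k\<bar> - \<bar>T k - \<beta> k\<bar>"
        using mono[of k] i step by auto
      then have "cost (Suc k) - cost k \<le> 0" using diff[of k] i step \<alpha> by (simp add: mult_nonneg_nonpos)
      then show ?case using step by simp
    qed simp
  qed
qed

lemma boundaries_chain: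
  assumes "boundaries n \<alpha> T \<beta>"
  shows "chain \<alpha> 0 (map (\<lambda>i. (T i, \<beta> i - \<beta> (i - 1))) [1..<Suc n])"
    and "total (map (\<lambda>i. (T i, \<beta> i - \<beta> (i - 1))) [1..<Suc n]) = 1"
proof -
  define c where "c = (\<lambda>i. (T i, \<beta> i - \<beta> (i - 1)))"
  have "chain \<alpha> 0 (map c [1..<Suc m]) \<and> total (map c [1..<Suc m]) = \<beta> m" if "m \<le> n" for m
    using that
  proof (induction m)
    case 0
    then show ?case using assms by (simp add: boundaries_def)
  next
    case (Suc m)
    have eq: "map c [1..<Suc (Suc m)] = map c [1..<Suc m] @ [c (Suc m)]" by simp
    have "balanced \<alpha> (\<beta> m) (last (map c [1..<Suc m])) (c (Suc m))" if m0: "m \<noteq> 0"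
    proof -
      obtain k where k: "m = Suc k" using m0 by (cases m) auto
      show ?thesis using assms Suc.prems by (simp add: boundaries_def c_def k)
    qed
    moreover have "chain \<alpha> 0 (map c [1..<Suc m])" "total (map c [1..<Suc m]) = \<beta> m"
      using Suc by auto
    moreover have "map c [1..<Suc m] = [] \<longleftrightarrow> m = 0" by auto
    moreover have "total (map c [1..<Suc m] @ [c (Suc m)]) = total (map c [1..<Suc m]) + (\<beta> (Suc m) - \<beta> m)"
      by (simp add: c_def del: upt_Suc)
    ultimately show ?case unfolding eq chain_append by (simp del: upt_Suc)
  qed
  from this[of n] show "chain \<alpha> 0 (map (\<lambda>i. (T i, \<beta> i - \<beta> (i - 1))) [1..<Suc n])"
    "total (map (\<lambda>i. (T i, \<beta> i - \<beta> (i - 1))) [1..<Suc n]) = 1"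
    using assms by (simp_all add: c_def boundaries_def)
qed

lemma sorted_map_mono:
  assumes "mono_on {1..n} (T :: nat \<Rightarrow> real)"
  shows "sorted (map T [1..<Suc n])"
  using assms by (auto simp: sorted_iff_nth_mono monotone_on_def simp del: upt_Suc)

text \<open>At \<alpha> = 0 every client uses a nearest location, so the clients served at a
  location are its nearest clients up to midpoints between locations, a finite set. Equal loads are
  then equal shares of its measure.\<close>

lemma equal_sharing_zero:
  assumes range: "\<forall>z\<in>{0..1}. f t z \<in> {1..n}"
    and meas: "\<And>i. i \<in> {1..n} \<Longrightarrow> clients_of t f i \<in> sets lborel"
    and eq: "client_equilibrium n 0 t f"
    and same: "\<And>i j. i \<in> {1..n} \<Longrightarrow> j \<in> {1..n} \<Longrightarrow> t i = t j \<Longrightarrow> load t f i = load t f j"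
  shows "equal_sharing n t f"
  unfolding equal_sharing_def
proof
  fix i assume i: "i \<in> {1..n}"
  define J where "J = {j \<in> {1..n}. t j = t i}"
  define C where "C = (\<Union>j\<in>J. clients_of t f j)"
  define N where "N = nearest_clients n t i"
  have J: "finite J" "i \<in> J" using i by (auto simp: J_def)
  have sub: "C \<subseteq> N"
  proof
    fix z assume "z \<in> C"
    then obtain j where j: "j \<in> J" "z \<in> {0..1}" "f t z = j" by (auto simp: C_def clients_of_def)
    have "\<bar>t j - z\<bar> \<le> \<bar>t k - z\<bar>" if "k \<in> {1..n}" for k
      using eq j that by (auto simp: client_equilibrium_def client_cost_def facility_cost_def)
    then show "z \<in> N" using j by (auto simp: N_def nearest_clients_def J_def)
  qed
  have "N - C \<subseteq> (\<lambda>j. (t i + t j) / 2) ` {1..n}"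
  proof
    fix z assume z: "z \<in> N - C"
    define j where "j = f t z"
    have j: "j \<in> {1..n}" "z \<in> {0..1}" using range z by (auto simp: j_def N_def nearest_clients_def)
    have "j \<notin> J" using z j by (auto simp: C_def clients_of_def j_def)
    then have ne: "t j \<noteq> t i" using j by (auto simp: J_def)
    have "\<bar>t j - z\<bar> \<le> \<bar>t i - z\<bar>"
      using eq j i by (auto simp: client_equilibrium_def client_cost_def facility_cost_def j_def)
    moreover have "\<bar>t i - z\<bar> \<le> \<bar>t j - z\<bar>" using z j by (auto simp: N_def nearest_clients_def)
    ultimately have "\<bar>t i - z\<bar> = \<bar>t j - z\<bar>" by (rule antisym[rotated])
    then have "t i - z = t j - z \<or> t i - z = - (t j - z)" by (simp only: abs_eq_iff)
    then have "z = (t i + t j) / 2" using ne by (elim disjE) simp_all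
    then show "z \<in> (\<lambda>j. (t i + t j) / 2) ` {1..n}" using j by blast
  qed
  then have "finite (N - C)" by (rule finite_subset) simp
  then have null: "N - C \<in> null_sets lborel" by (rule finite_imp_null_set_lborel)
  have Cm: "C \<in> sets lborel" unfolding C_def using J meas by (intro sets.finite_UN) (auto simp: J_def)
  have "N = C \<union> (N - C)" using sub by auto
  then have "measure lborel N = measure lborel C" using measure_Un_null_set[OF Cm null] by simp
  also have "\<dots> = (\<Sum>j\<in>J. measure lborel (clients_of t f j))"
    unfolding C_def
  proof (rule measure_finite_Union)
    show "disjoint_family_on (clients_of t f) J" by (auto simp: disjoint_family_on_def clients_of_def)
    show "clients_of t f ` J \<subseteq> sets lborel" using meas by (auto simp: J_def)
    fix j assume "j \<in> J"
    have "emeasure lborel (clients_of t f j) \<le> emeasure lborel {0..1 :: real}"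
      by (intro emeasure_mono) (auto simp: clients_of_def)
    also have "\<dots> < \<infinity>" by simp
    finally show "emeasure lborel (clients_of t f j) \<noteq> \<infinity>" by simp
  qed (rule J)
  also have "\<dots> = (\<Sum>j\<in>J. load t f i)"
  proof (rule sum.cong[OF refl])
    fix j assume "j \<in> J"
    then have "j \<in> {1..n}" "t j = t i" by (simp_all add: J_def)
    from same[OF this(1) i this(2)] show "measure lborel (clients_of t f j) = load t f i"
      by (simp only: load_def)
  qed
  also have "\<dots> = card J * load t f i" by simp
  finally have "measure lborel N = card J * load t f i" .
  moreover have "0 < card J" using J by (auto simp: card_gt_0_iff)
  ultimately have "load t f i = measure lborel N / real (card J)" by simp
  then show "load t f i = measure lborel (nearest_clients n t i) / real (card {j \<in> {1..n}. t j = t i})"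
    by (simp only: N_def J_def)
qed

lemma sorting_permutation:
  fixes t :: "nat \<Rightarrow> real"
  obtains p where "p permutes {1..n}" "mono_on {1..n} (t \<circ> p)"
proof -
  define xs where "xs = sort_key t [1..<Suc n]"
  have xs: "length xs = n" "distinct xs" "set xs = {1..n}" "sorted (map t xs)"
    by (auto simp: xs_def simp del: upt_Suc)
  define p where "p = (\<lambda>i. if i \<in> {1..n} then xs ! (i - 1) else i)"
  have "bij_betw (\<lambda>i. xs ! i) {..<n} {1..n}" using bij_betw_nth[of xs "{..<n}" "{1..n}"] xs by simp
  moreover have "bij_betw (\<lambda>i. i - 1) {1..n} {..<n}"
    by (rule bij_betw_byWitness[where f' = Suc]) auto
  ultimately have "bij_betw ((\<lambda>i. xs ! i) \<circ> (\<lambda>i. i - 1)) {1..n} {1..n}" by (rule bij_betw_trans[rotated])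
  then have "bij_betw p {1..n} {1..n}" by (rule bij_betw_cong[THEN iffD1, rotated]) (auto simp: p_def)
  then have "p permutes {1..n}" by (rule bij_imp_permutes) (auto simp: p_def)
  moreover have "mono_on {1..n} (t \<circ> p)"
  proof (rule mono_onI)
    fix i j :: nat assume ij: "i \<in> {1..n}" "j \<in> {1..n}" "i \<le> j"
    then have "map t xs ! (i - 1) \<le> map t xs ! (j - 1)"
      using xs by (intro sorted_nth_mono) auto
    then show "(t \<circ> p) i \<le> (t \<circ> p) j" using ij xs by (auto simp: p_def)
  qed
  ultimately show ?thesis by (rule that)
qed

text \<open>An equilibrium is built for one location vector at a time, hence the mappings
  \<open>\<lambda>_. g\<close>; they are glued together by choice afterwards.\<close>

lemma equilibrium_at:
  assumes \<alpha>: "0 \<le> \<alpha>" "\<alpha> \<le> 1" and n: "1 \<le> n" and t: "t \<in> locations n"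
  shows "\<exists>g. (\<forall>z\<in>{0..1}. g z \<in> {1..n}) \<and>
    (\<forall>i\<in>{1..n}. finite_interval_union (clients_of t (\<lambda>_. g) i)) \<and>
    client_equilibrium n \<alpha> t (\<lambda>_. g) \<and> proper n t (\<lambda>_. g) \<and>
    (\<alpha> = 0 \<longrightarrow> equal_sharing n t (\<lambda>_. g))"
proof -
  obtain p where p: "p permutes {1..n}" "mono_on {1..n} (t \<circ> p)" by (rule sorting_permutation)
  define T where "T = t \<circ> p"
  have pin: "p i \<in> {1..n} \<longleftrightarrow> i \<in> {1..n}" for i using permutes_in_image[OF p(1)] .
  have mono: "T i \<le> T j" if "1 \<le> i" "i \<le> j" "j \<le> n" for i j
    using monotone_onD[OF p(2), of i j] that by (simp add: T_def)
  have trange: "0 \<le> t i \<and> t i \<le> 1" if "i \<in> {1..n}" for i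
    using t that by (auto simp: locations_def PiE_def Pi_def)
  have "0 \<le> T i \<and> T i \<le> 1" if "1 \<le> i" "i \<le> n" for i
    using trange[of "p i"] pin[of i] that by (simp add: T_def)
  then obtain \<beta> where \<beta>: "boundaries n \<alpha> T \<beta>"
    using boundaries_exist[OF \<alpha> n, of T] mono by auto
  have \<beta>0: "\<beta> 0 = 0" and \<beta>n: "\<beta> n = 1" using \<beta> by (auto simp: boundaries_def)
  \<comment> \<open>A boundary client goes to the leftmost possible facility;
    \<open>1 \<le> i\<close> keeps client \<open>0\<close> away from index \<open>0\<close>.\<close>
  define idx where "idx = (\<lambda>z. LEAST i. 1 \<le> i \<and> z \<le> \<beta> i)"
  have idx: "1 \<le> idx z" "idx z \<le> n" "z \<le> \<beta> (idx z)" "\<beta> (idx z - 1) \<le> z" if z: "z \<in> {0..1}" for z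
  proof -
    have ex: "1 \<le> n \<and> z \<le> \<beta> n" using n z \<beta>n by simp
    have L: "1 \<le> idx z \<and> z \<le> \<beta> (idx z)" unfolding idx_def by (rule LeastI[of _ n]) (rule ex)
    then show "1 \<le> idx z" "z \<le> \<beta> (idx z)" by auto
    show "idx z \<le> n" unfolding idx_def by (rule Least_le) (rule ex)
    show "\<beta> (idx z - 1) \<le> z"
    proof (cases "idx z = 1")
      case True
      then show ?thesis using z \<beta>0 by simp
    next
      case False
      have "idx z - 1 < idx z" using L by simp
      then have "\<not> (1 \<le> idx z - 1 \<and> z \<le> \<beta> (idx z - 1))"
        unfolding idx_def by (rule not_less_Least)
      moreover have "1 \<le> idx z - 1" using False L by linarith
      ultimately show ?thesis by simp
    qed
  qed
  have idx_mono: "idx z \<le> idx w" if "z \<le> w" "w \<in> {0..1}" for z w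
  proof -
    have "1 \<le> idx w \<and> z \<le> \<beta> (idx w)" using idx(1,3)[OF that(2)] that(1) by simp
    then show ?thesis unfolding idx_def by (rule Least_le)
  qed
  have \<beta>_range: "0 \<le> \<beta> (i - 1)" "\<beta> i \<le> 1" if "i \<in> {1..n}" for i
  proof -
    have "0 \<le> i - 1" "i - 1 \<le> n" "i \<le> n" "n \<le> n" using that by auto
    then show "0 \<le> \<beta> (i - 1)" "\<beta> i \<le> 1"
      using boundaries_mono[OF \<beta>, of 0 "i - 1"] boundaries_mono[OF \<beta>, of i n] \<beta>0 \<beta>n by simp_all
  qed
  have idx_eq: "idx z = i" if "i \<in> {1..n}" "\<beta> (i - 1) < z" "z < \<beta> i" for i z
  proof -
    have z: "z \<in> {0..1}"
      using that(2,3) \<beta>_range[OF that(1)] by auto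
    have "\<not> idx z < i"
    proof
      assume "idx z < i"
      then have "\<beta> (idx z) \<le> \<beta> (i - 1)" using that(1) by (intro boundaries_mono[OF \<beta>]) auto
      then show False using idx(3)[OF z] that by simp
    qed
    moreover have "\<not> i < idx z"
    proof
      assume "i < idx z"
      then have "\<beta> i \<le> \<beta> (idx z - 1)" using idx(2)[OF z] by (intro boundaries_mono[OF \<beta>]) auto
      then show False using idx(4)[OF z] that by simp
    qed
    ultimately show ?thesis by simp
  qed
  define g where "g = p \<circ> idx"
  have clients: "clients_of t (\<lambda>_. g) (p i) = {z \<in> {0..1}. idx z = i}" for i
    using permutes_inj[OF p(1)] by (auto simp: clients_of_def g_def inj_eq)
  have cov: "\<exists>i\<in>{1..n}. j = p i" if "j \<in> {1..n}" for j
    using permutes_image[OF p(1)] that by (metis imageE)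
  have interval: "is_interval {z \<in> {0..1}. idx z = i}" for i
    unfolding is_interval_1
  proof safe
    fix a b x :: real
    assume ab: "a \<in> {0..1}" "b \<in> {0..1}" "idx b = idx a" "a \<le> x" "x \<le> b"
    then have x: "x \<in> {0..1}" by auto
    then show "x \<in> {0..1}" .
    show "idx x = idx a" using idx_mono[OF ab(4) x] idx_mono[OF ab(5,2)] ab(3) by simp
  qed
  have fiu: "finite_interval_union (clients_of t (\<lambda>_. g) j)" if j: "j \<in> {1..n}" for j
  proof -
    obtain i where i: "j = p i" using cov[OF j] by blast
    show ?thesis unfolding finite_interval_union_def
      by (rule exI[of _ "{clients_of t (\<lambda>_. g) j}"]) (use interval clients in \<open>auto simp: i disjoint_def\<close>)
  qed
  have load: "load t (\<lambda>_. g) (p i) = \<beta> i - \<beta> (i - 1)" if i: "i \<in> {1..n}" for i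
  proof -
    have "{\<beta> (i - 1)<..<\<beta> i} \<subseteq> {z \<in> {0..1}. idx z = i}"
    proof
      fix z assume z: "z \<in> {\<beta> (i - 1)<..<\<beta> i}"
      then have "idx z = i" using idx_eq i by auto
      moreover have "z \<in> {0..1}"
        using z \<beta>_range[OF i] by auto
      ultimately show "z \<in> {z \<in> {0..1}. idx z = i}" by simp
    qed
    moreover have "{z \<in> {0..1}. idx z = i} \<subseteq> {\<beta> (i - 1)<..<\<beta> i} \<union> {\<beta> (i - 1), \<beta> i}"
      using idx(3,4) by force
    moreover have "\<beta> (i - 1) \<le> \<beta> i" using i by (intro boundaries_mono[OF \<beta>]) auto
    ultimately show ?thesis
      unfolding load_def clients by (intro measure_between(2)[where N = "{\<beta> (i - 1), \<beta> i}"]) simp_all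
  qed
  have range: "\<forall>z\<in>{0..1}. g z \<in> {1..n}"
  proof
    fix z :: real assume "z \<in> {0..1}"
    then show "g z \<in> {1..n}" using idx(1,2)[of z] pin[of "idx z"] by (simp add: g_def)
  qed
  have ce: "client_equilibrium n \<alpha> t (\<lambda>_. g)"
    unfolding client_equilibrium_def
  proof (intro ballI)
    fix z :: real and j assume z: "z \<in> {0..1}" and j: "j \<in> {1..n}"
    obtain k where k: "k \<in> {1..n}" "j = p k" using cov[OF j] by blast
    have i: "idx z \<in> {1..n}" using idx(1,2)[OF z] by simp
    have m: "T i \<le> T (Suc i)" if "1 \<le> i" "i < n" for i using mono[of i "Suc i"] that by simp
    have "(1 - \<alpha>) * \<bar>T (idx z) - z\<bar> + \<alpha> * (\<beta> (idx z) - \<beta> (idx z - 1)) \<le>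
        (1 - \<alpha>) * \<bar>T k - z\<bar> + \<alpha> * (\<beta> k - \<beta> (k - 1))"
      using boundaries_equilibrium[OF \<beta> \<alpha>(2) m, of "idx z" z k] idx[OF z] k(1) by simp
    then show "client_cost \<alpha> t (\<lambda>_. g) z \<le> facility_cost \<alpha> t (\<lambda>_. g) z j"
      using load[OF i] load[OF k(1)] by (simp add: client_cost_def facility_cost_def g_def T_def k(2))
  qed
  have "proper n t (\<lambda>_. g)"
    unfolding proper_def
  proof (intro exI conjI)
    show "mono_on {0..n} \<beta>" by (rule mono_onI) (use boundaries_mono[OF \<beta>] in auto)
    show "\<forall>i\<in>{1..n}. \<forall>z\<in>{\<beta> (i - 1)<..<\<beta> i}. g z = p i" using idx_eq by (auto simp: g_def)
  qed (use p \<beta>0 \<beta>n in auto)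
  moreover have "equal_sharing n t (\<lambda>_. g)" if "\<alpha> = 0"
  proof (rule equal_sharing_zero)
    show "client_equilibrium n 0 t (\<lambda>_. g)" using ce that by simp
    show "clients_of t (\<lambda>_. g) i \<in> sets lborel" if "i \<in> {1..n}" for i
      using finite_interval_union_borel fiu that by blast
    fix i j assume ij: "i \<in> {1..n}" "j \<in> {1..n}" "t i = t j"
    obtain k l where kl: "k \<in> {1..n}" "i = p k" "l \<in> {1..n}" "j = p l" using cov ij by metis
    define cs where "cs = map (\<lambda>i. (T i, \<beta> i - \<beta> (i - 1))) [1..<Suc n]"
    have "sorted (map T [1..<Suc n])" using p(2) by (intro sorted_map_mono) (simp add: T_def)
    then have "sorted (map fst cs)" by (simp add: cs_def comp_def del: upt_Suc)
    moreover have "(T k, \<beta> k - \<beta> (k - 1)) \<in> set cs" "(T l, \<beta> l - \<beta> (l - 1)) \<in> set cs"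
      using kl by (auto simp: cs_def simp del: upt_Suc)
    moreover have "T k = T l" using ij kl by (simp add: T_def)
    ultimately have "\<beta> k - \<beta> (k - 1) = \<beta> l - \<beta> (l - 1)"
      using chain_colocated[OF boundaries_chain(1)[OF \<beta>, folded cs_def]] by fastforce
    then show "load t (\<lambda>_. g) i = load t (\<lambda>_. g) j" using load kl by simp
  qed (rule range)
  ultimately show ?thesis using range fiu ce by blast
qed

lemma induced_equilibria_exist:
  assumes \<alpha>: "0 \<le> \<alpha>" "\<alpha> \<le> 1" and n: "1 \<le> n"
  shows "\<exists>f. induced_equilibria n \<alpha> f"
proof -
  have "\<forall>t\<in>locations n. \<exists>g. (\<forall>z\<in>{0..1}. g z \<in> {1..n}) \<and>
    (\<forall>i\<in>{1..n}. finite_interval_union (clients_of t (\<lambda>_. g) i)) \<and>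
    client_equilibrium n \<alpha> t (\<lambda>_. g) \<and> proper n t (\<lambda>_. g) \<and>
    (\<alpha> = 0 \<longrightarrow> equal_sharing n t (\<lambda>_. g))"
    using equilibrium_at[OF assms] by blast
  then obtain f where f: "\<And>t. t \<in> locations n \<Longrightarrow> (\<forall>z\<in>{0..1}. f t z \<in> {1..n}) \<and>
    (\<forall>i\<in>{1..n}. finite_interval_union (clients_of t (\<lambda>_. f t) i)) \<and>
    client_equilibrium n \<alpha> t (\<lambda>_. f t) \<and> proper n t (\<lambda>_. f t) \<and>
    (\<alpha> = 0 \<longrightarrow> equal_sharing n t (\<lambda>_. f t))"
    by metis
  have "clients_of t (\<lambda>_. f t) = clients_of t f" for t
    by (simp add: clients_of_def fun_eq_iff)
  moreover from this have "load t (\<lambda>_. f t) = load t f" for t by (simp add: load_def fun_eq_iff)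
  moreover from this have "client_equilibrium n \<alpha> t (\<lambda>_. f t) = client_equilibrium n \<alpha> t f"
    "equal_sharing n t (\<lambda>_. f t) = equal_sharing n t f" for t
    by (simp_all add: client_equilibrium_def client_cost_def facility_cost_def equal_sharing_def)
  moreover have "proper n t (\<lambda>_. f t) = proper n t f" for t by (simp add: proper_def)
  ultimately have "induced_equilibria n \<alpha> f"
    using f by (simp add: induced_equilibria_def client_mapping_def)
  then show ?thesis by blast
qed

section \<open>Recovering balanced boundaries from an induced equilibrium\<close>

lemma interval_near:
  assumes "0 \<le> a" "a \<le> (1 :: real)" "0 < \<epsilon>"
  obtains u v where "u < v" "{u..v} \<subseteq> {0..1}" "\<And>z. z \<in> {u..v} \<Longrightarrow> \<bar>a - z\<bar> < \<epsilon>"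
proof
  show "max 0 (a - \<epsilon> / 2) < min 1 (a + \<epsilon> / 2)" using assms by auto
  show "{max 0 (a - \<epsilon> / 2)..min 1 (a + \<epsilon> / 2)} \<subseteq> {0..1}" by auto
  show "\<bar>a - z\<bar> < \<epsilon>" if "z \<in> {max 0 (a - \<epsilon> / 2)..min 1 (a + \<epsilon> / 2)}" for z
    using that assms by (auto simp: abs_less_iff)
qed

lemma le_at_endpoint:
  fixes g h :: "real \<Rightarrow> real"
  assumes "continuous_on UNIV g" "continuous_on UNIV h" "u < v" "w \<in> {u..v}"
    and "\<And>z. z \<in> {u<..<v} \<Longrightarrow> g z \<le> h z"
  shows "g w \<le> h w"
proof -
  have "continuous_on (closure {u<..<v}) (\<lambda>z. g z - h z)"
    using assms(1,2) by (intro continuous_intros) (auto elim: continuous_on_subset)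
  moreover have "w \<in> closure {u<..<v}" using assms(3,4) by simp
  ultimately have "g w - h w \<le> 0" by (rule continuous_le_on_closure) (use assms(5) in auto)
  then show ?thesis by simp
qed

text \<open>Gives positive loads at \<alpha> = 0. Clients closer to \<open>t i\<close> than half the
  distance to any other occupied location are nearest to \<open>t i\<close>; the element
  \<open>1\<close> of \<open>D\<close> provides a minimum when all facilities share one
  location.\<close>

lemma nearest_clients_positive:
  assumes t: "\<And>i. i \<in> {1..n} \<Longrightarrow> 0 \<le> t i \<and> t i \<le> 1" and i: "i \<in> {1..n}"
  shows "0 < measure lborel (nearest_clients n t i)"
proof -
  define D where "D = insert 1 ((\<lambda>k. \<bar>t k - t i\<bar>) ` {k \<in> {1..n}. t k \<noteq> t i})"
  have D: "finite D" "D \<noteq> {}" "\<And>x. x \<in> D \<Longrightarrow> 0 < x" by (auto simp: D_def)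
  then have "0 < Min D" by simp
  then obtain u v where uv: "u < v" "{u..v} \<subseteq> {0..1}" "\<And>z. z \<in> {u..v} \<Longrightarrow> \<bar>t i - z\<bar> < Min D / 2"
    using interval_near[of "t i" "Min D / 2"] t[OF i] by auto
  have sub: "{u..v} \<subseteq> nearest_clients n t i"
  proof
    fix z assume z: "z \<in> {u..v}"
    have "\<bar>t i - z\<bar> \<le> \<bar>t j - z\<bar>" if "j \<in> {1..n}" for j
    proof (cases "t j = t i")
      case False
      then have "\<bar>t j - t i\<bar> \<in> D" using that by (auto simp: D_def)
      then have "Min D \<le> \<bar>t j - t i\<bar>" using D by simp
      moreover have "\<bar>(t j - z) - (t i - z)\<bar> \<le> \<bar>t j - z\<bar> + \<bar>t i - z\<bar>" by (rule abs_triangle_ineq4)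
      ultimately show ?thesis using uv(3)[OF z] by simp
    qed simp
    then show "z \<in> nearest_clients n t i" using z uv(2) by (auto simp: nearest_clients_def)
  qed
  have eq: "nearest_clients n t i = {0..1} \<inter> (\<Inter>j\<in>{1..n}. {z. \<bar>t i - z\<bar> \<le> \<bar>t j - z\<bar>})"
    by (auto simp: nearest_clients_def)
  have "closed (nearest_clients n t i)"
    unfolding eq by (intro closed_Int closed_INT closed_atLeastAtMost ballI closed_Collect_le continuous_intros)
  moreover have "bounded (nearest_clients n t i)"
    by (rule bounded_subset[OF bounded_closed_interval[of "0 :: real" 1]]) (auto simp: nearest_clients_def)
  ultimately have "nearest_clients n t i \<in> fmeasurable lborel"
    by (intro fmeasurable_compact) (simp add: compact_eq_bounded_closed)
  then have "measure lborel {u..v} \<le> measure lborel (nearest_clients n t i)"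
    using sub by (intro measure_mono_fmeasurable) auto
  then show ?thesis using uv(1) by simp
qed

text \<open>Properness leaves the clients at the boundaries free, so their indifference is obtained
  by continuity from the open intervals on both sides. This requires intervals of positive length,
  hence the detour through positivity of all loads.\<close>

lemma induced_boundaries:
  assumes f: "induced_equilibria n \<alpha> f" and t: "t \<in> locations n" and \<alpha>: "0 \<le> \<alpha>" "\<alpha> \<le> 1"
  obtains p \<beta> where "p permutes {1..n}" "mono_on {1..n} (t \<circ> p)" "boundaries n \<alpha> (t \<circ> p) \<beta>"
    "\<And>i. i \<in> {1..n} \<Longrightarrow> load t f (p i) = \<beta> i - \<beta> (i - 1)"
proof -
  have range: "f t z \<in> {1..n}" if "z \<in> {0..1}" for z
    using f t that by (auto simp: induced_equilibria_def client_mapping_def)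
  have ce: "client_equilibrium n \<alpha> t f" using f t by (simp add: induced_equilibria_def)
  have es: "equal_sharing n t f" if "\<alpha> = 0" using f t that by (simp add: induced_equilibria_def)
  have trange: "0 \<le> t i \<and> t i \<le> 1" if "i \<in> {1..n}" for i
    using t that by (auto simp: locations_def PiE_def Pi_def)
  obtain p \<beta> where p: "p permutes {1..n}" "mono_on {1..n} (t \<circ> p)"
    and \<beta>: "mono_on {0..n} \<beta>" "\<beta> 0 = 0" "\<beta> n = 1"
    and serve: "\<And>i z. i \<in> {1..n} \<Longrightarrow> z \<in> {\<beta> (i - 1)<..<\<beta> i} \<Longrightarrow> f t z = p i"
    using f t unfolding induced_equilibria_def proper_def by blast
  have mono: "\<beta> i \<le> \<beta> j" if "i \<le> j" "j \<le> n" for i j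
    using monotone_onD[OF \<beta>(1), of i j] that by simp
  have pin: "p i \<in> {1..n} \<longleftrightarrow> i \<in> {1..n}" for i using permutes_in_image[OF p(1)] .
  have cov: "\<exists>i\<in>{1..n}. j = p i" if "j \<in> {1..n}" for j
    using permutes_image[OF p(1)] that by (metis imageE)
  have cl_sub: "clients_of t f (p i) \<subseteq> {\<beta> (i - 1)<..<\<beta> i} \<union> \<beta> ` {0..n}" for i
  proof
    fix z assume z: "z \<in> clients_of t f (p i)"
    show "z \<in> {\<beta> (i - 1)<..<\<beta> i} \<union> \<beta> ` {0..n}"
    proof (rule ccontr)
      assume out: "z \<notin> {\<beta> (i - 1)<..<\<beta> i} \<union> \<beta> ` {0..n}"
      have z01: "0 \<le> z" "z \<le> 1" "f t z = p i" using z by (auto simp: clients_of_def)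
      define j where "j = (LEAST j. z \<le> \<beta> j)"
      have "z \<le> \<beta> n" using z01 \<beta> by simp
      then have j: "z \<le> \<beta> j" "j \<le> n" unfolding j_def by (rule LeastI, rule Least_le)
      have ne: "z \<noteq> \<beta> k" if "k \<le> n" for k using out that by auto
      then have "j \<noteq> 0" using z01 j \<beta>(2) ne[of 0] by (auto intro: gr0I)
      then have "\<not> z \<le> \<beta> (j - 1)" unfolding j_def by (intro not_less_Least) simp
      then have "z \<in> {\<beta> (j - 1)<..<\<beta> j}" using j ne[of j] by simp
      then have "p j = p i" using serve[of j z] j \<open>j \<noteq> 0\<close> z01 by simp
      then have "j = i" using permutes_inj[OF p(1)] by (simp add: inj_eq)
      then show False using out \<open>z \<in> {\<beta> (j - 1)<..<\<beta> j}\<close> by simp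
    qed
  qed
  have load: "load t f (p i) = \<beta> i - \<beta> (i - 1)" if i: "i \<in> {1..n}" for i
  proof -
    have "{\<beta> (i - 1)<..<\<beta> i} \<subseteq> clients_of t f (p i)"
    proof
      fix z assume z: "z \<in> {\<beta> (i - 1)<..<\<beta> i}"
      have "0 \<le> \<beta> (i - 1)" "\<beta> i \<le> 1" using mono[of 0 "i - 1"] mono[of i n] i \<beta> by auto
      then show "z \<in> clients_of t f (p i)" using serve[OF i z] z by (auto simp: clients_of_def)
    qed
    moreover have "\<beta> (i - 1) \<le> \<beta> i" using i by (intro mono) auto
    ultimately show ?thesis
      unfolding load_def by (intro measure_between(2)[OF _ cl_sub]) simp_all
  qed
  have nonneg: "0 \<le> load t f j" for j by (simp add: load_def)
  have pos: "0 < load t f j" if j: "j \<in> {1..n}" for j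
  proof (cases "\<alpha> = 0")
    case True
    have "0 < card {k \<in> {1..n}. t k = t j}" using j by (auto simp: card_gt_0_iff)
    then show ?thesis using es[OF True] j nearest_clients_positive[OF trange j]
      by (simp add: equal_sharing_def)
  next
    case False
    show ?thesis
    proof (rule ccontr)
      assume "\<not> 0 < load t f j"
      then have j0: "load t f j = 0" using nonneg[of j] by simp
      \<comment> \<open>An idle facility would attract clients: those close to it would pay less
        than \<open>\<alpha> * m\<close> there, whereas all but finitely many clients pay at least
        that, \<open>m\<close> being at most every positive load.\<close>
      define Z where "Z = {k \<in> {1..n}. load t f k = 0}"
      define N where "N = (\<Union>k\<in>Z. clients_of t f k)"
      have "finite (clients_of t f k)" if "k \<in> Z" for k
      proof -
        have k: "k \<in> {1..n}" "load t f k = 0" using that by (auto simp: Z_def)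
        obtain i where i: "i \<in> {1..n}" "k = p i" using cov[OF k(1)] by blast
        have "clients_of t f k \<subseteq> \<beta> ` {0..n}" using cl_sub[of i] load[OF i(1)] k(2) i(2) by auto
        then show ?thesis by (rule finite_subset) simp
      qed
      then have N: "finite N" by (simp add: N_def Z_def)
      define m where "m = Min (insert 1 (load t f ` ({1..n} - Z)))"
      have m0: "0 < m"
      proof -
        have "0 < x" if x: "x \<in> insert 1 (load t f ` ({1..n} - Z))" for x
        proof -
          consider "x = 1" | k where "k \<in> {1..n}" "k \<notin> Z" "x = load t f k" using x by blast
          then show ?thesis
          proof cases
            case 2
            then have "load t f k \<noteq> 0" by (simp add: Z_def)
            then show ?thesis using nonneg[of k] 2(3) by simp
          qed simp
        qed
        then show ?thesis unfolding m_def by (subst Min_gr_iff) auto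
      qed
      have m: "m \<le> load t f k" if "k \<in> {1..n}" "k \<notin> Z" for k
        unfolding m_def using that by (intro Min_le) auto
      have "0 < \<alpha> * m" using m0 False \<alpha> by simp
      then obtain u v where uv: "u < v" "{u..v} \<subseteq> {0..1}" "\<And>z. z \<in> {u..v} \<Longrightarrow> \<bar>t j - z\<bar> < \<alpha> * m"
        using interval_near[of "t j" "\<alpha> * m"] trange[OF j] by blast
      have "infinite ({u..v} - N)" using uv(1) N by (simp add: infinite_Icc Diff_infinite_finite)
      then obtain z where z: "z \<in> {u..v}" "z \<notin> N" by (metis Diff_iff ex_in_conv infinite_imp_nonempty)
      have z01: "z \<in> {0..1}" using z uv(2) by blast
      have "f t z \<notin> Z" using z z01 by (auto simp: N_def clients_of_def)
      then have "\<alpha> * m \<le> \<alpha> * load t f (f t z)" using m range[OF z01] \<alpha> by (intro mult_left_mono) auto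
      also have "\<dots> \<le> client_cost \<alpha> t f z" using \<alpha> by (simp add: client_cost_def facility_cost_def)
      also have "\<dots> \<le> facility_cost \<alpha> t f z j" using ce z01 j by (simp add: client_equilibrium_def)
      also have "\<dots> \<le> \<bar>t j - z\<bar>" using \<alpha> by (simp add: facility_cost_def j0 mult_left_le_one_le)
      finally show False using uv(3)[OF z(1)] by simp
    qed
  qed
  have cont: "continuous_on UNIV (\<lambda>z. facility_cost \<alpha> t f z k)" for k
    unfolding facility_cost_def by (intro continuous_intros)
  have favour: "facility_cost \<alpha> t f w (p i) \<le> facility_cost \<alpha> t f w (p k)"
    if "i \<in> {1..n}" "k \<in> {1..n}" "w \<in> {\<beta> (i - 1)..\<beta> i}" for i k w
  proof (rule le_at_endpoint[OF cont cont _ that(3)])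
    show "\<beta> (i - 1) < \<beta> i" using pos[of "p i"] load[OF that(1)] pin[of i] that(1) by simp
    fix z assume z: "z \<in> {\<beta> (i - 1)<..<\<beta> i}"
    have "0 \<le> \<beta> (i - 1)" "\<beta> i \<le> 1" using mono[of 0 "i - 1"] mono[of i n] that(1) \<beta> by auto
    then have "z \<in> {0..1}" using z by auto
    then have "client_cost \<alpha> t f z \<le> facility_cost \<alpha> t f z (p k)"
      using ce pin[of k] that(2) by (simp add: client_equilibrium_def)
    then show "facility_cost \<alpha> t f z (p i) \<le> facility_cost \<alpha> t f z (p k)"
      using serve[OF that(1) z] by (simp add: client_cost_def)
  qed
  have "boundaries n \<alpha> (t \<circ> p) \<beta>"
    unfolding boundaries_def
  proof (intro conjI allI impI)
    fix i assume i: "i < n - 1"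
    define A where "A = p (Suc i)"
    define B where "B = p (Suc (Suc i))"
    define w where "w = \<beta> (Suc i)"
    have ls: "load t f A = \<beta> (Suc i) - \<beta> i" "load t f B = \<beta> (Suc (Suc i)) - \<beta> (Suc i)"
      using load[of "Suc i"] load[of "Suc (Suc i)"] i by (simp_all add: A_def B_def)
    have "facility_cost \<alpha> t f w A \<le> facility_cost \<alpha> t f w B" "facility_cost \<alpha> t f w B \<le> facility_cost \<alpha> t f w A"
      unfolding A_def B_def using i by (intro favour; auto simp: w_def intro: mono)+
    then have cost: "facility_cost \<alpha> t f w A = facility_cost \<alpha> t f w B" by simp
    \<comment> \<open>For \<alpha> > 0 this is the cost equation; at \<alpha> = 0 co-located
      facilities have the same nearest clients and the rule of equal sharing applies.\<close>
    have "load t f A = load t f B" if same: "t A = t B"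
    proof (cases "\<alpha> = 0")
      case True
      have "A \<in> {1..n}" "B \<in> {1..n}" using pin i by (simp_all add: A_def B_def)
      then show ?thesis using es[OF True] same by (simp add: equal_sharing_def nearest_clients_def)
    next
      case False
      then show ?thesis using cost same by (simp add: facility_cost_def)
    qed
    then show "balanced \<alpha> (\<beta> (Suc i)) ((t \<circ> p) (Suc i), \<beta> (Suc i) - \<beta> i)
       ((t \<circ> p) (Suc (Suc i)), \<beta> (Suc (Suc i)) - \<beta> (Suc i))"
      using cost ls by (simp add: balanced_def facility_cost_def A_def B_def w_def)
  qed (use \<beta> mono in auto)
  then show ?thesis using that p load by blast
qed

text \<open>Sorting forgets which player stands where; the multiset of location-load pairs is what
  still links loads to players.\<close>

lemma induced_chain:
  assumes f: "induced_equilibria n \<alpha> f" and t: "t \<in> locations n" and \<alpha>: "0 \<le> \<alpha>" "\<alpha> \<le> 1"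
  obtains cs where "chain \<alpha> 0 cs" "sorted (map fst cs)" "total cs = 1"
    "mset cs = mset (map (\<lambda>i. (t i, load t f i)) [1..<Suc n])"
proof -
  obtain p \<beta> where p: "p permutes {1..n}" "mono_on {1..n} (t \<circ> p)" "boundaries n \<alpha> (t \<circ> p) \<beta>"
    and load: "\<And>i. i \<in> {1..n} \<Longrightarrow> load t f (p i) = \<beta> i - \<beta> (i - 1)"
    using induced_boundaries[OF assms] by blast
  define cs where "cs = map (\<lambda>i. ((t \<circ> p) i, \<beta> i - \<beta> (i - 1))) [1..<Suc n]"
  have "sorted (map fst cs)"
    using sorted_map_mono[OF p(2)] by (simp add: cs_def comp_def del: upt_Suc)
  moreover have "mset cs = mset (map (\<lambda>i. (t i, load t f i)) [1..<Suc n])"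
  proof -
    have set: "set [1..<Suc n] = {1..n}" by auto
    have "cs = map ((\<lambda>i. (t i, load t f i)) \<circ> p) [1..<Suc n]"
      unfolding cs_def using load set by (intro map_cong) auto
    then have "mset cs = image_mset (\<lambda>i. (t i, load t f i)) (image_mset p (mset_set {1..n}))"
      by (metis mset_map list.map_comp mset_set_set distinct_upt set)
    also have "image_mset p (mset_set {1..n}) = mset_set {1..n}"
      using permutes_inj_on[OF p(1)] permutes_image[OF p(1)] by (simp add: image_mset_mset_set)
    also have "image_mset (\<lambda>i. (t i, load t f i)) (mset_set {1..n}) = mset (map (\<lambda>i. (t i, load t f i)) [1..<Suc n])"
      by (metis mset_map mset_set_set distinct_upt set)
    finally show ?thesis .
  qed
  ultimately show ?thesis
    using boundaries_chain[OF p(3), folded cs_def] that by blast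
qed

section \<open>The paired locations\<close>

lemma spots_memE:
  assumes "x \<in> set (spots a m)"
  obtains c where "c < length m" "0 < m ! c" "x = a + 2 * real c"
proof -
  have "\<exists>c<length m. 0 < m ! c \<and> x = a + 2 * real c"
    using assms
  proof (induction m arbitrary: a)
    case (Cons M m)
    then consider "x = a" "0 < M" | "x \<in> set (spots (a + 2) m)" by auto
    then show ?case
    proof cases
      case 1
      then show ?thesis by (intro exI[of _ 0]) auto
    next
      case 2
      then obtain c where "c < length m" "0 < m ! c" "x = a + 2 + 2 * real c" using Cons.IH by blast
      then show ?thesis by (intro exI[of _ "Suc c"]) auto
    qed
  qed simp
  then show ?thesis using that by blast
qed

lemma mset_spots_remove:
  assumes "c < length m" "0 < m ! c"
  shows "mset (spots a m) = add_mset (a + 2 * real c) (mset (spots a (m[c := m ! c - 1])))"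
  using assms
proof (induction m arbitrary: a c)
  case (Cons M m)
  show ?case
  proof (cases c)
    case 0
    then obtain k where "M = Suc k" using Cons.prems by (cases M) auto
    then show ?thesis by (simp add: 0)
  next
    case (Suc j)
    then show ?thesis using Cons.IH[of j "a + 2"] Cons.prems by (simp add: algebra_simps)
  qed
qed simp

text \<open>The interface between the game and the polynomial tests: \<open>d\<close> and
  \<open>num\<close> encode the loads without deviation, and scaling by \<open>K\<close> puts the
  groups at odd integers. A deviation takes one facility out of group \<open>c\<close> and inserts
  one at \<open>K * x\<close>, which is all that \<open>ratio_bound\<close> has to know about the
  player.\<close>

lemma approx_SPE_ratio:
  fixes m :: "nat list"
  defines "K \<equiv> 2 * real (length m)"
  assumes \<alpha>: "0 \<le> \<alpha>" "\<alpha> \<le> 1" and f: "induced_equilibria n \<alpha> f" and s: "s \<in> locations n"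
    and m: "0 < length m" and spots: "map (\<lambda>i. K * s i) [1..<Suc n] = spots 1 m"
    and loads: "\<And>cs c i. chain \<alpha> 0 cs \<Longrightarrow> map fst cs = spots 1 m \<Longrightarrow> total cs = K \<Longrightarrow>
      c \<in> set cs \<Longrightarrow> fst c = 2 * real i + 1 \<Longrightarrow> i < length m \<Longrightarrow>
      0 < peval d \<alpha> \<and> peval d \<alpha> * snd c = peval (num i) \<alpha>"
    and test: "ratio_test N D d m (length m) num" and D: "0 < peval D \<alpha>"
  shows "approx_SPE n \<alpha> (peval N \<alpha> / peval D \<alpha>) s f"
proof -
  have K: "0 < K" using m by (simp add: K_def)
  have scaled: "\<exists>cs. chain \<alpha> 0 cs \<and> sorted (map fst cs) \<and> total cs = K \<and>
      mset cs = mset (map (\<lambda>i. (K * t i, K * load t f i)) [1..<Suc n])" if t: "t \<in> locations n" for t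
  proof -
    obtain cs where cs: "chain \<alpha> 0 cs" "sorted (map fst cs)" "total cs = 1"
      "mset cs = mset (map (\<lambda>i. (t i, load t f i)) [1..<Suc n])"
      using induced_chain[OF f t \<alpha>] by blast
    define cs' where "cs' = map (\<lambda>(t, l). (K * t, K * l)) cs"
    have "chain \<alpha> 0 cs'" using chain_scale[OF cs(1) K] by (simp add: cs'_def)
    moreover have "sorted (map fst cs')"
    proof -
      have "map fst cs' = map ((*) K) (map fst cs)" by (simp add: cs'_def case_prod_unfold)
      then show ?thesis using cs(2) K by (auto simp: sorted_iff_nth_mono)
    qed
    moreover have "total cs' = K"
    proof -
      have "total cs' = K * total cs"
        by (simp add: cs'_def case_prod_unfold comp_def sum_list_const_mult)
      then show ?thesis using cs(3) by simp
    qed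
    moreover have "mset cs' = mset (map (\<lambda>i. (K * t i, K * load t f i)) [1..<Suc n])"
    proof -
      have "mset cs' = image_mset (\<lambda>(t, l). (K * t, K * l)) (mset cs)" by (simp add: cs'_def)
      also have "\<dots> = mset (map (\<lambda>(t, l). (K * t, K * l)) (map (\<lambda>i. (t i, load t f i)) [1..<Suc n]))"
        unfolding cs(4) by (simp only: mset_map)
      also have "map (\<lambda>(t, l). (K * t, K * l)) (map (\<lambda>i. (t i, load t f i)) [1..<Suc n]) =
          map (\<lambda>i. (K * t i, K * load t f i)) [1..<Suc n]"
        by (simp only: map_map comp_def case_prod_conv)
      finally show ?thesis .
    qed
    ultimately show ?thesis by blast
  qed
  have member: "(K * t i, K * load t f i) \<in> set cs"
    if "mset cs = mset (map (\<lambda>i. (K * t i, K * load t f i)) [1..<Suc n])" "i \<in> {1..n}" for cs t i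
  proof -
    have "set cs = (\<lambda>i. (K * t i, K * load t f i)) ` {1..n}"
      using mset_eq_setD[OF that(1)] by (simp add: atLeastLessThanSuc_atLeastAtMost del: upt_Suc)
    then show ?thesis using that(2) by blast
  qed
  have locs: "mset (map fst cs) = mset (map (\<lambda>i. K * t i) [1..<Suc n])"
    if "mset cs = mset (map (\<lambda>i. (K * t i, K * load t f i)) [1..<Suc n])" for cs t
  proof -
    have "mset (map fst cs) = mset (map fst (map (\<lambda>i. (K * t i, K * load t f i)) [1..<Suc n]))"
      unfolding mset_map that ..
    then show ?thesis by (simp only: map_map comp_def fst_conv)
  qed
  obtain cs where cs: "chain \<alpha> 0 cs" "sorted (map fst cs)" "total cs = K"
      "mset cs = mset (map (\<lambda>i. (K * s i, K * load s f i)) [1..<Suc n])"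
    using scaled[OF s] by blast
  have fcs: "map fst cs = spots 1 m"
    using cs(2) sorted_spots locs[OF cs(4)] unfolding spots by (rule sorted_unique)
  have "load (s(i := x)) f i \<le> peval N \<alpha> / peval D \<alpha> * load s f i"
    if i: "i \<in> {1..n}" and x: "x \<in> {0..1}" for i x
  proof -
    have nth: "spots 1 m ! (i - 1) = K * s i" "i - 1 < length (spots 1 m)"
      unfolding spots[symmetric] using i by (auto simp del: upt_Suc)
    then have "K * s i \<in> set (spots 1 m)" by (metis nth_mem)
    then obtain c where c: "c < length m" "0 < m ! c" "K * s i = 1 + 2 * real c" by (rule spots_memE)
    have d: "0 < peval d \<alpha>" "peval d \<alpha> * (K * load s f i) = peval (num c) \<alpha>"
      using loads[OF cs(1) fcs cs(3) member[OF cs(4) i], of c] c by auto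
    have "s(i := x) \<in> locations n"
      using s i x by (auto simp: locations_def PiE_def Pi_def extensional_def)
    then obtain ds where ds: "chain \<alpha> 0 ds" "sorted (map fst ds)" "total ds = K"
        "mset ds = mset (map (\<lambda>j. (K * (s(i := x)) j, K * load (s(i := x)) f j)) [1..<Suc n])"
      using scaled by blast
    have upd: "map (\<lambda>j. K * (s(i := x)) j) [1..<Suc n] = (spots 1 m)[i - 1 := K * x]"
      unfolding spots[symmetric]
      by (rule nth_equalityI) (use i in \<open>auto simp: nth_list_update simp del: upt_Suc\<close>)
    have "mset (map fst ds) = add_mset (K * x) (mset (spots 1 m) - {#1 + 2 * real c#})"
      unfolding locs[OF ds(4)] upd using mset_update[OF nth(2)] nth(1) c(3) by simp
    also have "mset (spots 1 m) - {#1 + 2 * real c#} = mset (spots 1 (m[c := m ! c - 1]))"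
      using mset_spots_remove[OF c(1,2), of 1] by simp
    finally have e: "mset (map fst ds) = add_mset (K * x) (mset (spots 1 (m[c := m ! c - 1])))" .
    have "(K * x, K * load (s(i := x)) f i) \<in> set ds"
      using member[where t = "s(i := x)", OF ds(4) i] by simp
    then have "K * load (s(i := x)) f i \<le> peval N \<alpha> / peval D \<alpha> * (K * load s f i)"
      using ratio_bound[OF \<alpha> test c(1) ds(1,2) e _ _ _ D d] ds(3)
      unfolding K_def by (metis fst_conv snd_conv)
    then have "K * load (s(i := x)) f i \<le> K * (peval N \<alpha> / peval D \<alpha> * load s f i)"
      by (simp only: mult.left_commute)
    then show ?thesis using K by (simp only: mult_le_cancel_left_pos)
  qed
  then show ?thesis
    using s f by (auto simp: approx_SPE_def utility_def induced_equilibria_def)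
qed

lemma approx_SPE_even:
  assumes \<alpha>: "0 \<le> \<alpha>" "\<alpha> \<le> 1" and f: "induced_equilibria n \<alpha> f" and s: "s \<in> locations n"
    and m: "m = replicate (Suc k) 2"
    and spots: "map (\<lambda>i. 2 * real (length m) * s i) [1..<Suc n] = spots 1 m"
    and test: "ratio_test N D [1] m (length m) (\<lambda>_. [1])" and D: "0 < peval D \<alpha>"
  shows "approx_SPE n \<alpha> (peval N \<alpha> / peval D \<alpha>) s f"
proof (rule approx_SPE_ratio[OF \<alpha> f s _ spots _ test D])
  fix cs c i
  assume "chain \<alpha> 0 cs" "map fst cs = spots 1 m" "total cs = 2 * real (length m)"
    "c \<in> set cs" "fst c = 2 * real i + 1" "i < length m"
  then show "0 < peval [1] \<alpha> \<and> peval [1] \<alpha> * snd c = peval [1] \<alpha>"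
    using even_load[OF \<alpha>, of cs k c i] by (simp add: m)
qed (simp add: m)

lemma approx_SPE_odd:
  assumes \<alpha>: "0 \<le> \<alpha>" "\<alpha> \<le> 1" and f: "induced_equilibria n \<alpha> f" and s: "s \<in> locations n"
    and m: "m = replicate (Suc a) 2 @ 1 # replicate (Suc b) 2"
    and spots: "map (\<lambda>i. 2 * real (length m) * s i) [1..<Suc n] = spots 1 m"
    and test: "ratio_test N D (load_den a b) m (length m) (load_num a b)" and D: "0 < peval D \<alpha>"
  shows "approx_SPE n \<alpha> (peval N \<alpha> / peval D \<alpha>) s f"
proof (rule approx_SPE_ratio[OF \<alpha> f s _ spots _ test D])
  fix cs c i
  assume c: "chain \<alpha> 0 cs" "map fst cs = spots 1 m" "total cs = 2 * real (length m)"
    "c \<in> set cs" "fst c = 2 * real i + 1" "i < length m"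
  have sp: "spots 1 m = spots 1 (replicate (Suc a) 2) @
      (2 * real (Suc a) + 1) # spots (2 * real (Suc a) + 1 + 2) (replicate (Suc b) 2)"
    unfolding m spots_append by (simp add: algebra_simps)
  show "0 < peval (load_den a b) \<alpha> \<and> peval (load_den a b) \<alpha> * snd c = peval (load_num a b i) \<alpha>"
    using odd_load[OF \<alpha> c(1) _ _ _ c(4,5), of a b] c(2,3,6) sp sorted_spots[of 1 m] by (simp add: m)
qed (simp add: m)

lemma half_ceiling_eq: "half_ceiling n = (n + 1) div 2"
  unfolding half_ceiling_def by (cases "even n") (auto elim!: evenE oddE simp: ceiling_eq_iff nat_eq_iff)

lemma s_pair_locations: "1 \<le> n \<Longrightarrow> s_pair n \<in> locations n"
  unfolding locations_def
proof (rule PiE_I)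
  fix j assume n: "1 \<le> n" and j: "j \<in> {1..n}"
  define k where "k = half_ceiling n"
  have *: "paired k i \<in> {0..1}" if "1 \<le> i" "i \<le> 2 * k" for i
  proof -
    have i: "1 \<le> (i + 1) div 2" "(i + 1) div 2 \<le> k" using that by auto
    then have "1 \<le> real ((i + 1) div 2)" "real ((i + 1) div 2) \<le> real k" by linarith+
    then show ?thesis by (simp add: paired_def)
  qed
  \<comment> \<open>For odd \<open>n\<close> the omitted entry shifts the later indices by one, and
    \<open>n + 1 = 2 * k\<close>.\<close>
  have "j \<le> 2 * k" "odd n \<Longrightarrow> j + 1 \<le> 2 * k" using j by (auto simp: k_def half_ceiling_eq elim!: oddE)
  then show "s_pair n j \<in> {0..1}" using * j by (auto simp: s_pair_def Let_def k_def[symmetric])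
next
  fix j assume "j \<notin> {1..n}"
  then show "s_pair n j = undefined" by (auto simp: s_pair_def Let_def)
qed

lemma s_pair_apply:
  "s_pair n j = (if even n \<or> j \<le> (n + 1) div 2 then paired ((n + 1) div 2) j else paired ((n + 1) div 2) (j + 1))"
  if "1 \<le> j" "j \<le> n"
  using that by (simp only: s_pair_def half_ceiling_eq Let_def restrict_apply atLeastAtMost_iff simp_thms if_True)

lemma replicate_two: "replicate 2 x = [x, x]"
  by (simp add: numeral_2_eq_2)

lemma quotient_cong:
  fixes p q N D c :: real
  assumes "p = c * N" "q = c * D" "c \<noteq> 0"
  shows "p / q = N / D"
  using assms by simp

section \<open>Polynomial certificates for the seven ratios\<close>

lemma ratio_test_4: "ratio_test [4, 1, - 1] [4] [1] [2, 2] (length [2 :: nat, 2]) (\<lambda>_. [1])"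
  by code_simp

text \<open>The first two lists are the expanded numerator and denominator of \<open>rho 5\<close>,
  both multiplied by \<open>- 1\<close> to make the denominator positive. The omitted entry leaves
  the middle one of the three groups single.\<close>

lemma ratio_test_5: "ratio_test [16, 16, - 9, - 7, - 1] [16, 12, - 8, - 5]
    (load_den 0 0) [2, 1, 2] (length [2 :: nat, 1, 2]) (load_num 0 0)"
  by code_simp

lemma ratio_test_6: "ratio_test [16, - 4, - 7, 1] [16, - 8, - 2] [1] [2, 2, 2] (length [2 :: nat, 2, 2]) (\<lambda>_. [1])"
  by code_simp

text \<open>Omitting the fifth of eight entries leaves the third group single, so the stacks on its
  two sides differ: two pairs on the left, one on the right.\<close>

lemma ratio_test_7: "ratio_test [1024, - 1280, - 256, 560, 100, - 120, - 7, 7] [1024, - 1536, 256, 384, - 84, - 18, 2]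
    (load_den 1 0) [2, 2, 1, 2] (length [2 :: nat, 2, 1, 2]) (load_num 1 0)"
  by code_simp

lemma ratio_test_8: "ratio_test [64, - 48, - 24, 17, - 1] [64, - 64, 4, 4] [1] [2, 2, 2, 2] (length [2 :: nat, 2, 2, 2]) (\<lambda>_. [1])"
  by code_simp

lemma ratio_test_9: "ratio_test [512, - 256, - 352, 48, 98, 1, - 6] [512, - 384, - 192, 88, 22, - 1]
    (load_den 1 1) [2, 2, 1, 2, 2] (length [2 :: nat, 2, 1, 2, 2]) (load_num 1 1)"
  by code_simp

lemma ratio_test_10: "ratio_test [256, - 320, - 16, 120, - 31, 1] [256, - 384, 128, 16, - 6] [1] [2, 2, 2, 2, 2] (length [2 :: nat, 2, 2, 2, 2]) (\<lambda>_. [1])"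
  by code_simp

context
  fixes \<alpha> :: real
  assumes \<alpha>: "0 \<le> \<alpha>" "\<alpha> \<le> 1"
begin

text \<open>The margin of \<open>1\<close> turns the non-strict test into strict positivity; with
  the signs chosen, every denominator is at least \<open>1\<close> on the unit interval.\<close>

lemma peval_ge_1: "nonneg_test (psub D [1]) \<Longrightarrow> 0 < peval D \<alpha>"
  using nonneg_test[of "psub D [1]" \<alpha>] \<alpha> by simp

lemma approx_SPE_4:
  assumes f: "induced_equilibria 4 \<alpha> f"
  shows "approx_SPE 4 \<alpha> (rho 4 \<alpha>) (s_pair 4) f"
proof -
  have rho: "rho 4 \<alpha> = peval [4, 1, - 1] \<alpha> /
      peval [4] \<alpha>"
    by (simp add: rho_def algebra_simps power2_eq_square)
  have spots: "map (\<lambda>i. 2 * real (length [2 :: nat, 2]) * s_pair 4 i) [1..<Suc 4] = spots 1 [2, 2]"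
    by (simp add: s_pair_apply paired_def upt_rec replicate_two)
  have D: "0 < peval [4] \<alpha>"
    by (rule peval_ge_1) code_simp
  show ?thesis
    unfolding rho
    by (rule approx_SPE_even[where m = "[2, 2]" and k = "Suc 0", OF \<alpha> f s_pair_locations _ spots _ D])
      (use ratio_test_4 in simp_all)
qed

lemma approx_SPE_5:
  assumes f: "induced_equilibria 5 \<alpha> f"
  shows "approx_SPE 5 \<alpha> (rho 5 \<alpha>) (s_pair 5) f"
proof -
  have rho: "rho 5 \<alpha> = peval [16, 16, - 9, - 7, - 1] \<alpha> /
      peval [16, 12, - 8, - 5] \<alpha>"
    unfolding rho_def
    by (simp, rule quotient_cong[where c = "- 1"])
      (simp_all add: algebra_simps power2_eq_square power3_eq_cube)
  have spots: "map (\<lambda>i. 2 * real (length [2 :: nat, 1, 2]) * s_pair 5 i) [1..<Suc 5] = spots 1 [2, 1, 2]"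
    by (simp add: s_pair_apply paired_def upt_rec replicate_two)
  have D: "0 < peval [16, 12, - 8, - 5] \<alpha>"
    by (rule peval_ge_1) code_simp
  show ?thesis
    unfolding rho
    by (rule approx_SPE_odd[where m = "[2, 1, 2]" and a = "0" and b = "0", OF \<alpha> f s_pair_locations _ spots _ D])
      (use ratio_test_5 in simp_all)
qed

lemma approx_SPE_6:
  assumes f: "induced_equilibria 6 \<alpha> f"
  shows "approx_SPE 6 \<alpha> (rho 6 \<alpha>) (s_pair 6) f"
proof -
  have rho: "rho 6 \<alpha> = peval [16, - 4, - 7, 1] \<alpha> /
      peval [16, - 8, - 2] \<alpha>"
    unfolding rho_def
    by (simp, rule quotient_cong[where c = "- 1"])
      (simp_all add: algebra_simps power2_eq_square power3_eq_cube)
  have spots: "map (\<lambda>i. 2 * real (length [2 :: nat, 2, 2]) * s_pair 6 i) [1..<Suc 6] = spots 1 [2, 2, 2]"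
    by (simp add: s_pair_apply paired_def upt_rec replicate_two)
  have D: "0 < peval [16, - 8, - 2] \<alpha>"
    by (rule peval_ge_1) code_simp
  show ?thesis
    unfolding rho
    by (rule approx_SPE_even[where m = "[2, 2, 2]" and k = "Suc (Suc 0)", OF \<alpha> f s_pair_locations _ spots _ D])
      (use ratio_test_6 in simp_all)
qed

lemma approx_SPE_7:
  assumes f: "induced_equilibria 7 \<alpha> f"
  shows "approx_SPE 7 \<alpha> (rho 7 \<alpha>) (s_pair 7) f"
proof -
  have rho: "rho 7 \<alpha> = peval [1024, - 1280, - 256, 560, 100, - 120, - 7, 7] \<alpha> /
      peval [1024, - 1536, 256, 384, - 84, - 18, 2] \<alpha>"
    unfolding rho_def
    by (simp, rule quotient_cong[where c = "1"])
      (simp_all add: algebra_simps power2_eq_square power3_eq_cube)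
  have spots: "map (\<lambda>i. 2 * real (length [2 :: nat, 2, 1, 2]) * s_pair 7 i) [1..<Suc 7] = spots 1 [2, 2, 1, 2]"
    by (simp add: s_pair_apply paired_def upt_rec replicate_two)
  have D: "0 < peval [1024, - 1536, 256, 384, - 84, - 18, 2] \<alpha>"
    by (rule peval_ge_1) code_simp
  show ?thesis
    unfolding rho
    by (rule approx_SPE_odd[where m = "[2, 2, 1, 2]" and a = "Suc 0" and b = "0", OF \<alpha> f s_pair_locations _ spots _ D])
      (use ratio_test_7 in simp_all)
qed

lemma approx_SPE_8:
  assumes f: "induced_equilibria 8 \<alpha> f"
  shows "approx_SPE 8 \<alpha> (rho 8 \<alpha>) (s_pair 8) f"
proof -
  have rho: "rho 8 \<alpha> = peval [64, - 48, - 24, 17, - 1] \<alpha> /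
      peval [64, - 64, 4, 4] \<alpha>"
    unfolding rho_def
    by (simp, rule quotient_cong[where c = "1"])
      (simp_all add: algebra_simps power2_eq_square power3_eq_cube)
  have spots: "map (\<lambda>i. 2 * real (length [2 :: nat, 2, 2, 2]) * s_pair 8 i) [1..<Suc 8] = spots 1 [2, 2, 2, 2]"
    by (simp add: s_pair_apply paired_def upt_rec replicate_two)
  have D: "0 < peval [64, - 64, 4, 4] \<alpha>"
    by (rule peval_ge_1) code_simp
  show ?thesis
    unfolding rho
    by (rule approx_SPE_even[where m = "[2, 2, 2, 2]" and k = "Suc (Suc (Suc 0))", OF \<alpha> f s_pair_locations _ spots _ D])
      (use ratio_test_8 in simp_all)
qed

lemma approx_SPE_9:
  assumes f: "induced_equilibria 9 \<alpha> f"
  shows "approx_SPE 9 \<alpha> (rho 9 \<alpha>) (s_pair 9) f"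
proof -
  have rho: "rho 9 \<alpha> = peval [512, - 256, - 352, 48, 98, 1, - 6] \<alpha> /
      peval [512, - 384, - 192, 88, 22, - 1] \<alpha>"
    unfolding rho_def
    by (simp, rule quotient_cong[where c = "- 1"])
      (simp_all add: algebra_simps power2_eq_square power3_eq_cube)
  have spots: "map (\<lambda>i. 2 * real (length [2 :: nat, 2, 1, 2, 2]) * s_pair 9 i) [1..<Suc 9] = spots 1 [2, 2, 1, 2, 2]"
    by (simp add: s_pair_apply paired_def upt_rec replicate_two)
  have D: "0 < peval [512, - 384, - 192, 88, 22, - 1] \<alpha>"
    by (rule peval_ge_1) code_simp
  show ?thesis
    unfolding rho
    by (rule approx_SPE_odd[where m = "[2, 2, 1, 2, 2]" and a = "Suc 0" and b = "Suc 0", OF \<alpha> f s_pair_locations _ spots _ D])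
      (use ratio_test_9 in simp_all)
qed

lemma approx_SPE_10:
  assumes f: "induced_equilibria 10 \<alpha> f"
  shows "approx_SPE 10 \<alpha> (rho 10 \<alpha>) (s_pair 10) f"
proof -
  have rho: "rho 10 \<alpha> = peval [256, - 320, - 16, 120, - 31, 1] \<alpha> /
      peval [256, - 384, 128, 16, - 6] \<alpha>"
    unfolding rho_def
    by (simp, rule quotient_cong[where c = "- 1"])
      (simp_all add: algebra_simps power2_eq_square power3_eq_cube)
  have spots: "map (\<lambda>i. 2 * real (length [2 :: nat, 2, 2, 2, 2]) * s_pair 10 i) [1..<Suc 10] = spots 1 [2, 2, 2, 2, 2]"
    by (simp add: s_pair_apply paired_def upt_rec replicate_two)
  have D: "0 < peval [256, - 384, 128, 16, - 6] \<alpha>"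
    by (rule peval_ge_1) code_simp
  show ?thesis
    unfolding rho
    by (rule approx_SPE_even[where m = "[2, 2, 2, 2, 2]" and k = "Suc (Suc (Suc (Suc 0)))", OF \<alpha> f s_pair_locations _ spots _ D])
      (use ratio_test_10 in simp_all)
qed

end

theorem theorem5:
  fixes n :: nat and \<alpha> :: real
  assumes "0 \<le> \<alpha>" and "\<alpha> \<le> 1" and "4 \<le> n" and "n \<le> 10"
  shows "(\<exists>f. induced_equilibria n \<alpha> f) \<and>
    (\<forall>f. induced_equilibria n \<alpha> f \<longrightarrow> approx_SPE n \<alpha> (rho n \<alpha>) (s_pair n) f)"
proof
  show "\<exists>f. induced_equilibria n \<alpha> f"
    using assms by (intro induced_equilibria_exist) auto
  show "\<forall>f. induced_equilibria n \<alpha> f \<longrightarrow> approx_SPE n \<alpha> (rho n \<alpha>) (s_pair n) f"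
  proof (intro allI impI)
    fix f assume f: "induced_equilibria n \<alpha> f"
    consider "n = 4" | "n = 5" | "n = 6" | "n = 7" | "n = 8" | "n = 9" | "n = 10"
      using assms(3,4) by linarith
    then show "approx_SPE n \<alpha> (rho n \<alpha>) (s_pair n) f"
      using f approx_SPE_4[OF assms(1,2)] approx_SPE_5[OF assms(1,2)] approx_SPE_6[OF assms(1,2)]
        approx_SPE_7[OF assms(1,2)] approx_SPE_8[OF assms(1,2)] approx_SPE_9[OF assms(1,2)]
        approx_SPE_10[OF assms(1,2)]
      by cases simp_all
  qed
qed

end
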